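(* Assume: (F) $F_0$ has bounded support $\mathcal{S}_0=[0,M_0]$ and is strictly increasing on $\mathcal{S}_0$ with density $f_0$, strictly staying away from zero on $\mathcal{S}_0$; (G) $G$ has support $[0,\infty)$, is strictly increasing on $\mathcal{S}_0$ with density $g$ staying away from zero on $\mathcal{S}_0$, and $g'$ is bounded on $\mathcal{S}_0$. Fix $t>0$ such that $f_0'$ is continuous at $t$ and $f_0'(t)\ne0$. Let $h=cn^{-1/5}$ ($c>0$) be the bandwidth used in the definition of $\hat F_n^{\mathrm{SM}}$. Then, as $n\to\infty$, $$n^{2/5}\big(\hat F_n^{\mathrm{SM}}(t)-F_0(t)\big)\rightsquigarrow\mathcal{N}(\mu_{F,\mathrm{SM}},\sigma^2_{F,\mathrm{SM}}),$$ where $$\mu_{F,\mathrm{SM}}=\tfrac12c^2m_2(k)f_0'(t),\qquad\sigma^2_{F,\mathrm{SM}}=\frac{F_0(t)(1-F_0(t))}{cg(t)}\int k(u)^2\,du.$$ For fixed $t$, the aMSE-optimal bandwidth for $\hat F_n^{\mathrm{SM}}(t)$ is $h_{n,F,\mathrm{SM}}=c_{F,\mathrm{SM}}n^{-1/5}$, where $$c_{F,\mathrm{SM}}=\Big\{\frac{F_0(t)(1-F_0(t))}{g(t)}\int k(u)^2\,du\Big\}^{1/5}\{m_2^2(k)f_0'(t)^2\}^{-1/5};$$ that is, $c_{F,\mathrm{SM}}$ minimizes the asymptotic mean squared error $\mu_{F,\mathrm{SM}}^2+\sigma_{F,\mathrm{SM}}^2$ over $c>0$.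
   Context: Current status model: $X_1,X_2,\dots$ are i.i.d. with distribution function $F_0$ on $[0,\infty)$, and, independently, $T_1,T_2,\dots$ are i.i.d. with distribution function $G$ on $[0,\infty)$ having Lebesgue density $g$. One observes $(T_i,\Delta_i)$, $1\le i\le n$, with $\Delta_i=1_{\{X_i\le T_i\}}$. The (nonparametric) maximum likelihood estimator $\hat F_n$ maximizes $\frac1n\sum_{i=1}^n\{\Delta_i\log F(T_i)+(1-\Delta_i)\log(1-F(T_i))\}$ over all distribution functions $F$. Explicitly: let $T_{(1)}<\dots<T_{(n)}$ be the ordered $T_i$ and $\Delta_{(i)}$ the indicator associated with $T_{(i)}$; let $P_0=(0,0)$, $P_i=(i/n,\frac1n\sum_{j\le i}\Delta_{(j)})$. Then $\hat F_n(T_{(i)})$ is the left derivative at $P_i$ of the greatest convex minorant of the points $P_0,\dots,P_n$; elsewhere $\hat F_n$ is the right-continuous step function determined by these values (equal to $0$ on $[0,T_{(1)})$). Kernel: $k$ is a probability density with support $[-1,1]$, symmetric and twice continuously differentiable on $\mathbb{R}$; $m_2(k)=\int u^2k(u)\,du$; $K(t)=\int_{-\infty}^tk(u)\,du$ and $K_h(u)=K(u/h)$. The smoothed maximum likelihood estimator (SMLE) is $\hat F_n^{\mathrm{SM}}(t)=\int K_h(t-u)\,d\hat F_n(u)$. The symbol $\rightsquigarrow$ denotes convergence in distribution. *)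

theory Defs
  imports "HOL-Probability.Probability"
begin

definition dist_support :: "real measure \<Rightarrow> real set" where
  "dist_support \<mu> = {x. \<forall>U. open U \<and> x \<in> U \<longrightarrow> 0 < emeasure \<mu> U}"

subsection \<open>The maximum likelihood estimator\<close>

text \<open>
  The data are sequences \<open>T\<close> (inspection times) and \<open>\<Delta>\<close> (indicators), of which the entries with
  index \<open>0, \<dots>, n - 1\<close> are used.
\<close>

definition gcm :: "real set \<Rightarrow> (real \<times> real) set \<Rightarrow> real \<Rightarrow> real" where
  "gcm S P x = (SUP H \<in> {H. convex_on S H \<and> (\<forall>(u, v) \<in> P. H u \<le> v)}. H x)"

text \<open>
  \<open>sort_key T [0..<n]\<close> lists the indices in increasing order of the inspection times, so that
  \<open>ordered_ind n T \<Delta> j\<close> is the indicator belonging to the \<open>(j+1)\<close>-st smallest time. Ties, which have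
  probability 0 when the times have a density, are broken by the index.
\<close>

definition ordered_ind :: "nat \<Rightarrow> (nat \<Rightarrow> real) \<Rightarrow> (nat \<Rightarrow> real) \<Rightarrow> nat \<Rightarrow> real" where
  "ordered_ind n T \<Delta> j = \<Delta> (sort_key T [0..<n] ! j)"

definition cusum_points :: "nat \<Rightarrow> (nat \<Rightarrow> real) \<Rightarrow> (nat \<Rightarrow> real) \<Rightarrow> (real \<times> real) set" where
  "cusum_points n T \<Delta> = (\<lambda>i. (real i / real n, (\<Sum>j<i. ordered_ind n T \<Delta> j) / real n)) ` {..n}"

text \<open>
  If \<open>m\<close> of the times are \<open>\<le> x\<close>, then \<open>x\<close> lies between the \<open>m\<close>-th and the \<open>(m+1)\<close>-st smallest time,
  and the right-continuous step function takes at \<open>x\<close> its value at the \<open>m\<close>-th smallest time.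
\<close>

definition mle :: "nat \<Rightarrow> (nat \<Rightarrow> real) \<Rightarrow> (nat \<Rightarrow> real) \<Rightarrow> real \<Rightarrow> real" where
  "mle n T \<Delta> x =
    (let m = card {i. i < n \<and> T i \<le> x}
     in if m = 0 then 0
        else vector_derivative (gcm {0..1} (cusum_points n T \<Delta>)) (at_left (real m / real n)))"

subsection \<open>The smoothed maximum likelihood estimator\<close>

definition smooth_kernel :: "(real \<Rightarrow> real) \<Rightarrow> bool" where
  "smooth_kernel k \<longleftrightarrow>
    (\<forall>u. 0 \<le> k u) \<and> has_bochner_integral lborel k 1 \<and>
    closure {u. k u \<noteq> 0} = {-1..1} \<and>
    (\<forall>u. k (- u) = k u) \<and>
    (\<forall>u. k differentiable (at u)) \<and> (\<forall>u. deriv k differentiable (at u)) \<and>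
    continuous_on UNIV (deriv (deriv k))"

definition second_moment :: "(real \<Rightarrow> real) \<Rightarrow> real" where
  "second_moment k = (\<integral>u. u\<^sup>2 * k u \<partial>lborel)"

definition integrated_kernel :: "(real \<Rightarrow> real) \<Rightarrow> real \<Rightarrow> real" where
  "integrated_kernel k x = (LINT u:{..x}|lborel. k u)"

text \<open>
  The integral is with respect to the Stieltjes measure of the estimator. The latter may stay
  below 1, but any mass missing at infinity would not contribute, since the integrand vanishes for
  \<open>u > t + h\<close>.
\<close>

definition smle ::
    "(real \<Rightarrow> real) \<Rightarrow> real \<Rightarrow> nat \<Rightarrow> (nat \<Rightarrow> real) \<Rightarrow> (nat \<Rightarrow> real) \<Rightarrow> real \<Rightarrow> real" where
  "smle k h n T \<Delta> t =
    (\<integral>u. integrated_kernel k ((t - u) / h) \<partial>(interval_measure (mle n T \<Delta>)))"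

subsection \<open>Asymptotic bias, variance and mean squared error\<close>

definition mu_SM :: "(real \<Rightarrow> real) \<Rightarrow> (real \<Rightarrow> real) \<Rightarrow> real \<Rightarrow> real \<Rightarrow> real" where
  "mu_SM k f\<^sub>0 t c = 1/2 * c\<^sup>2 * second_moment k * deriv f\<^sub>0 t"

definition sigma2_SM ::
    "(real \<Rightarrow> real) \<Rightarrow> (real \<Rightarrow> real) \<Rightarrow> (real \<Rightarrow> real) \<Rightarrow> real \<Rightarrow> real \<Rightarrow> real" where
  "sigma2_SM k F\<^sub>0 g t c = F\<^sub>0 t * (1 - F\<^sub>0 t) / (c * g t) * (\<integral>u. (k u)\<^sup>2 \<partial>lborel)"

definition amse_SM ::
    "(real \<Rightarrow> real) \<Rightarrow> (real \<Rightarrow> real) \<Rightarrow> (real \<Rightarrow> real) \<Rightarrow> (real \<Rightarrow> real) \<Rightarrow> real \<Rightarrow> real \<Rightarrow> real" where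
  "amse_SM k F\<^sub>0 f\<^sub>0 g t c = (mu_SM k f\<^sub>0 t c)\<^sup>2 + sigma2_SM k F\<^sub>0 g t c"

definition c_SM ::
    "(real \<Rightarrow> real) \<Rightarrow> (real \<Rightarrow> real) \<Rightarrow> (real \<Rightarrow> real) \<Rightarrow> (real \<Rightarrow> real) \<Rightarrow> real \<Rightarrow> real" where
  "c_SM k F\<^sub>0 f\<^sub>0 g t =
    (F\<^sub>0 t * (1 - F\<^sub>0 t) / g t * (\<integral>u. (k u)\<^sup>2 \<partial>lborel)) powr (1/5)
    * ((second_moment k)\<^sup>2 * (deriv f\<^sub>0 t)\<^sup>2) powr (- 1/5)"

end

theory Submission
  imports Defs "HOL-Real_Asymp.Real_Asymp"
begin

text \<open>
  Write \<open>F\<close>, \<open>G\<close> for the two distribution functions, \<open>\<epsilon>\<^sub>i = \<Delta>\<^sub>i - F (T\<^sub>i)\<close> and \<open>h = c n powr (-1/5)\<close>. Integration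
  by parts turns the smoothed estimator into \<open>\<integral> k\<^sub>h (t - v) mle v dv\<close>, and with
  \<open>\<phi> v = k\<^sub>h (t - v) / g v\<close> its distance to the smoothed \<open>F\<close> is \<open>\<integral> \<phi> (mle - F) dG\<close>. The core of the
  proof is that this integral equals \<open>(\<Sum>i<n. \<phi> (T\<^sub>i) \<epsilon>\<^sub>i) / n\<close> up to \<open>o (n powr (-2/5))\<close>. Two replacements
  lead from one to the other.

  First, \<open>G\<close> is replaced by the empirical distribution function \<open>G\<^sub>n\<close> of the times. The integrand
  \<open>\<phi> (mle - F)\<close> is a combination of four products of monotone functions whose total range stays bounded
  as \<open>n\<close> grows: \<open>\<phi>\<close> has size \<open>1/h\<close>, but \<open>mle\<close> and \<open>F\<close> vary only by a multiple of \<open>h\<close> over the support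
  of \<open>\<phi>\<close>. Hence (\<open>product_integral_close\<close>) the error is at most a constant times the supremum distance
  of \<open>G\<^sub>n\<close> and \<open>G\<close>, which is below \<open>n powr (-9/20)\<close> with high probability.

  Second, \<open>mle\<close> is replaced by \<open>\<Delta>\<close> under the empirical integral. The differences \<open>mle (T\<^sub>i) - \<Delta>\<^sub>i\<close> are, up
  to sign and a factor \<open>n\<close>, the increments of the gap between the greatest convex minorant and the cumulative sum
  diagram, so summation by parts bounds the error by the variation of \<open>\<phi>\<close>, which is of order \<open>1/h\<close>, times
  the gap near \<open>t\<close> (\<open>weighted_residuals_small\<close>). The gap is of order \<open>\<delta>\<^sup>2\<close> for \<open>\<delta>\<close> slightly above
  \<open>n powr (-1/3)\<close>: a straight line of slope \<open>F x\<close> lying that little below the diagram is still a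
  minorant, because away from \<open>x\<close> the diagram rises above its tangent faster than the noise can pull it
  down (\<open>cusum_above_C\<close>). As \<open>\<delta>\<^sup>2 / h\<close> is \<open>o (n powr (-2/5))\<close>, this suffices. What
  these steps require of the noise is a bound by \<open>sqrt ((r - l) L)\<close>, with \<open>L\<close> logarithmic in \<open>n\<close>, of every sum of the \<open>\<epsilon>\<^sub>i\<close> over consecutive
  ordered times; it follows from Hoeffding's inequality conditionally on the times
  (\<open>good_event_likely\<close>).

  What remains is classical. The linear statistic obeys a central limit theorem for bounded triangular
  arrays, a Taylor expansion of \<open>F\<close> at \<open>t\<close> gives the bias, and characteristic functions absorb the
  remainder (\<open>slutsky_weak_conv\<close>). The asymptotic mean squared error has the form \<open>A c\<^sup>4 + V / c\<close>, whose
  unique minimizer is explicit.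
\<close>

section \<open>The greatest convex minorant of a cumulative sum diagram\<close>

text \<open>
  The points \<open>(i / n, v i)\<close> for \<open>i \<le> n\<close>. The minorant \<open>C\<close> turns out to be the piecewise linear
  interpolation of its values on this grid.
\<close>

locale grid_points =
  fixes n :: nat and v :: "nat \<Rightarrow> real"
  assumes n_pos: "0 < n" and v_nonneg: "\<And>i. 0 \<le> v i" and v_0: "v 0 = 0"
begin

definition C :: "real \<Rightarrow> real" where
  "C = gcm {0..1} ((\<lambda>i. (real i / real n, v i)) ` {..n})"

definition minorants :: "(real \<Rightarrow> real) set" where
  "minorants = {H. convex_on {0..1} H \<and> (\<forall>i\<le>n. H (real i / real n) \<le> v i)}"

lemma C_eq: "C x = (SUP H\<in>minorants. H x)"
  unfolding C_def gcm_def minorants_def by (rule arg_cong[where f = Sup]) auto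

lemma zero_minorant: "(\<lambda>_. 0) \<in> minorants"
  using v_nonneg by (simp add: minorants_def convex_on_def)

text \<open>
  The supremum that defines the minorant is finite: convexity bounds every competitor by its values
  at the ends of the unit interval.
\<close>

lemma minorant_le_max:
  assumes "H \<in> minorants" "x \<in> {0..1}"
  shows "H x \<le> v n"
proof -
  have H: "convex_on {0..1} H" and e: "H 0 \<le> 0" "H 1 \<le> v n"
    using assms(1) n_pos v_0 by (auto simp: minorants_def dest: spec[of _ 0] spec[of _ n])
  have "H ((1 - x) *\<^sub>R 0 + x *\<^sub>R 1) \<le> (1 - x) * H 0 + x * H 1"
    using assms(2) by (intro convex_onD[OF H]) auto
  also have "\<dots> \<le> (1 - x) * 0 + x * v n"
    using assms(2) e by (intro add_mono mult_left_mono) auto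
  also have "\<dots> \<le> v n"
    using assms(2) v_nonneg[of n] by (simp add: mult_left_le_one_le)
  finally show ?thesis by simp
qed

lemma minorant_le_C: "H \<in> minorants \<Longrightarrow> x \<in> {0..1} \<Longrightarrow> H x \<le> C x"
  unfolding C_eq by (rule cSUP_upper) (auto intro!: bdd_aboveI2 minorant_le_max)

lemma C_leI: "(\<And>H. H \<in> minorants \<Longrightarrow> H x \<le> y) \<Longrightarrow> C x \<le> y"
  unfolding C_eq using zero_minorant by (intro cSUP_least) auto

lemma C_le_points: "i \<le> n \<Longrightarrow> C (real i / real n) \<le> v i"
  by (rule C_leI) (auto simp: minorants_def)

lemma C_nonneg: "x \<in> {0..1} \<Longrightarrow> 0 \<le> C x"
  using minorant_le_C[OF zero_minorant] .

lemma C_0: "C 0 = 0"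
  using C_nonneg[of 0] C_le_points[of 0] v_0 by simp

lemma C_convex: "convex_on {0..1} C"
proof (rule convex_onI)
  fix s x y :: real assume s: "0 < s" "s < 1" and x: "x \<in> {0..1}" and y: "y \<in> {0..1}"
  show "C ((1 - s) *\<^sub>R x + s *\<^sub>R y) \<le> (1 - s) * C x + s * C y"
  proof (rule C_leI)
    fix H assume H: "H \<in> minorants"
    then have "H ((1 - s) *\<^sub>R x + s *\<^sub>R y) \<le> (1 - s) * H x + s * H y"
      using s x y by (intro convex_onD) (auto simp: minorants_def)
    also have "\<dots> \<le> (1 - s) * C x + s * C y"
      using s x y H by (intro add_mono mult_left_mono minorant_le_C) auto
    finally show "H ((1 - s) *\<^sub>R x + s *\<^sub>R y) \<le> (1 - s) * C x + s * C y" .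
  qed
qed auto

lemma grid_in: "i \<le> n \<Longrightarrow> real i / real n \<in> {0..1}"
  using n_pos by auto

lemma affine_minorant:
  assumes "\<And>i. i \<le> n \<Longrightarrow> a + b * (real i / real n) \<le> v i" "x \<in> {0..1}"
  shows "a + b * x \<le> C x"
proof -
  have "(\<lambda>x. a + b * x) \<in> minorants"
    using assms(1) by (auto simp: minorants_def convex_on_def algebra_simps simp flip: distrib_left)
       (auto simp flip: distrib_right mult.assoc)
  then show ?thesis using minorant_le_C assms(2) by blast
qed

abbreviation slope :: "nat \<Rightarrow> real" where
  "slope i \<equiv> real n * (C (real (Suc i) / real n) - C (real i / real n))"

text \<open>
  Over a grid cell the minorant is its own chord \<open>l\<close>: the maximum of \<open>C\<close> and \<open>l\<close> is convex, and it agrees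
  with \<open>C\<close> at every grid point since \<open>l\<close> exceeds \<open>C\<close> only inside the cell. It is thus a competitor, whence
  \<open>l \<le> C\<close> on the cell; the other inequality is convexity.
\<close>

lemma C_linear:
  assumes i: "i < n" and x: "x \<in> {real i / n .. real (Suc i) / n}"
  shows "C x = C (real i / n) + slope i * (x - real i / n)"
proof -
  define a b where "a = real i / n" and "b = real (Suc i) / n"
  have ab: "a < b" "b - a = 1 / n" "a \<in> {0..1}" "b \<in> {0..1}"
    using i n_pos by (auto simp: a_def b_def field_simps)
  define l where "l y = C a + slope i * (y - a)" for y
  have la: "l a = C a" by (simp add: l_def)
  have sl: "slope i = (C b - C a) / (b - a)"
    using ab(2) n_pos by (simp add: a_def b_def field_simps)
  have lb: "l b = C b"
    using ab(1) unfolding l_def sl by simp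
  have inside: "C y \<le> l y" if y: "y \<in> {a..b}" for y
  proof -
    define s where "s = (y - a) / (b - a)"
    have "s * (b - a) = y - a" using ab(1) by (simp add: s_def)
    moreover have "(1 - s) *\<^sub>R a + s *\<^sub>R b = a + s * (b - a)" by (simp add: algebra_simps)
    ultimately have s: "s \<in> {0..1}" "y = (1 - s) *\<^sub>R a + s *\<^sub>R b"
      using y ab(1) by (simp_all add: s_def)
    have "C y \<le> (1 - s) * C a + s * C b"
      unfolding s(2) using s(1) ab by (intro convex_onD[OF C_convex]) auto
    also have "\<dots> = C a + s * (C b - C a)" by (simp add: algebra_simps)
    also have "\<dots> = l y" unfolding l_def sl s_def by simp
    finally show ?thesis .
  qed
  have outside: "l y \<le> C y" if y: "y \<in> {0..1}" "y \<le> a \<or> b \<le> y" for y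
  proof -
    consider "y = a" | "y = b" | "y < a" | "b < y" using y(2) ab(1) by fastforce
    then show ?thesis
    proof cases
      case 3
      have "(C y - C b) / (y - b) \<le> (C a - C b) / (a - b)"
        using convex_on_slope_le[OF C_convex, of y b a] 3 ab y by auto
      then have "(C b - C y) / (b - y) \<le> slope i"
        unfolding sl by (metis minus_diff_eq minus_divide_divide)
      then have "C b - C y \<le> slope i * (b - y)"
        using 3 ab(1) by (simp add: pos_divide_le_eq)
      then show ?thesis using lb by (simp add: l_def algebra_simps)
    next
      case 4
      have "(C a - C b) / (a - b) \<le> (C a - C y) / (a - y)"
        using convex_on_slope_le[OF C_convex, of a y b] 4 ab y by auto
      then have "(C b - C a) / (b - a) \<le> (C y - C a) / (y - a)"
        by (metis minus_diff_eq minus_divide_divide)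
      then have "slope i * (y - a) \<le> C y - C a"
        unfolding sl using 4 ab(1) by (simp add: pos_le_divide_eq)
      then show ?thesis by (simp add: l_def algebra_simps)
    qed (auto simp: la lb)
  qed
  have "(\<lambda>y. max (C y) (l y)) \<in> minorants"
    unfolding minorants_def
  proof (intro CollectI conjI allI impI)
    have l_convex: "convex_on {0..1} l"
      by (auto simp: convex_on_def l_def algebra_simps simp flip: distrib_left)
         (auto simp flip: distrib_right mult.assoc)
    show "convex_on {0..1} (\<lambda>y. max (C y) (l y))"
    proof (rule convex_onI)
      fix s x y :: real assume s: "0 < s" "s < 1" and x: "x \<in> {0..1}" and y: "y \<in> {0..1}"
      show "max (C ((1 - s) *\<^sub>R x + s *\<^sub>R y)) (l ((1 - s) *\<^sub>R x + s *\<^sub>R y))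
          \<le> (1 - s) * max (C x) (l x) + s * max (C y) (l y)"
      proof (rule max.boundedI)
        have "C ((1 - s) *\<^sub>R x + s *\<^sub>R y) \<le> (1 - s) * C x + s * C y"
          using s x y by (intro convex_onD[OF C_convex]) auto
        also have "\<dots> \<le> (1 - s) * max (C x) (l x) + s * max (C y) (l y)"
          using s by (intro add_mono mult_left_mono) auto
        finally show "C ((1 - s) *\<^sub>R x + s *\<^sub>R y) \<le> (1 - s) * max (C x) (l x) + s * max (C y) (l y)" .
        have "l ((1 - s) *\<^sub>R x + s *\<^sub>R y) \<le> (1 - s) * l x + s * l y"
          using s x y by (intro convex_onD[OF l_convex]) auto
        also have "\<dots> \<le> (1 - s) * max (C x) (l x) + s * max (C y) (l y)"
          using s by (intro add_mono mult_left_mono) auto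
        finally show "l ((1 - s) *\<^sub>R x + s *\<^sub>R y) \<le> (1 - s) * max (C x) (l x) + s * max (C y) (l y)" .
      qed
    qed auto
  next
    fix j assume j: "j \<le> n"
    have "real j / n \<le> a \<or> b \<le> real j / n"
      using n_pos by (auto simp: a_def b_def divide_simps)
    then show "max (C (real j / real n)) (l (real j / real n)) \<le> v j"
      using outside[of "real j / n"] C_le_points[OF j] grid_in[OF j] by auto
  qed
  moreover have "x \<in> {0..1}" using x ab(3,4) unfolding a_def[symmetric] b_def[symmetric] by auto
  ultimately have "l x \<le> C x"
    using minorant_le_C by fastforce
  with inside[of x] x show ?thesis
    by (simp add: a_def b_def l_def)
qed

lemma C_left_derivative:
  assumes i: "i < n"
  shows "vector_derivative C (at_left (real (Suc i) / n)) = slope i"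
proof -
  define a b where "a = real i / n" and "b = real (Suc i) / n"
  have ab: "a < b" using n_pos by (simp add: a_def b_def divide_strict_right_mono)
  have "((\<lambda>x. C a + slope i * (x - a)) has_vector_derivative slope i) (at b within {..b})"
    by (auto intro!: derivative_eq_intros simp: has_real_derivative_iff_has_vector_derivative[symmetric])
  then have "(C has_vector_derivative slope i) (at b within {..b})"
  proof (rule has_vector_derivative_transform_within[where d = "b - a"])
    fix y assume "y \<in> {..b}" "dist y b < b - a"
    then have "y \<in> {a..b}" by (auto simp: dist_real_def)
    from C_linear[OF i this[unfolded a_def b_def]]
    show "C a + slope i * (y - a) = C y" by (simp add: a_def)
  qed (use ab in auto)
  then have "(C has_vector_derivative slope i) (at b within {..<b})"
    by (rule has_vector_derivative_within_subset) auto
  then show ?thesis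
    unfolding b_def by (intro vector_derivative_within) auto
qed

lemma slope_mono:
  assumes "i \<le> j" "j < n"
  shows "slope i \<le> slope j"
  using assms
proof (induction j rule: dec_induct)
  case (step j)
  have "C ((1 - 1/2) *\<^sub>R (real j / n) + (1/2) *\<^sub>R (real (Suc (Suc j)) / n))
      \<le> (1 - 1/2) * C (real j / n) + (1/2) * C (real (Suc (Suc j)) / n)"
    using step.prems by (intro convex_onD[OF C_convex] grid_in) auto
  also have "(1 - 1/2) *\<^sub>R (real j / n) + (1/2) *\<^sub>R (real (Suc (Suc j)) / n) = real (Suc j) / n"
    using n_pos by (simp add: field_simps)
  finally have "slope j \<le> slope (Suc j)"
    using n_pos by (intro mult_left_mono) auto
  with step show ?case by simp
qed simp

lemma slope_nonneg: "i < n \<Longrightarrow> 0 \<le> slope i"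
  using slope_mono[of 0 i] C_0 C_nonneg[of "1 / n"] n_pos
  by (smt (verit) grid_in le0 mult_nonneg_nonneg of_nat_0_le_iff One_nat_def Suc_leI div_0 of_nat_0 of_nat_1)

end

section \<open>The maximum likelihood estimator as a step function of its slopes\<close>

definition order_perm :: "nat \<Rightarrow> (nat \<Rightarrow> real) \<Rightarrow> nat \<Rightarrow> nat" where
  "order_perm n T j = sort_key T [0..<n] ! j"

lemma order_perm_bij: "bij_betw (order_perm n T) {..<n} {..<n}"
proof -
  have "bij_betw (\<lambda>j. sort_key T [0..<n] ! j) {..<length (sort_key T [0..<n])} (set (sort_key T [0..<n]))"
    by (intro bij_betw_nth) auto
  then show ?thesis by (simp add: order_perm_def[abs_def] lessThan_atLeast0)
qed

lemma order_perm_less: "j < n \<Longrightarrow> order_perm n T j < n"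
  using order_perm_bij[of n T] by (auto simp: bij_betw_def)

lemma order_perm_sorted: "i \<le> j \<Longrightarrow> j < n \<Longrightarrow> T (order_perm n T i) \<le> T (order_perm n T j)"
  using sorted_nth_mono[of "map T (sort_key T [0..<n])" i j] by (simp add: order_perm_def)

text \<open>
  A property inherited by smaller reals holds exactly on an initial stretch of the ordered sample, so
  counting the observations that have it tells where the stretch ends.
\<close>

lemma order_perm_less_card_iff:
  fixes P :: "real \<Rightarrow> bool"
  assumes P: "\<And>x y. x \<le> y \<Longrightarrow> P y \<Longrightarrow> P x" and j: "j < n"
  shows "P (T (order_perm n T j)) \<longleftrightarrow> j < card {i. i < n \<and> P (T i)}"
proof -
  define A where "A = {j. j < n \<and> P (T (order_perm n T j))}"
  have fin: "finite A" by (simp add: A_def)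
  have "order_perm n T ` A = {i. i < n \<and> P (T i)}"
  proof (intro equalityI subsetI)
    fix i assume i: "i \<in> {i. i < n \<and> P (T i)}"
    moreover have "order_perm n T ` {..<n} = {..<n}"
      by (rule bij_betw_imp_surj_on[OF order_perm_bij])
    ultimately obtain j where "j < n" "i = order_perm n T j" by (auto simp: set_eq_iff image_iff)
    with i show "i \<in> order_perm n T ` A" by (auto simp: A_def)
  qed (auto simp: A_def order_perm_less)
  moreover have "inj_on (order_perm n T) A"
    using order_perm_bij[of n T] by (auto simp: A_def bij_betw_def inj_on_def)
  ultimately have card: "card {i. i < n \<and> P (T i)} = card A"
    by (metis card_image)
  have down: "i \<in> A" if "i \<le> j" "j \<in> A" for i j
    using that order_perm_sorted[of i j n T] P by (auto simp: A_def)
  have "A = {..<card A}"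
  proof (cases "A = {}")
    case False
    have "A = {..Max A}"
      using down fin False by (auto intro: down[OF _ Max_in[OF fin False]])
    then show ?thesis by (metis card_atMost lessThan_Suc_atMost)
  qed simp
  then show ?thesis
    using j by (simp add: card) (metis (mono_tags, lifting) A_def lessThan_iff mem_Collect_eq)
qed

lemma card_filter_le: "card {i. i < n \<and> P i} \<le> (n::nat)"
  using card_mono[of "{..<n}" "{i. i < n \<and> P i}"] by auto

lemma sum_order_perm: "(\<Sum>j<n. f (order_perm n T j)) = (\<Sum>i<n. f i)"
  by (rule sum.reindex_bij_betw[OF order_perm_bij])

definition cusum :: "nat \<Rightarrow> (nat \<Rightarrow> real) \<Rightarrow> (nat \<Rightarrow> real) \<Rightarrow> nat \<Rightarrow> real" where
  "cusum n T \<Delta> i = (\<Sum>j<i. \<Delta> (order_perm n T j)) / real n"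

definition rank_of :: "nat \<Rightarrow> (nat \<Rightarrow> real) \<Rightarrow> real \<Rightarrow> nat" where
  "rank_of n T x = card {i. i < n \<and> T i \<le> x}"

lemma rank_le: "rank_of n T x \<le> n"
  unfolding rank_of_def by (rule card_filter_le)

lemma rank_mono: "x \<le> y \<Longrightarrow> rank_of n T x \<le> rank_of n T y"
  unfolding rank_of_def by (rule card_mono) auto

locale current_status_data =
  fixes n :: nat and T \<Delta> :: "nat \<Rightarrow> real"
  assumes n: "0 < n" and \<Delta>_nonneg: "\<And>i. 0 \<le> \<Delta> i"
begin

sublocale grid_points n "cusum n T \<Delta>"
  using n \<Delta>_nonneg by unfold_locales (auto simp: cusum_def intro!: divide_nonneg_nonneg sum_nonneg)

text \<open>
  The index of a slope is the number of the grid cell to the left of the grid point at which the left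
  derivative is taken, hence the shift by one.
\<close>

lemma mle_eq: "mle n T \<Delta> x = (if rank_of n T x = 0 then 0 else slope (rank_of n T x - 1))"
proof (cases "rank_of n T x")
  case (Suc i)
  then have "i < n" using rank_le[of n T x] by simp
  moreover have "gcm {0..1} (cusum_points n T \<Delta>) = C"
    unfolding C_def cusum_points_def cusum_def ordered_ind_def order_perm_def ..
  ultimately show ?thesis
    using C_left_derivative Suc by (simp add: mle_def rank_of_def[symmetric] Let_def)
qed (simp add: mle_def rank_of_def)

lemma mle_nonneg: "0 \<le> mle n T \<Delta> x"
  using slope_nonneg[of "rank_of n T x - 1"] rank_le[of n T x] n by (cases "rank_of n T x") (auto simp: mle_eq)

lemma mle_mono: "x \<le> y \<Longrightarrow> mle n T \<Delta> x \<le> mle n T \<Delta> y"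
  using slope_mono[of "rank_of n T x - 1" "rank_of n T y - 1"] rank_mono[of x y n T] rank_le[of n T y] n
    mle_nonneg[of y]
  by (cases "rank_of n T x = 0") (auto simp: mle_eq[of x] mle_eq[of y])

lemma mle_eq_0: "(\<And>i. i < n \<Longrightarrow> x < T i) \<Longrightarrow> mle n T \<Delta> x = 0"
  by (auto simp: mle_def Let_def not_le)

lemma mle_right_continuous: "continuous (at_right x) (mle n T \<Delta>)"
proof -
  have "\<forall>\<^sub>F y in at_right x. \<forall>i\<in>{..<n}. T i \<le> y \<longleftrightarrow> T i \<le> x"
  proof (rule eventually_ball_finite)
    show "\<forall>i\<in>{..<n}. \<forall>\<^sub>F y in at_right x. T i \<le> y \<longleftrightarrow> T i \<le> x"
    proof
      fix i
      show "\<forall>\<^sub>F y in at_right x. T i \<le> y \<longleftrightarrow> T i \<le> x"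
      proof (cases "T i \<le> x")
        case True
        then show ?thesis by (auto simp: eventually_at_filter intro!: always_eventually)
      next
        case False
        then have "\<forall>\<^sub>F y in at_right x. y < T i" 
          by (intro eventually_at_right_field[THEN iffD2] exI[of _ "T i"]) auto
        then show ?thesis by eventually_elim (use False in auto)
      qed
    qed
  qed simp
  then have "\<forall>\<^sub>F y in at_right x. mle n T \<Delta> y = mle n T \<Delta> x"
  proof eventually_elim
    case (elim y)
    then have "{i. i < n \<and> T i \<le> y} = {i. i < n \<and> T i \<le> x}" by auto
    then show ?case by (simp add: mle_def)
  qed
  then show ?thesis
    unfolding continuous_within by (rule tendsto_eventually)
qed

end

section \<open>Deterministic bounds for the minorant and the estimator\<close>

context current_status_data
begin

lemma n_cusum_diff:
  assumes "l \<le> r"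
  shows "real n * (cusum n T \<Delta> r - cusum n T \<Delta> l) = (\<Sum>j\<in>{l..<r}. \<Delta> (order_perm n T j))"
proof -
  have "(\<Sum>j<r. \<Delta> (order_perm n T j)) - (\<Sum>j<l. \<Delta> (order_perm n T j)) = (\<Sum>j\<in>{l..<r}. \<Delta> (order_perm n T j))"
    using assms by (subst lessThan_minus_lessThan[symmetric], subst sum_diff) auto
  then show ?thesis
    using n by (simp add: cusum_def field_simps)
qed

lemma n_C_diff:
  assumes "l \<le> r"
  shows "real n * (C (real r / n) - C (real l / n)) = (\<Sum>j\<in>{l..<r}. slope j)"
  using assms by (simp add: sum_distrib_left[symmetric] sum_Suc_diff'[of l r "\<lambda>j. C (real j / n)"] del: of_nat_Suc)

end

lemma sqrt_mult_divide:
  fixes d L :: real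
  assumes "0 < d"
  shows "sqrt (d * L) / d = sqrt (L / d)"
proof -
  have "L / d = (d * L) / d\<^sup>2" using assms by (simp add: power2_eq_square)
  also have "sqrt \<dots> = sqrt (d * L) / d" using assms by (simp add: real_sqrt_divide)
  finally show ?thesis ..
qed

text \<open>
  The noise condition below is all that the deterministic part uses of the randomness of \<open>\<Delta>\<close>. It
  concerns every stretch of consecutive ordered times, and its bound depends only on the length of the
  stretch.
\<close>

locale noisy_data = current_status_data +
  fixes F :: "real \<Rightarrow> real" and L :: real
  assumes F_mono: "\<And>x y. x \<le> y \<Longrightarrow> F x \<le> F y" and L_pos: "0 < L"
    and noise: "\<And>l r. l \<le> r \<Longrightarrow> r \<le> n \<Longrightarrow>
      \<bar>\<Sum>j\<in>{l..<r}. \<Delta> (order_perm n T j) - F (T (order_perm n T j))\<bar> \<le> sqrt (real (r - l) * L)"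
begin

text \<open>
  The inequality of arithmetic and geometric means, with the weight chosen such that the term
  proportional to \<open>m\<close> has the prescribed factor \<open>\<eta>\<close>.
\<close>

lemma quadratic_beats_noise:
  assumes "0 < \<eta>" "0 \<le> m"
  shows "sqrt (m * L) \<le> \<eta> * m + L / (4 * \<eta>)"
proof -
  have "0 \<le> (sqrt (\<eta> * m) - sqrt (L / (4 * \<eta>)))\<^sup>2" by simp
  also have "\<dots> = \<eta> * m + L / (4 * \<eta>) - 2 * (sqrt (\<eta> * m) * sqrt (L / (4 * \<eta>)))"
    using assms L_pos by (simp add: power2_diff)
  also have "sqrt (\<eta> * m) * sqrt (L / (4 * \<eta>)) = sqrt (m * L / 4)"
    using assms by (simp flip: real_sqrt_mult)
  also have "2 * sqrt (m * L / 4) = sqrt (m * L)"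
    by (simp add: real_sqrt_divide)
  finally show ?thesis by simp
qed

text \<open>
  The line of slope \<open>F x\<close> through the point number \<open>l\<close> of the diagram, lowered by the bound \<open>D\<close>, stays
  below the whole diagram. Indeed the mean increments exceed \<open>F x\<close> by at least \<open>\<eta>\<close> to the right of \<open>l\<close>,
  and fall short of it by \<open>\<eta>\<close> to the left, except for the \<open>N\<close> times within \<open>\<delta>\<close> of \<open>x\<close>; this linear surplus
  compensates the noise by \<open>quadratic_beats_noise\<close>. The line being a minorant, \<open>C\<close> lies above it at \<open>l\<close>.
\<close>

lemma cusum_above_C:
  assumes l: "l \<le> n" "\<And>j. j < l \<Longrightarrow> T (order_perm n T j) \<le> x"
      "\<And>j. l \<le> j \<Longrightarrow> j < n \<Longrightarrow> x \<le> T (order_perm n T j)"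
    and \<eta>: "0 < \<eta>" "\<And>y. y \<le> x - \<delta> \<Longrightarrow> F y \<le> F x - \<eta>" "\<And>y. x + \<delta> \<le> y \<Longrightarrow> F x + \<eta> \<le> F y"
    and N: "real (card {i. i < n \<and> \<bar>T i - x\<bar> < \<delta>}) \<le> N"
  shows "cusum n T \<Delta> l - C (real l / n) \<le> (\<eta> * N + L / (4 * \<eta>)) / n"
proof -
  define D where "D = (\<eta> * N + L / (4 * \<eta>)) / n"
  define p where "p = order_perm n T"
  have nD: "real n * D = \<eta> * N + L / (4 * \<eta>)" using n by (simp add: D_def)
  have close: "(\<Sum>j\<in>J. of_bool (\<bar>T (p j) - x\<bar> < \<delta>)) \<le> N" if J: "J \<subseteq> {..<n}" for J
  proof -
    have "(\<Sum>j\<in>J. of_bool (\<bar>T (p j) - x\<bar> < \<delta>)) \<le> (\<Sum>j<n. of_bool (\<bar>T (p j) - x\<bar> < \<delta>) :: real)"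
      using J by (intro sum_mono2) auto
    also have "\<dots> = (\<Sum>i<n. of_bool (\<bar>T i - x\<bar> < \<delta>))"
      unfolding p_def by (rule sum_order_perm)
    also have "\<dots> = real (card {i. i < n \<and> \<bar>T i - x\<bar> < \<delta>})"
      by (simp add: of_bool_def sum.If_cases Int_def)
    finally show ?thesis using N by simp
  qed
  have main: "cusum n T \<Delta> l - D + F x * (real i / n - real l / n) \<le> cusum n T \<Delta> i" if i: "i \<le> n" for i
  proof (cases "l \<le> i")
    case True
    have "real (i - l) * F x + \<eta> * real (i - l) - \<eta> * N
        \<le> (\<Sum>j\<in>{l..<i}. F x) + \<eta> * (\<Sum>j\<in>{l..<i}. 1 - of_bool (\<bar>T (p j) - x\<bar> < \<delta>))"
      using mult_left_mono[OF close[of "{l..<i}"], of \<eta>] i \<eta>(1)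
      by (simp add: sum_subtractf algebra_simps subset_iff)
    also have "\<dots> = (\<Sum>j\<in>{l..<i}. F x + \<eta> * (1 - of_bool (\<bar>T (p j) - x\<bar> < \<delta>)))"
      by (simp only: sum.distrib sum_distrib_left)
    also have "\<dots> \<le> (\<Sum>j\<in>{l..<i}. F (T (p j)))"
    proof (rule sum_mono)
      fix j assume "j \<in> {l..<i}"
      then have "x \<le> T (p j)" using l(3)[of j] i by (simp add: p_def)
      then show "F x + \<eta> * (1 - of_bool (\<bar>T (p j) - x\<bar> < \<delta>)) \<le> F (T (p j))"
        using \<eta>(3)[of "T (p j)"] F_mono[of x "T (p j)"] by (cases "\<bar>T (p j) - x\<bar> < \<delta>") auto
    qed
    also have "\<dots> \<le> (\<Sum>j\<in>{l..<i}. \<Delta> (p j)) + sqrt (real (i - l) * L)"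
      using noise[OF True i] by (auto simp: sum_subtractf p_def)
    also have "\<dots> = real n * (cusum n T \<Delta> i - cusum n T \<Delta> l) + sqrt (real (i - l) * L)"
      using n_cusum_diff[OF True] by (simp add: p_def)
    also have "sqrt (real (i - l) * L) \<le> \<eta> * real (i - l) + L / (4 * \<eta>)"
      using \<eta>(1) by (intro quadratic_beats_noise) auto
    finally have "real (i - l) * F x \<le> real n * (cusum n T \<Delta> i - cusum n T \<Delta> l) + real n * D"
      by (simp add: nD)
    then have "real n * (cusum n T \<Delta> l - D + F x * (real i / n - real l / n)) \<le> real n * cusum n T \<Delta> i"
      using n True by (simp add: algebra_simps of_nat_diff)
    then show ?thesis using n by simp
  next
    case False
    then have le: "i \<le> l" by simp
    have "real n * (cusum n T \<Delta> l - cusum n T \<Delta> i) = (\<Sum>j\<in>{i..<l}. \<Delta> (p j))"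
      using n_cusum_diff[OF le] by (simp add: p_def)
    also have "\<dots> \<le> (\<Sum>j\<in>{i..<l}. F (T (p j))) + sqrt (real (l - i) * L)"
      using noise[OF le l(1)] by (auto simp: sum_subtractf p_def)
    also have "(\<Sum>j\<in>{i..<l}. F (T (p j))) \<le> (\<Sum>j\<in>{i..<l}. F x - \<eta> * (1 - of_bool (\<bar>T (p j) - x\<bar> < \<delta>)))"
    proof (rule sum_mono)
      fix j assume "j \<in> {i..<l}"
      then have "T (p j) \<le> x" using l(2)[of j] i by (simp add: p_def)
      then show "F (T (p j)) \<le> F x - \<eta> * (1 - of_bool (\<bar>T (p j) - x\<bar> < \<delta>))"
        using \<eta>(2)[of "T (p j)"] F_mono[of "T (p j)" x] by (cases "\<bar>T (p j) - x\<bar> < \<delta>") auto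
    qed
    also have "\<dots> = (\<Sum>j\<in>{i..<l}. F x) - \<eta> * (\<Sum>j\<in>{i..<l}. 1 - of_bool (\<bar>T (p j) - x\<bar> < \<delta>))"
      unfolding sum_distrib_left by (rule sum_subtractf)
    also have "\<dots> \<le> real (l - i) * F x - \<eta> * real (l - i) + \<eta> * N"
      using mult_left_mono[OF close[of "{i..<l}"], of \<eta>] l(1) \<eta>(1)
      by (simp add: sum_subtractf algebra_simps subset_iff)
    also have "sqrt (real (l - i) * L) \<le> \<eta> * real (l - i) + L / (4 * \<eta>)"
      using \<eta>(1) by (intro quadratic_beats_noise) auto
    finally have "real n * (cusum n T \<Delta> l - cusum n T \<Delta> i) \<le> real (l - i) * F x + real n * D"
      by (simp add: nD)
    then have "real n * (cusum n T \<Delta> l - D + F x * (real i / n - real l / n)) \<le> real n * cusum n T \<Delta> i"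
      using n le by (simp add: algebra_simps of_nat_diff)
    then show ?thesis using n by simp
  qed
  have "cusum n T \<Delta> l - D - F x * (real l / n) + F x * (real l / n) \<le> C (real l / n)"
  proof (rule affine_minorant)
    fix i assume "i \<le> n"
    from main[OF this] show "cusum n T \<Delta> l - D - F x * (real l / n) + F x * (real i / n) \<le> cusum n T \<Delta> i"
      by (simp add: algebra_simps)
  qed (rule grid_in[OF l(1)])
  then show ?thesis by (simp add: D_def)
qed

lemma rank_iff: "j < n \<Longrightarrow> T (order_perm n T j) \<le> x \<longleftrightarrow> j < rank_of n T x"
  unfolding rank_of_def by (rule order_perm_less_card_iff) auto

text \<open>
  The value at \<open>x\<close> is a slope of the minorant, so it is at most the average slope over the following \<open>m\<close>
  or more cells. That average is controlled by the diagram from above at the right end and by the gap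
  \<open>D\<close> at the left end. The lower bound is the mirror image.
\<close>

lemma mle_upper:
  fixes D m :: real
  assumes D: "cusum n T \<Delta> (rank_of n T x) - C (real (rank_of n T x) / n) \<le> D"
    and m: "real (rank_of n T x) + m \<le> rank_of n T y" "0 < m" and D0: "0 \<le> D" and Fy: "0 \<le> F y"
  shows "mle n T \<Delta> x \<le> F y + sqrt (L / m) + n * D / m"
proof (cases "rank_of n T x = 0")
  case True
  then show ?thesis using D0 Fy L_pos m n by (simp add: mle_eq)
next
  case False
  define l r where "l = rank_of n T x" and "r = rank_of n T y"
  have lr: "l < r" "r \<le> n" "0 < l" "m \<le> real (r - l)"
    using m False rank_le[of n T y] by (auto simp: l_def r_def)
  have "real (r - l) * mle n T \<Delta> x = (\<Sum>j\<in>{l..<r}. mle n T \<Delta> x)" by simp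
  also have "\<dots> \<le> (\<Sum>j\<in>{l..<r}. slope j)"
  proof (rule sum_mono)
    fix j assume "j \<in> {l..<r}"
    then have "slope (l - 1) \<le> slope j" using lr by (intro slope_mono) auto
    then show "mle n T \<Delta> x \<le> slope j" using lr(3) by (simp add: mle_eq l_def)
  qed
  also have "\<dots> = real n * (C (real r / n) - C (real l / n))"
    using n_C_diff[of l r] lr by simp
  also have "\<dots> \<le> real n * (cusum n T \<Delta> r - (cusum n T \<Delta> l - D))"
    using C_le_points[OF lr(2)] D by (intro mult_left_mono) (auto simp: l_def)
  also have "\<dots> = (\<Sum>j\<in>{l..<r}. \<Delta> (order_perm n T j)) + n * D"
    using n_cusum_diff[of l r] lr by (simp add: algebra_simps)
  also have "(\<Sum>j\<in>{l..<r}. \<Delta> (order_perm n T j)) \<le> (\<Sum>j\<in>{l..<r}. F (T (order_perm n T j))) + sqrt (real (r - l) * L)"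
    using noise[of l r] lr by (auto simp: sum_subtractf)
  also have "(\<Sum>j\<in>{l..<r}. F (T (order_perm n T j))) \<le> (\<Sum>j\<in>{l..<r}. F y)"
    using lr(2) by (intro sum_mono F_mono) (auto simp: rank_iff r_def)
  also have "\<dots> = real (r - l) * F y" by simp
  finally have "mle n T \<Delta> x \<le> (real (r - l) * F y + sqrt (real (r - l) * L) + n * D) / real (r - l)"
    using lr by (simp add: pos_le_divide_eq mult.commute)
  also have "\<dots> = F y + sqrt (L / real (r - l)) + n * D / real (r - l)"
    using lr by (simp add: add_divide_distrib sqrt_mult_divide)
  also have "\<dots> \<le> F y + sqrt (L / m) + n * D / m"
    using lr m D0 L_pos by (intro add_mono divide_left_mono real_sqrt_le_mono) auto
  finally show ?thesis .
qed

lemma mle_lower: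
  fixes D m :: real
  assumes D: "cusum n T \<Delta> (rank_of n T x) - C (real (rank_of n T x) / n) \<le> D"
    and m: "real (rank_of n T y) + m \<le> rank_of n T x" "0 < m" and D0: "0 \<le> D"
  shows "F y - sqrt (L / m) - n * D / m \<le> mle n T \<Delta> x"
proof -
  define l r where "l = rank_of n T y" and "r = rank_of n T x"
  have lr: "l < r" "r \<le> n" "0 < r" "m \<le> real (r - l)"
    using m rank_le[of n T x] by (auto simp: l_def r_def)
  have "real (r - l) * F y = (\<Sum>j\<in>{l..<r}. F y)" by simp
  also have "\<dots> \<le> (\<Sum>j\<in>{l..<r}. F (T (order_perm n T j)))"
  proof (intro sum_mono F_mono)
    fix j assume "j \<in> {l..<r}"
    then show "y \<le> T (order_perm n T j)" using rank_iff[of j y] lr(2) by (simp add: l_def)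
  qed
  also have "\<dots> \<le> (\<Sum>j\<in>{l..<r}. \<Delta> (order_perm n T j)) + sqrt (real (r - l) * L)"
    using noise[of l r] lr by (auto simp: sum_subtractf)
  also have "(\<Sum>j\<in>{l..<r}. \<Delta> (order_perm n T j)) = real n * (cusum n T \<Delta> r - cusum n T \<Delta> l)"
    using n_cusum_diff[of l r] lr by simp
  also have "\<dots> \<le> real n * (C (real r / n) + D - C (real l / n))"
    using C_le_points[of l] lr D by (intro mult_left_mono) (auto simp: r_def)
  also have "\<dots> = (\<Sum>j\<in>{l..<r}. slope j) + n * D"
    using n_C_diff[of l r] lr by (simp add: algebra_simps)
  also have "(\<Sum>j\<in>{l..<r}. slope j) \<le> (\<Sum>j\<in>{l..<r}. mle n T \<Delta> x)"
  proof (rule sum_mono)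
    fix j assume "j \<in> {l..<r}"
    then have "slope j \<le> slope (r - 1)" using lr by (intro slope_mono) auto
    then show "slope j \<le> mle n T \<Delta> x" using lr(3) by (simp add: mle_eq r_def)
  qed
  also have "\<dots> = real (r - l) * mle n T \<Delta> x" by simp
  finally have "(real (r - l) * F y - sqrt (real (r - l) * L) - n * D) / real (r - l) \<le> mle n T \<Delta> x"
    using lr by (simp add: pos_divide_le_eq mult.commute)
  moreover have "(real (r - l) * F y - sqrt (real (r - l) * L) - n * D) / real (r - l)
      = F y - sqrt (L / real (r - l)) - n * D / real (r - l)"
    using lr by (simp add: diff_divide_distrib sqrt_mult_divide)
  moreover have "F y - sqrt (L / m) - n * D / m \<le> F y - sqrt (L / real (r - l)) - n * D / real (r - l)"
    using lr m D0 L_pos by (intro diff_mono divide_left_mono real_sqrt_le_mono) auto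
  ultimately show ?thesis by linarith
qed

end

text \<open>
  Summation by parts moves the differences from \<open>W\<close> to the weight \<open>a\<close>, of variation at most \<open>V\<close>.
\<close>

lemma abel_bound:
  fixes a W :: "nat \<Rightarrow> real"
  assumes W: "\<And>j. \<bar>W j\<bar> \<le> D" and n: "0 < n"
    and a: "\<bar>a 0\<bar> \<le> B" "\<bar>a (n - 1)\<bar> \<le> B" "(\<Sum>j<n - 1. \<bar>a (Suc j) - a j\<bar>) \<le> V"
  shows "\<bar>\<Sum>j<n. a j * (W (Suc j) - W j)\<bar> \<le> (2 * B + V) * D"
proof -
  have eq: "(\<Sum>j<Suc m. a j * (W (Suc j) - W j)) = a m * W (Suc m) - a 0 * W 0 - (\<Sum>j<m. (a (Suc j) - a j) * W (Suc j))" for m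
    by (induction m) (auto simp: algebra_simps)
  have D: "0 \<le> D" using W[of 0] by linarith
  obtain m where m: "n = Suc m" using n by (cases n) auto
  have "\<bar>\<Sum>j<n. a j * (W (Suc j) - W j)\<bar> \<le> \<bar>a m\<bar> * \<bar>W (Suc m)\<bar> + \<bar>a 0\<bar> * \<bar>W 0\<bar> + \<bar>\<Sum>j<m. (a (Suc j) - a j) * W (Suc j)\<bar>"
    unfolding m eq by (simp flip: abs_mult)
  also have "\<bar>\<Sum>j<m. (a (Suc j) - a j) * W (Suc j)\<bar> \<le> (\<Sum>j<m. \<bar>a (Suc j) - a j\<bar> * D)"
    by (rule order.trans[OF sum_abs]) (auto simp: abs_mult intro!: sum_mono mult_left_mono W)
  also have "\<dots> = (\<Sum>j<m. \<bar>a (Suc j) - a j\<bar>) * D" by (simp add: sum_distrib_right)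
  also have "\<dots> \<le> V * D" using a(3) D by (intro mult_right_mono) (auto simp: m)
  also have "\<bar>a m\<bar> * \<bar>W (Suc m)\<bar> \<le> B * D"
    using a(2) W by (intro mult_mono) (auto simp: m)
  also have "\<bar>a 0\<bar> * \<bar>W 0\<bar> \<le> B * D"
    using a(1) W by (intro mult_mono) auto
  finally show ?thesis by (simp add: algebra_simps)
qed

text \<open>
  In the absence of ties the residual at the \<open>j\<close>-th ordered time is \<open>n (W (Suc j) - W j)\<close>, where \<open>W\<close> is
  minus the gap between diagram and minorant. The gap is controlled only where \<open>\<phi>\<close> is nonzero;
  clipping it to \<open>[-D, 0]\<close> leaves the sum unchanged and makes summation by parts applicable.
\<close>

lemma (in current_status_data) weighted_residuals_small:
  fixes \<phi> up dn :: "real \<Rightarrow> real"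
  assumes inj: "inj_on T {..<n}"
    and \<phi>: "\<And>x. \<phi> x = up x - dn x" "mono up" "mono dn" "\<And>x. 0 \<le> up x" "\<And>x. up x \<le> B" "\<And>x. 0 \<le> dn x" "\<And>x. dn x \<le> B"
    and D: "\<And>j. j < n \<Longrightarrow> \<phi> (T (order_perm n T j)) \<noteq> 0 \<Longrightarrow>
      cusum n T \<Delta> j - C (real j / n) \<le> D \<and> cusum n T \<Delta> (Suc j) - C (real (Suc j) / n) \<le> D"
    and D0: "0 \<le> D"
  shows "\<bar>(\<Sum>i<n. \<phi> (T i) * (mle n T \<Delta> (T i) - \<Delta> i)) / n\<bar> \<le> 4 * B * D"
proof -
  define p where "p = order_perm n T"
  define W where "W j = C (real j / n) - cusum n T \<Delta> j" for j
  define W' where "W' j = max (- D) (min 0 (W j))" for j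
  have B: "0 \<le> B" using \<phi>(4,5)[of 0] by linarith
  have W0: "W j \<le> 0" if "j \<le> n" for j
    using C_le_points[OF that] by (simp add: W_def)
  have rank_of: "rank_of n T (T (p j)) = Suc j" if j: "j < n" for j
  proof -
    have eq: "i < rank_of n T (T (p j)) \<longleftrightarrow> i \<le> j" if i: "i < n" for i
    proof -
      have "i < rank_of n T (T (p j)) \<longleftrightarrow> T (p i) \<le> T (p j)"
        unfolding rank_of_def p_def using i by (intro order_perm_less_card_iff[symmetric]) auto
      also have "\<dots> \<longleftrightarrow> i \<le> j"
      proof
        assume le: "T (p i) \<le> T (p j)"
        show "i \<le> j"
        proof (rule ccontr)
          assume "\<not> i \<le> j"
          then have "T (p j) \<le> T (p i)" unfolding p_def using i by (intro order_perm_sorted) auto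
          with le have "T (p i) = T (p j)" by simp
          then have "p i = p j"
            using inj i j order_perm_less[of _ n T] by (auto simp: inj_on_def p_def)
          then have "i = j"
            using order_perm_bij[of n T] i j by (auto simp: bij_betw_def inj_on_def p_def)
          with \<open>\<not> i \<le> j\<close> show False by simp
        qed
      next
        assume "i \<le> j"
        then show "T (p i) \<le> T (p j)" unfolding p_def using j by (intro order_perm_sorted) auto
      qed
      finally show ?thesis .
    qed
    have "j < rank_of n T (T (p j))" using eq[OF j] by simp
    moreover have "\<not> Suc j < rank_of n T (T (p j))"
    proof (cases "Suc j < n")
      case True then show ?thesis using eq[of "Suc j"] by simp
    next
      case False then show ?thesis using rank_le[of n T "T (p j)"] by simp
    qed
    ultimately show ?thesis by simp
  qed
  have "(\<Sum>i<n. \<phi> (T i) * (mle n T \<Delta> (T i) - \<Delta> i)) = (\<Sum>j<n. \<phi> (T (p j)) * (mle n T \<Delta> (T (p j)) - \<Delta> (p j)))"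
    unfolding p_def by (rule sum_order_perm[symmetric])
  also have "\<dots> = (\<Sum>j<n. n * (\<phi> (T (p j)) * (W' (Suc j) - W' j)))"
  proof (rule sum.cong[OF refl])
    fix j assume "j \<in> {..<n}"
    then have j: "j < n" by simp
    have "\<Delta> (p j) = n * (cusum n T \<Delta> (Suc j) - cusum n T \<Delta> j)"
      using n_cusum_diff[of j "Suc j"] by (simp add: p_def)
    then have *: "mle n T \<Delta> (T (p j)) - \<Delta> (p j) = n * (W (Suc j) - W j)"
      by (simp add: mle_eq rank_of[OF j] W_def algebra_simps)
    show "\<phi> (T (p j)) * (mle n T \<Delta> (T (p j)) - \<Delta> (p j)) = n * (\<phi> (T (p j)) * (W' (Suc j) - W' j))"
    proof (cases "\<phi> (T (p j)) = 0")
      case False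
      then have "W' j = W j" "W' (Suc j) = W (Suc j)"
        using D[OF j] W0[of j] W0[of "Suc j"] j by (auto simp: W'_def W_def p_def)
      then show ?thesis by (simp add: *)
    qed simp
  qed
  also have "\<dots> / n = (\<Sum>j<n. \<phi> (T (p j)) * (W' (Suc j) - W' j))"
    using n by (simp flip: sum_distrib_left)
  also have "\<bar>\<dots>\<bar> \<le> (2 * B + 2 * B) * D"
  proof (rule abel_bound[OF _ n])
    show "\<bar>W' j\<bar> \<le> D" for j using D0 by (auto simp: W'_def)
    have bd: "\<bar>\<phi> x\<bar> \<le> B" for x using \<phi>(1)[of x] \<phi>(4-7)[of x] by auto
    show "\<bar>\<phi> (T (p 0))\<bar> \<le> B" "\<bar>\<phi> (T (p (n - 1)))\<bar> \<le> B" by (rule bd)+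
    have "(\<Sum>j<n - 1. \<bar>\<phi> (T (p (Suc j))) - \<phi> (T (p j))\<bar>)
        \<le> (\<Sum>j<n - 1. (up (T (p (Suc j))) - up (T (p j))) + (dn (T (p (Suc j))) - dn (T (p j))))"
    proof (rule sum_mono)
      fix j assume "j \<in> {..<n - 1}"
      then have "T (p j) \<le> T (p (Suc j))" unfolding p_def by (intro order_perm_sorted) auto
      then show "\<bar>\<phi> (T (p (Suc j))) - \<phi> (T (p j))\<bar>
        \<le> (up (T (p (Suc j))) - up (T (p j))) + (dn (T (p (Suc j))) - dn (T (p j)))"
        using monoD[OF \<phi>(2)] monoD[OF \<phi>(3)] unfolding \<phi>(1) by fastforce
    qed
    also have "\<dots> = (up (T (p (n - 1))) - up (T (p 0))) + (dn (T (p (n - 1))) - dn (T (p 0)))"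
      using sum_lessThan_telescope[of "\<lambda>j. up (T (p j))" "n - 1"]
        sum_lessThan_telescope[of "\<lambda>j. dn (T (p j))" "n - 1"] by (simp only: sum.distrib)
    also have "\<dots> \<le> 2 * B"
      using \<phi>(4-7)[of "T (p 0)"] \<phi>(4-7)[of "T (p (n - 1))"] by linarith
    finally show "(\<Sum>j<n - 1. \<bar>\<phi> (T (p (Suc j))) - \<phi> (T (p j))\<bar>) \<le> 2 * B" .
  qed
  finally show ?thesis by (simp add: algebra_simps)
qed

section \<open>Replacing the distribution of the times by the empirical one\<close>

text \<open>
  An upward closed set of reals is a half line. The closed complement is covered by the hypothesis, the
  open one by a limit of closed ones.
\<close>

lemma prob_upper_set_close:
  assumes P: "real_distribution P" and Q: "real_distribution Q"
    and close: "\<And>x. \<bar>measure P {..x} - measure Q {..x}\<bar> \<le> \<rho>"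
    and U: "\<And>x y. x \<in> U \<Longrightarrow> x \<le> y \<Longrightarrow> y \<in> U"
  shows "\<bar>measure P U - measure Q U\<bar> \<le> \<rho>"
proof -
  interpret P: real_distribution P by fact
  interpret Q: real_distribution Q by fact
  have \<rho>: "0 \<le> \<rho>" using close[of 0] by linarith
  have compl: "\<bar>measure P U - measure Q U\<bar> \<le> \<rho>" if "\<bar>measure P (- U) - measure Q (- U)\<bar> \<le> \<rho>" "- U \<in> sets borel"
  proof -
    have "U \<in> sets borel" using that(2) by (metis borel_comp double_complement)
    then show ?thesis
      using that(1) P.prob_compl[of U] Q.prob_compl[of U] by (simp add: Compl_eq_Diff_UNIV)
  qed
  show ?thesis
  proof (cases "U = {} \<or> U = UNIV")
    case True
    then show ?thesis using \<rho> P.prob_space Q.prob_space by auto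
  next
    case False
    then obtain u d where u: "u \<in> U" and d: "d \<notin> U" by blast
    define a where "a = Sup (- U)"
    have bdd: "bdd_above (- U)"
      using U u by (intro bdd_aboveI[of _ u]) (metis ComplD linear)
    have le: "x \<le> a" if "x \<notin> U" for x
      unfolding a_def using that bdd by (intro cSup_upper) auto
    have less: "x \<notin> U" if "x < a" for x
    proof -
      have "- U \<noteq> {}" using d by auto
      then obtain y where "y \<in> - U" "x < y"
        using \<open>x < a\<close> less_cSup_iff[of "- U" x] bdd unfolding a_def by auto
      then show ?thesis using U[of x y] by auto
    qed
    show ?thesis
    proof (cases "a \<in> U")
      case False
      then have "- U = {..a}" using le less by (force simp: less_le)
      then show ?thesis using close[of a] by (intro compl) auto
    next
      case True
      then have eq: "- U = {..<a}" using le less by (force simp: less_le)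
      have Un: "(\<Union>k. {..a - 1 / real (Suc k)}) = {..<a}"
      proof (intro equalityI subsetI)
        fix x assume "x \<in> {..<a}"
        then obtain k where "inverse (real (Suc k)) < a - x"
          using reals_Archimedean[of "a - x"] by auto
        then show "x \<in> (\<Union>k. {..a - 1 / real (Suc k)})"
          by (auto simp: inverse_eq_divide algebra_simps intro!: exI[of _ k])
      next
        fix x assume "x \<in> (\<Union>k. {..a - 1 / real (Suc k)})"
        then obtain k where "x \<le> a - 1 / real (Suc k)" by auto
        moreover have "0 < 1 / real (Suc k)" by simp
        ultimately show "x \<in> {..<a}" unfolding lessThan_iff by linarith
      qed
      have inc: "incseq (\<lambda>k. {..a - 1 / real (Suc k)})"
        by (auto simp: incseq_def intro: order.trans divide_left_mono)
      have "(\<lambda>k. measure P {..a - 1 / real (Suc k)}) \<longlonglongrightarrow> measure P {..<a}"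
        using P.finite_Lim_measure_incseq[OF _ inc] by (simp add: Un image_subset_iff del: of_nat_Suc)
      moreover have "(\<lambda>k. measure Q {..a - 1 / real (Suc k)}) \<longlonglongrightarrow> measure Q {..<a}"
        using Q.finite_Lim_measure_incseq[OF _ inc] by (simp add: Un image_subset_iff del: of_nat_Suc)
      ultimately have "(\<lambda>k. \<bar>measure P {..a - 1 / real (Suc k)} - measure Q {..a - 1 / real (Suc k)}\<bar>)
          \<longlonglongrightarrow> \<bar>measure P {..<a} - measure Q {..<a}\<bar>"
        by (intro tendsto_intros)
      then have "\<bar>measure P {..<a} - measure Q {..<a}\<bar> \<le> \<rho>"
        by (rule LIMSEQ_le_const2) (use close in blast)
      then show ?thesis by (intro compl) (auto simp: eq)
    qed
  qed
qed

text \<open>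
  The layer cake formula, by Fubini's theorem.
\<close>

lemma integral_eq_integral_prob_greater:
  fixes m :: "real \<Rightarrow> real"
  assumes P: "real_distribution P" and m: "mono m" "\<And>x. 0 \<le> m x" "\<And>x. m x \<le> B"
  shows "(\<integral>x. m x \<partial>P) = (LINT s:{0..B}|lborel. measure P {x. s < m x})"
    and "set_integrable lborel {0..B} (\<lambda>s. measure P {x. s < m x})"
proof -
  interpret P: real_distribution P by fact
  interpret pair_sigma_finite P lborel ..
  have [measurable]: "m \<in> borel_measurable borel" using m(1) by (rule borel_measurable_mono)
  have meas: "(\<lambda>s. measure P {x. s < m x}) \<in> borel_measurable borel"
  proof -
    have "mono (\<lambda>s. - measure P {x. s < m x})"
      by (auto simp: mono_def intro!: P.finite_measure_mono)
    then have "(\<lambda>s. - (- measure P {x. s < m x})) \<in> borel_measurable borel"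
      by (intro borel_measurable_uminus borel_measurable_mono)
    then show ?thesis by simp
  qed
  show int: "set_integrable lborel {0..B} (\<lambda>s. measure P {x. s < m x})"
    unfolding set_integrable_def
  proof (rule integrableI_bounded_set_indicator[where B = 1])
    show "AE s in lborel. s \<in> {0..B} \<longrightarrow> norm (measure P {x. s < m x}) \<le> 1"
      by (auto simp: P.prob_le_1)
  qed (auto intro: meas simp: emeasure_lborel_Icc_eq)
  have "(\<integral>x. m x \<partial>P) = enn2real (\<integral>\<^sup>+x. ennreal (m x) \<partial>P)"
    using m(2) by (intro integral_eq_nn_integral) auto
  also have "(\<integral>\<^sup>+x. ennreal (m x) \<partial>P)
      = (\<integral>\<^sup>+x. (\<integral>\<^sup>+s. indicator {q. 0 \<le> snd q \<and> snd q \<le> B \<and> snd q < m (fst q)} (x, s) \<partial>lborel) \<partial>P)"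
  proof (rule nn_integral_cong)
    fix x
    have "(\<integral>\<^sup>+s. indicator {q. 0 \<le> snd q \<and> snd q \<le> B \<and> snd q < m (fst q)} (x, s) \<partial>lborel)
        = (\<integral>\<^sup>+s. indicator {0..<m x} s \<partial>lborel)"
      using m(3)[of x] by (intro nn_integral_cong) (auto simp: indicator_def)
    also have "\<dots> = ennreal (m x)" using m(2)[of x] by simp
    finally show "ennreal (m x) = (\<integral>\<^sup>+s. indicator {q. 0 \<le> snd q \<and> snd q \<le> B \<and> snd q < m (fst q)} (x, s) \<partial>lborel)" ..
  qed
  also have "\<dots> = (\<integral>\<^sup>+s. (\<integral>\<^sup>+x. indicator {q. 0 \<le> snd q \<and> snd q \<le> B \<and> snd q < m (fst q)} (x, s) \<partial>P) \<partial>lborel)"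
    by (rule Fubini'[symmetric]) measurable
  also have "\<dots> = (\<integral>\<^sup>+s. ennreal (indicator {0..B} s * measure P {x. s < m x}) \<partial>lborel)"
  proof (rule nn_integral_cong)
    fix s
    have "(\<integral>\<^sup>+x. indicator {q. 0 \<le> snd q \<and> snd q \<le> B \<and> snd q < m (fst q)} (x, s) \<partial>P)
        = (\<integral>\<^sup>+x. indicator {0..B} s * indicator {x. s < m x} x \<partial>P)"
      by (intro nn_integral_cong) (auto simp: indicator_def)
    also have "\<dots> = indicator {0..B} s * emeasure P {x. s < m x}"
      by (subst nn_integral_cmult_indicator) auto
    finally show "(\<integral>\<^sup>+x. indicator {q. 0 \<le> snd q \<and> snd q \<le> B \<and> snd q < m (fst q)} (x, s) \<partial>P)
        = ennreal (indicator {0..B} s * measure P {x. s < m x})"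
      by (auto simp: P.emeasure_eq_measure indicator_def)
  qed
  also have "enn2real \<dots> = (\<integral>s. indicator {0..B} s * measure P {x. s < m x} \<partial>lborel)"
    using meas by (intro integral_eq_nn_integral[symmetric]) auto
  finally show "(\<integral>x. m x \<partial>P) = (LINT s:{0..B}|lborel. measure P {x. s < m x})"
    by (simp add: set_lebesgue_integral_def)
qed

lemma mono_integral_close:
  fixes m :: "real \<Rightarrow> real"
  assumes P: "real_distribution P" and Q: "real_distribution Q"
    and close: "\<And>x. \<bar>measure P {..x} - measure Q {..x}\<bar> \<le> \<rho>"
    and m: "mono m" "\<And>x. 0 \<le> m x" "\<And>x. m x \<le> B"
  shows "\<bar>(\<integral>x. m x \<partial>P) - (\<integral>x. m x \<partial>Q)\<bar> \<le> B * \<rho>"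
proof -
  have B: "0 \<le> B" using m(2,3)[of 0] by linarith
  note * = integral_eq_integral_prob_greater[OF P m] and ** = integral_eq_integral_prob_greater[OF Q m]
  have "\<bar>(\<integral>x. m x \<partial>P) - (\<integral>x. m x \<partial>Q)\<bar> = \<bar>LINT s:{0..B}|lborel. measure P {x. s < m x} - measure Q {x. s < m x}\<bar>"
    using * ** by (simp add: set_integral_diff)
  also have "\<dots> \<le> (LINT s:{0..B}|lborel. \<bar>measure P {x. s < m x} - measure Q {x. s < m x}\<bar>)"
    using set_integral_norm_bound[OF set_integral_diff(1)[OF *(2) **(2)]] by simp
  also have "\<dots> \<le> (LINT s:{0..B}|lborel. \<rho>)"
  proof (rule set_integral_mono)
    show "set_integrable lborel {0..B} (\<lambda>s. \<bar>measure P {x. s < m x} - measure Q {x. s < m x}\<bar>)"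
      using set_integrable_abs[OF set_integral_diff(1)[OF *(2) **(2)]] by simp
    show "set_integrable lborel {0..B} (\<lambda>s. \<rho>)"
      unfolding set_integrable_def by (intro integrable_scaleR_left integrable_real_indicator)
        (auto simp: emeasure_lborel_Icc_eq)
    fix s
    show "\<bar>measure P {x. s < m x} - measure Q {x. s < m x}\<bar> \<le> \<rho>"
      using monoD[OF m(1)] by (intro prob_upper_set_close[OF P Q close]) (auto intro: less_le_trans)
  qed
  also have "\<dots> = B * \<rho>" using B by (simp add: set_lebesgue_integral_def)
  finally show ?thesis .
qed

text \<open>
  Since \<open>\<phi>\<close> is nonzero only where \<open>q\<close> and \<open>r\<close> lie in \<open>[\<alpha>, \<beta>]\<close>, both may be clipped to that interval and
  shifted by \<open>\<alpha>\<close>. Then \<open>\<phi> (q - r)\<close> splits into four products of nonnegative monotone functions, each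
  again monotone and bounded by \<open>B (\<beta> - \<alpha>)\<close>.
\<close>

lemma product_integral_close:
  fixes \<phi> up dn q r :: "real \<Rightarrow> real"
  assumes P: "real_distribution P" and Q: "real_distribution Q"
    and close: "\<And>x. \<bar>measure P {..x} - measure Q {..x}\<bar> \<le> \<rho>"
    and \<phi>: "\<And>x. \<phi> x = up x - dn x" "mono up" "mono dn" "\<And>x. 0 \<le> up x" "\<And>x. up x \<le> B" "\<And>x. 0 \<le> dn x" "\<And>x. dn x \<le> B"
    and q: "mono q" "\<And>x. \<phi> x \<noteq> 0 \<Longrightarrow> \<alpha> \<le> q x \<and> q x \<le> \<beta>"
    and r: "mono r" "\<And>x. \<phi> x \<noteq> 0 \<Longrightarrow> \<alpha> \<le> r x \<and> r x \<le> \<beta>" and \<alpha>\<beta>: "\<alpha> \<le> \<beta>"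
  shows "\<bar>(\<integral>x. \<phi> x * (q x - r x) \<partial>P) - (\<integral>x. \<phi> x * (q x - r x) \<partial>Q)\<bar> \<le> 4 * B * (\<beta> - \<alpha>) * \<rho>"
proof -
  define c where "c f x = max \<alpha> (min \<beta> (f x)) - \<alpha>" for f :: "real \<Rightarrow> real" and x
  have c: "mono (c f)" if "mono f" for f
  proof (rule monoI)
    fix x y :: real assume "x \<le> y"
    from monoD[OF that this] show "c f x \<le> c f y" by (auto simp: c_def)
  qed
  have c_range: "0 \<le> c f x" "c f x \<le> \<beta> - \<alpha>" for f x using \<alpha>\<beta> by (auto simp: c_def)
  have prod: "mono (\<lambda>x. w x * c f x)" "0 \<le> w x * c f x" "w x * c f x \<le> B * (\<beta> - \<alpha>)"
    if "mono w" "\<And>x. 0 \<le> w x" "\<And>x. w x \<le> B" "mono f" for w f x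
    using monoD[OF that(1)] monoD[OF c[OF that(4)]] that(2,3) c_range order.trans[OF that(2,3)]
    by (auto intro!: monoI mult_mono)
  have diff: "\<bar>(\<integral>x. w x * c f x \<partial>P) - (\<integral>x. w x * c f x \<partial>Q)\<bar> \<le> B * (\<beta> - \<alpha>) * \<rho>"
    if "mono w" "\<And>x. 0 \<le> w x" "\<And>x. w x \<le> B" "mono f" for w f
    by (intro mono_integral_close[OF P Q close] prod[OF that])
  have int: "integrable R (\<lambda>x. w x * c f x)" if R: "real_distribution R"
    and "mono w" "\<And>x. 0 \<le> w x" "\<And>x. w x \<le> B" "mono f" for R w f
  proof -
    interpret R: real_distribution R by fact
    show ?thesis
      using prod(2,3)[OF that(2-)] borel_measurable_mono[OF prod(1)[OF that(2-)]]
      by (intro R.integrable_const_bound[where B = "B * (\<beta> - \<alpha>)"]) auto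
  qed
  have eq: "\<phi> x * (q x - r x) = up x * c q x - dn x * c q x - (up x * c r x - dn x * c r x)" for x
  proof (cases "\<phi> x = 0")
    case False
    then have *: "c q x = q x - \<alpha>" "c r x = r x - \<alpha>" using q(2) r(2) by (auto simp: c_def)
    show ?thesis unfolding * \<phi>(1) by (simp add: algebra_simps)
  qed (use \<phi>(1)[of x] in simp)
  have split: "(\<integral>x. \<phi> x * (q x - r x) \<partial>R) = (\<integral>x. up x * c q x \<partial>R) - (\<integral>x. dn x * c q x \<partial>R)
      - ((\<integral>x. up x * c r x \<partial>R) - (\<integral>x. dn x * c r x \<partial>R))" if R: "real_distribution R" for R
    unfolding eq using int[OF R \<phi>(2,4,5) q(1)] int[OF R \<phi>(3,6,7) q(1)] int[OF R \<phi>(2,4,5) r(1)] int[OF R \<phi>(3,6,7) r(1)]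
    by simp
  show ?thesis
    unfolding split[OF P] split[OF Q]
    using diff[OF \<phi>(2,4,5) q(1)] diff[OF \<phi>(3,6,7) q(1)] diff[OF \<phi>(2,4,5) r(1)] diff[OF \<phi>(3,6,7) r(1)]
    by (simp add: algebra_simps)
qed

definition empirical :: "nat \<Rightarrow> (nat \<Rightarrow> real) \<Rightarrow> real measure" where
  "empirical n T = distr (uniform_count_measure {..<n}) borel T"

lemma empirical:
  assumes "0 < n"
  shows "real_distribution (empirical n T)" "measure (empirical n T) {..x} = rank_of n T x / n"
    "f \<in> borel_measurable borel \<Longrightarrow> (\<integral>x. f x \<partial>empirical n T) = (\<Sum>i<n. f (T i)) / (n :: real)"
proof -
  have [simp]: "{..<n} \<noteq> {}" using assms by auto
  interpret U: prob_space "uniform_count_measure {..<n}"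
    by (rule prob_space_uniform_count_measure) auto
  have [measurable]: "T \<in> borel_measurable (uniform_count_measure {..<n})"
    by (simp add: measurable_def uniform_count_measure_def space_point_measure sets_point_measure) 
  show "real_distribution (empirical n T)"
    unfolding empirical_def by (rule U.real_distribution_distr) measurable
  have "measure (empirical n T) {..x} = measure (uniform_count_measure {..<n}) {i. i < n \<and> T i \<le> x}"
    unfolding empirical_def by (subst measure_distr) (auto intro!: arg_cong2[where f = measure] simp: space_uniform_count_measure)
  also have "\<dots> = rank_of n T x / n"
    by (subst measure_uniform_count_measure) (auto simp: rank_of_def)
  finally show "measure (empirical n T) {..x} = rank_of n T x / n" .
  assume [measurable]: "f \<in> borel_measurable borel"
  have "(\<integral>x. f x \<partial>empirical n T) = (\<integral>i. f (T i) \<partial>uniform_count_measure {..<n})"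
    unfolding empirical_def by (rule integral_distr) measurable
  also have "\<dots> = (\<Sum>i<n. f (T i)) / n"
    unfolding uniform_count_measure_def
    by (subst lebesgue_integral_point_measure_finite) (auto simp: sum_divide_distrib)
  finally show "(\<integral>x. f x \<partial>empirical n T) = (\<Sum>i<n. f (T i)) / n" .
qed

text \<open>
  The two replacements combined: first the empirical distribution for \<open>Q\<close>, then \<open>\<Delta>\<close> for the estimator.
\<close>

lemma (in noisy_data) mle_linearization:
  fixes \<phi> up dn :: "real \<Rightarrow> real"
  assumes Q: "real_distribution Q" and close: "\<And>x. \<bar>rank_of n T x / n - measure Q {..x}\<bar> \<le> \<rho>"
    and inj: "inj_on T {..<n}"
    and \<phi>: "\<And>x. \<phi> x = up x - dn x" "mono up" "mono dn" "\<And>x. 0 \<le> up x" "\<And>x. up x \<le> B" "\<And>x. 0 \<le> dn x" "\<And>x. dn x \<le> B"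
    and D: "\<And>j. j < n \<Longrightarrow> \<phi> (T (order_perm n T j)) \<noteq> 0 \<Longrightarrow>
      cusum n T \<Delta> j - C (real j / n) \<le> D \<and> cusum n T \<Delta> (Suc j) - C (real (Suc j) / n) \<le> D"
    and D0: "0 \<le> D" and \<alpha>\<beta>: "\<alpha> \<le> \<beta>"
    and range: "\<And>x. \<phi> x \<noteq> 0 \<Longrightarrow> \<alpha> \<le> mle n T \<Delta> x \<and> mle n T \<Delta> x \<le> \<beta>"
      "\<And>x. \<phi> x \<noteq> 0 \<Longrightarrow> \<alpha> \<le> F x \<and> F x \<le> \<beta>"
  shows "\<bar>(\<integral>x. \<phi> x * (mle n T \<Delta> x - F x) \<partial>Q) - (\<Sum>i<n. \<phi> (T i) * (\<Delta> i - F (T i))) / n\<bar>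
      \<le> 4 * B * (\<beta> - \<alpha>) * \<rho> + 4 * B * D"
proof -
  have mono: "mono (mle n T \<Delta>)" "mono F" using mle_mono F_mono by (auto simp: mono_def)
  note [measurable] = borel_measurable_mono[OF \<phi>(2)] borel_measurable_mono[OF \<phi>(3)]
    borel_measurable_mono[OF mono(1)] borel_measurable_mono[OF mono(2)]
  have [measurable]: "\<phi> \<in> borel_measurable borel"
    unfolding \<phi>(1)[abs_def] by measurable
  have "\<bar>(\<integral>x. \<phi> x * (mle n T \<Delta> x - F x) \<partial>empirical n T) - (\<integral>x. \<phi> x * (mle n T \<Delta> x - F x) \<partial>Q)\<bar>
      \<le> 4 * B * (\<beta> - \<alpha>) * \<rho>"
    using close by (intro product_integral_close[OF empirical(1)[OF n] Q _ \<phi> mono(1) range(1) mono(2) range(2) \<alpha>\<beta>])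
      (simp_all add: empirical(2)[OF n])
  moreover have "(\<integral>x. \<phi> x * (mle n T \<Delta> x - F x) \<partial>empirical n T)
      = (\<Sum>i<n. \<phi> (T i) * (mle n T \<Delta> (T i) - F (T i))) / n"
    by (rule empirical(3)[OF n]) measurable
  moreover have "(\<Sum>i<n. \<phi> (T i) * (mle n T \<Delta> (T i) - F (T i))) / n
      = (\<Sum>i<n. \<phi> (T i) * (\<Delta> i - F (T i))) / n + (\<Sum>i<n. \<phi> (T i) * (mle n T \<Delta> (T i) - \<Delta> i)) / n"
    by (simp add: sum.distrib[symmetric] add_divide_distrib[symmetric] algebra_simps)
  moreover have "\<bar>(\<Sum>i<n. \<phi> (T i) * (mle n T \<Delta> (T i) - \<Delta> i)) / n\<bar> \<le> 4 * B * D"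
    by (rule weighted_residuals_small[OF inj \<phi> D D0])
  ultimately show ?thesis by linarith
qed

text \<open>
  Adding \<open>l\<close> times the (clipped) identity to an \<open>l\<close>-Lipschitz function makes it monotone.
\<close>

lemma lipschitz_mono_decomposition:
  fixes \<phi> :: "real \<Rightarrow> real"
  assumes lip: "\<And>x y. \<bar>\<phi> x - \<phi> y\<bar> \<le> l * \<bar>x - y\<bar>" and ab: "a \<le> b"
    and zero: "\<And>x. x \<le> a \<Longrightarrow> \<phi> x = 0" "\<And>x. b \<le> x \<Longrightarrow> \<phi> x = 0"
  obtains up dn where "\<And>x. \<phi> x = up x - dn x" "mono up" "mono dn"
    "\<And>x. 0 \<le> up x" "\<And>x. up x \<le> l * (b - a)" "\<And>x. 0 \<le> dn x" "\<And>x. dn x \<le> l * (b - a)"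
proof -
  define cl where "cl x = max a (min b x)" for x
  have cl: "a \<le> cl x" "cl x \<le> b" "x \<le> y \<Longrightarrow> cl x \<le> cl y" for x y using ab by (auto simp: cl_def)
  have l: "0 \<le> l" using lip[of 0 1] by simp
  have \<phi>_cl: "\<phi> x = \<phi> (cl x)" for x using zero ab by (auto simp: cl_def max_def min_def)
  define dn where "dn x = l * (cl x - a)" for x
  define up where "up x = \<phi> x + dn x" for x
  have dn: "mono dn" "0 \<le> dn x" "dn x \<le> l * (b - a)" for x
    using cl l by (auto simp: dn_def mono_def intro!: mult_left_mono mult_nonneg_nonneg)
  have up: "mono up"
  proof (rule monoI)
    fix x y :: real assume "x \<le> y"
    then have "\<bar>\<phi> (cl x) - \<phi> (cl y)\<bar> \<le> l * (cl y - cl x)"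
      using lip[of "cl x" "cl y"] cl(3)[of x y] by simp
    then show "up x \<le> up y"
      unfolding up_def dn_def \<phi>_cl[of x] \<phi>_cl[of y] by (simp add: algebra_simps)
  qed
  have "0 \<le> up x" "up x \<le> l * (b - a)" for x
    using monoD[OF up, of "min a x" x] monoD[OF up, of x "max b x"] zero(1)[of "min a x"] zero(2)[of "max b x"] ab
    by (auto simp: up_def dn_def cl_def)
  with dn up that[of up dn] show thesis by (auto simp: up_def)
qed

section \<open>The kernel and the smoothed estimator\<close>

lemma emeasure_interval_measure_atMost:
  fixes F :: "real \<Rightarrow> real"
  assumes mono: "\<And>x y. x \<le> y \<Longrightarrow> F x \<le> F y" and right: "\<And>x. continuous (at_right x) F"
    and zero: "\<And>x. x < low \<Longrightarrow> F x = 0"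
  shows "emeasure (interval_measure F) {..v} = ennreal (F v)"
proof -
  have "(\<lambda>i. emeasure (interval_measure F) {- real i <.. v}) \<longlonglongrightarrow>
      emeasure (interval_measure F) (\<Union>i. {- real i <.. v})"
    by (rule Lim_emeasure_incseq) (auto simp: incseq_def)
  also have "(\<Union>i. {- real i <.. v}) = {..v}"
    using reals_Archimedean2 by (auto simp: minus_less_iff)
  finally have lim: "(\<lambda>i. emeasure (interval_measure F) {- real i <.. v}) \<longlonglongrightarrow>
      emeasure (interval_measure F) {..v}" .
  obtain N :: nat where N: "- min low v < real N" using reals_Archimedean2 by blast
  have "\<forall>\<^sub>F i in sequentially. emeasure (interval_measure F) {- real i <.. v} = ennreal (F v)"
    using eventually_ge_at_top[of N]
  proof eventually_elim
    case (elim i)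
    then have "- real i < low" "- real i \<le> v" using N by auto
    then show ?case
      using emeasure_interval_measure_Ioc[of "- real i" v F] mono right zero by simp
  qed
  then show ?thesis
    using lim by (metis (no_types) LIMSEQ_unique tendsto_eventually)
qed

text \<open>
  Integration by parts in the form of Tonelli's theorem: \<open>K u\<close> is the integral of its density \<open>\<kappa>\<close> over
  \<open>[u, \<infinity>)\<close>, and the measure of \<open>(-\<infinity>, v]\<close> is \<open>F v\<close>.
\<close>

lemma integral_interval_measure_by_parts:
  fixes F \<kappa> K :: "real \<Rightarrow> real"
  assumes mono: "\<And>x y. x \<le> y \<Longrightarrow> F x \<le> F y" and right: "\<And>x. continuous (at_right x) F"
    and zero: "\<And>x. x < low \<Longrightarrow> F x = 0" and F: "\<And>x. 0 \<le> F x"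
    and \<kappa>: "\<kappa> \<in> borel_measurable borel" "\<And>x. 0 \<le> \<kappa> x"
    and K: "\<And>u. ennreal (K u) = (\<integral>\<^sup>+v. ennreal (\<kappa> v) * indicator {u..} v \<partial>lborel)" "\<And>u. 0 \<le> K u"
    and K_meas: "K \<in> borel_measurable borel"
  shows "(\<integral>u. K u \<partial>interval_measure F) = (\<integral>v. \<kappa> v * F v \<partial>lborel)"
proof -
  interpret I: sigma_finite_measure "interval_measure F"
    by (rule sigma_finite_interval_measure[OF mono right])
  interpret pair_sigma_finite "interval_measure F" lborel ..
  have [measurable]: "F \<in> borel_measurable borel"
    using mono by (intro borel_measurable_mono) (auto simp: mono_def)
  note [measurable] = \<kappa>(1) K_meas
  have "(\<integral>u. K u \<partial>interval_measure F) = enn2real (\<integral>\<^sup>+u. ennreal (K u) \<partial>interval_measure F)"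
    by (rule integral_eq_nn_integral) (auto simp: K(2))
  also have "(\<integral>\<^sup>+u. ennreal (K u) \<partial>interval_measure F)
      = (\<integral>\<^sup>+u. (\<integral>\<^sup>+v. ennreal (\<kappa> v) * indicator {u..} v \<partial>lborel) \<partial>interval_measure F)"
    by (simp add: K(1))
  also have "\<dots> = (\<integral>\<^sup>+v. (\<integral>\<^sup>+u. ennreal (\<kappa> v) * indicator {p. fst p \<le> snd p} (u, v) \<partial>interval_measure F) \<partial>lborel)"
    by (subst Fubini') (auto intro!: nn_integral_cong simp: indicator_def)
  also have "\<dots> = (\<integral>\<^sup>+v. ennreal (\<kappa> v) * emeasure (interval_measure F) {..v} \<partial>lborel)"
  proof (rule nn_integral_cong)
    fix v
    have "(\<integral>\<^sup>+u. ennreal (\<kappa> v) * indicator {p. fst p \<le> snd p} (u, v) \<partial>interval_measure F)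
      = (\<integral>\<^sup>+u. ennreal (\<kappa> v) * indicator {..v} u \<partial>interval_measure F)"
      by (intro nn_integral_cong) (auto simp: indicator_def)
    then show "(\<integral>\<^sup>+u. ennreal (\<kappa> v) * indicator {p. fst p \<le> snd p} (u, v) \<partial>interval_measure F)
      = ennreal (\<kappa> v) * emeasure (interval_measure F) {..v}"
      by (simp add: nn_integral_cmult_indicator)
  qed
  also have "\<dots> = (\<integral>\<^sup>+v. ennreal (\<kappa> v * F v) \<partial>lborel)"
    using emeasure_interval_measure_atMost[OF mono right zero] \<kappa>(2) F by (simp add: ennreal_mult)
  also have "enn2real \<dots> = (\<integral>v. \<kappa> v * F v \<partial>lborel)"
    using \<kappa>(2) F by (intro integral_eq_nn_integral[symmetric]) auto
  finally show ?thesis .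
qed

locale kernel =
  fixes k :: "real \<Rightarrow> real"
  assumes kernel: "smooth_kernel k"
begin

lemma k_nonneg: "0 \<le> k u" and k_sym: "k (- u) = k u"
  and k_differentiable: "k differentiable (at u)" and k_integral: "has_bochner_integral lborel k 1"
  using kernel by (auto simp: smooth_kernel_def)

lemma k_has_deriv: "(k has_real_derivative deriv k u) (at u)"
  using k_differentiable by (simp add: DERIV_deriv_iff_real_differentiable)

lemma k_continuous: "continuous_on UNIV k"
  using k_has_deriv by (meson DERIV_continuous_on has_field_derivative_at_within)

lemma k_measurable[measurable]: "k \<in> borel_measurable borel"
  using k_continuous by (rule borel_measurable_continuous_onI)

text \<open>
  The support condition bounds the open set where \<open>k\<close> is nonzero by the closed interval, hence by its
  interior; in particular \<open>k\<close> vanishes at the two end points.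
\<close>

lemma k_zero: "1 \<le> \<bar>u\<bar> \<Longrightarrow> k u = 0"
proof (rule ccontr)
  assume u: "1 \<le> \<bar>u\<bar>" "k u \<noteq> 0"
  have "open (k -` (- {0}))"
    using k_continuous by (intro open_vimage) auto
  moreover have "k -` (- {0}) = {u. k u \<noteq> 0}" by auto
  moreover have "{u. k u \<noteq> 0} \<subseteq> {-1..1}"
    using kernel closure_subset[of "{u. k u \<noteq> 0}"] by (simp add: smooth_kernel_def)
  ultimately have "{u. k u \<noteq> 0} \<subseteq> interior {-1..1}" by (metis interior_maximal)
  then have "u \<in> {-1<..<1}" using u by (auto simp: interior_atLeastAtMost_real)
  with u show False by auto
qed

lemma k_lipschitz: "\<exists>K>0. \<forall>u v. \<bar>k u - k v\<bar> \<le> K * \<bar>u - v\<bar>"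
proof -
  have "continuous_on UNIV (deriv k)"
    using kernel unfolding smooth_kernel_def
    by (meson continuous_at_imp_continuous_on differentiable_imp_continuous_within)
  then have "compact (deriv k ` {-1..1})"
    by (intro compact_continuous_image) (auto intro: continuous_on_subset)
  then have "bounded (deriv k ` {-1..1})" by (rule compact_imp_bounded)
  then obtain K where "\<forall>y\<in>deriv k ` {-1..1}. norm y \<le> K" unfolding bounded_iff by blast
  then have K: "\<bar>deriv k u\<bar> \<le> K" if "u \<in> {-1..1}" for u using that by auto
  have zero: "deriv k u = 0" if "1 < \<bar>u\<bar>" for u
  proof (rule DERIV_imp_deriv)
    show "(k has_real_derivative 0) (at u)"
    proof (rule has_field_derivative_transform_within_open)
      show "((\<lambda>_. 0) has_real_derivative 0) (at u)" by simp
      show "open (- {-1..1::real})" by auto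
    qed (use that k_zero in auto)
  qed
  have "\<bar>deriv k u\<bar> \<le> \<bar>K\<bar> + 1" for u
  proof (cases "u \<in> {-1..1}")
    case True
    from K[OF this] show ?thesis by linarith
  next
    case False
    then show ?thesis using zero[of u] by auto
  qed
  then have "norm (k u - k v) \<le> (\<bar>K\<bar> + 1) * norm (u - v)" for u v
    by (intro field_differentiable_bound[of UNIV k "deriv k"])
       (auto intro: k_has_deriv has_field_derivative_at_within)
  then show ?thesis by (intro exI[of _ "\<bar>K\<bar> + 1"]) auto
qed

lemma k_bounded: "\<exists>K>0. \<forall>u. k u \<le> K"
proof -
  obtain K where K: "0 < K" "\<And>u v. \<bar>k u - k v\<bar> \<le> K * \<bar>u - v\<bar>" using k_lipschitz by blast
  have "k u \<le> K * 2" for u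
  proof (cases "\<bar>u\<bar> \<le> 1")
    case True
    have "k u \<le> K * \<bar>u - 1\<bar>" using K(2)[of u 1] k_zero[of 1] by simp
    also have "\<dots> \<le> K * 2" using True K(1) by (intro mult_left_mono) auto
    finally show ?thesis .
  qed (use k_zero[of u] K in auto)
  then show ?thesis using K(1) by (intro exI[of _ "K * 2"]) auto
qed

lemma integrable_k: "integrable lborel k" and integral_k: "(\<integral>u. k u \<partial>lborel) = 1"
  using k_integral by (auto dest: integrable.intros has_bochner_integral_integral_eq)

lemma integrable_k_times:
  assumes [measurable]: "f \<in> borel_measurable borel" and f: "\<And>u. \<bar>u\<bar> \<le> 1 \<Longrightarrow> \<bar>f u\<bar> \<le> B"
  shows "integrable lborel (\<lambda>u. k u * f u)"
proof (rule Bochner_Integration.integrable_bound)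
  show "integrable lborel (\<lambda>u. k u * B)" using integrable_k by simp
  have "\<bar>k u * f u\<bar> \<le> \<bar>k u * B\<bar>" for u
    using f[of u] k_zero[of u] by (cases "\<bar>u\<bar> \<le> 1") (auto simp: abs_mult intro!: mult_left_mono)
  then show "AE u in lborel. norm (k u * f u) \<le> norm (k u * B)" by simp
qed measurable

lemma integrable_k_squared: "integrable lborel (\<lambda>u. (k u)\<^sup>2)"
proof -
  obtain K where "\<And>u. k u \<le> K" using k_bounded by blast
  then show ?thesis
    unfolding power2_eq_square using k_nonneg by (intro integrable_k_times[of k K]) auto
qed

lemma integrable_second_moment: "integrable lborel (\<lambda>u. u\<^sup>2 * k u)"
  using integrable_k_times[of "\<lambda>u. u\<^sup>2" 1] by (simp add: mult.commute abs_square_le_1)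

text \<open>
  Otherwise \<open>k\<close> would vanish almost everywhere, although its integral is 1.
\<close>

lemma integral_k_weight_pos:
  assumes int: "integrable lborel (\<lambda>u. w u * k u)" and w: "\<And>u. 0 \<le> w u" "AE u in lborel. k u \<noteq> 0 \<longrightarrow> w u \<noteq> 0"
  shows "0 < (\<integral>u. w u * k u \<partial>lborel)"
proof (rule ccontr)
  assume "\<not> ?thesis"
  moreover have "0 \<le> (\<integral>u. w u * k u \<partial>lborel)" using w(1) k_nonneg by (intro integral_nonneg_AE) auto
  ultimately have "(\<integral>u. w u * k u \<partial>lborel) = 0" by linarith
  then have "AE u in lborel. w u * k u = 0"
    using integral_nonneg_eq_0_iff_AE[OF int] w(1) k_nonneg by auto
  with w(2) have "AE u in lborel. k u = 0" by eventually_elim auto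
  then have "(\<integral>u. k u \<partial>lborel) = (\<integral>u. 0 \<partial>(lborel::real measure))" by (intro integral_cong_AE) auto
  with integral_k show False by simp
qed

lemma second_moment_pos: "0 < second_moment k"
proof -
  have "AE u::real in lborel. u \<noteq> 0" by (rule AE_lborel_singleton)
  then show ?thesis
    unfolding second_moment_def by (intro integral_k_weight_pos integrable_second_moment) auto
qed

lemma integral_k_squared_pos: "0 < (\<integral>u. (k u)\<^sup>2 \<partial>lborel)"
  using integral_k_weight_pos[of k] integrable_k_squared k_nonneg by (simp add: power2_eq_square)

abbreviation smoothed :: "real \<Rightarrow> (real \<Rightarrow> real) \<Rightarrow> real \<Rightarrow> real" where
  "smoothed h q t \<equiv> (\<integral>v. k ((t - v) / h) / h * q v \<partial>lborel)"

lemma rescale_nn_integral: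
  assumes h: "0 < h" and [measurable]: "f \<in> borel_measurable borel"
  shows "(\<integral>\<^sup>+v. ennreal (k ((t - v) / h) / h) * f v \<partial>lborel) = (\<integral>\<^sup>+u. ennreal (k u) * f (t - h * u) \<partial>lborel)"
proof -
  have "(\<integral>\<^sup>+v. ennreal (k ((t - v) / h) / h) * f v \<partial>lborel)
      = \<bar>- h\<bar> * (\<integral>\<^sup>+u. ennreal (k ((t - (t + (- h) * u)) / h) / h) * f (t + (- h) * u) \<partial>lborel)"
    using h by (intro nn_integral_real_affine) auto
  also have "\<dots> = (\<integral>\<^sup>+u. ennreal h * (ennreal (k u / h) * f (t - h * u)) \<partial>lborel)"
    using h by (subst nn_integral_cmult) auto
  also have "\<dots> = (\<integral>\<^sup>+u. ennreal (k u) * f (t - h * u) \<partial>lborel)"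
    using h k_nonneg by (intro nn_integral_cong) (simp add: mult.assoc[symmetric] ennreal_mult[symmetric])
  finally show ?thesis .
qed

lemma rescale_integral:
  assumes h: "0 < h"
  shows "smoothed h f t = (\<integral>u. k u * f (t - h * u) \<partial>lborel)"
proof -
  have "smoothed h f t
      = \<bar>- h\<bar> *\<^sub>R (\<integral>u. k ((t - (t + (- h) * u)) / h) / h * f (t + (- h) * u) \<partial>lborel)"
    using h by (intro lborel_integral_real_affine) auto
  also have "\<dots> = (\<integral>u. h * (k u / h * f (t - h * u)) \<partial>lborel)"
    using h by simp
  finally show ?thesis using h by simp
qed

lemma integrated_kernel_nn:
  assumes h: "0 < h"
  shows "ennreal (integrated_kernel k ((t - u) / h)) = (\<integral>\<^sup>+v. ennreal (k ((t - v) / h) / h) * indicator {u..} v \<partial>lborel)"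
proof -
  have "(\<integral>\<^sup>+v. ennreal (k ((t - v) / h) / h) * indicator {u..} v \<partial>lborel)
      = (\<integral>\<^sup>+s. ennreal (k s) * indicator {u..} (t - h * s) \<partial>lborel)"
    by (rule rescale_nn_integral[OF h]) auto
  also have "\<dots> = (\<integral>\<^sup>+s. ennreal (indicator {..(t - u) / h} s * k s) \<partial>lborel)"
    using h by (intro nn_integral_cong) (auto simp: indicator_def field_simps)
  also have "\<dots> = ennreal (\<integral>s. indicator {..(t - u) / h} s * k s \<partial>lborel)"
    using integrable_k k_nonneg by (intro nn_integral_eq_integral) (auto intro: integrable_real_mult_indicator simp: mult.commute[of "indicator _ _"])
  finally show ?thesis by (simp add: integrated_kernel_def set_lebesgue_integral_def)
qed

lemma integrated_kernel_mono: "mono (integrated_kernel k)" and integrated_kernel_nonneg: "0 \<le> integrated_kernel k x"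
proof -
  have int: "integrable lborel (\<lambda>s. indicator {..x} s * k s)" for x
    using integrable_k by (auto intro: integrable_real_mult_indicator simp: mult.commute[of "indicator _ _"])
  show "mono (integrated_kernel k)"
    unfolding integrated_kernel_def set_lebesgue_integral_def
    using int k_nonneg by (intro monoI integral_mono) (auto simp: indicator_def)
  show "0 \<le> integrated_kernel k x"
    unfolding integrated_kernel_def set_lebesgue_integral_def
    using k_nonneg by (intro integral_nonneg_AE) auto
qed

lemma smle_eq:
  assumes h: "0 < h" and \<Delta>: "\<And>i. 0 \<le> \<Delta> i" and n: "0 < n"
  shows "smle k h n T \<Delta> t = smoothed h (mle n T \<Delta>) t"
proof -
  interpret current_status_data n T \<Delta> using \<Delta> n by unfold_locales
  have [measurable]: "integrated_kernel k \<in> borel_measurable borel"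
    using integrated_kernel_mono by (rule borel_measurable_mono)
  define x0 where "x0 = Min (T ` {..<n})"
  show ?thesis
    unfolding smle_def
  proof (rule integral_interval_measure_by_parts[where low = x0])
    fix x assume "x < x0"
    then show "mle n T \<Delta> x = 0"
      by (intro mle_eq_0) (auto simp: x0_def n intro: less_le_trans)
  qed (use mle_mono mle_right_continuous mle_nonneg integrated_kernel_nn[OF h] integrated_kernel_nonneg k_nonneg h in auto)
qed

end

lemma (in kernel) integrable_rescaled:
  assumes h: "0 < h" and [measurable]: "f \<in> borel_measurable borel" and B: "\<And>v. \<bar>v - t\<bar> \<le> h \<Longrightarrow> \<bar>f v\<bar> \<le> B"
  shows "integrable lborel (\<lambda>v. k ((t - v) / h) / h * f v)"
proof -
  have "integrable lborel (\<lambda>u. k u * f (t - h * u))"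
    using h by (intro integrable_k_times[where B = B] B) (auto simp: abs_mult)
  then have "integrable lborel (\<lambda>u. k ((t - (t + (- h) * u)) / h) / h * f (t + (- h) * u))"
    using h by simp
  then show ?thesis
    using lborel_integrable_real_affine_iff[of "- h" "\<lambda>v. k ((t - v) / h) / h * f v" t] h by simp
qed

lemma (in kernel) rescaled_zero: "0 < h \<Longrightarrow> h \<le> \<bar>v - t\<bar> \<Longrightarrow> k ((t - v) / h) = 0"
  by (rule k_zero) (simp add: abs_minus_commute)

section \<open>Bias and variance of kernel smoothing\<close>

text \<open>
  The remainder has derivative \<open>f x - f t - f' (x - t)\<close>, which is \<open>o (x - t)\<close> because \<open>f\<close> is differentiable
  at \<open>t\<close>, and the mean value inequality gains another factor \<open>x - t\<close>.
\<close>

lemma second_order_remainder: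
  fixes F f :: "real \<Rightarrow> real"
  assumes F: "\<And>x. \<bar>x - t\<bar> < w \<Longrightarrow> (F has_real_derivative f x) (at x)" and w: "0 < w"
    and f: "(f has_real_derivative f') (at t)" and e: "0 < e"
  obtains d where "0 < d" "\<And>x. \<bar>x - t\<bar> < d \<Longrightarrow> \<bar>F x - F t - f t * (x - t) - f' / 2 * (x - t)\<^sup>2\<bar> \<le> e * (x - t)\<^sup>2"
proof -
  have "((\<lambda>x. (f x - f t) / (x - t)) \<longlongrightarrow> f') (at t)"
    using f by (simp add: has_field_derivative_iff)
  then have "\<forall>\<^sub>F x in at t. dist ((f x - f t) / (x - t)) f' < e"
    using e by (rule tendstoD)
  then obtain d where d: "0 < d" "\<And>x. x \<noteq> t \<Longrightarrow> dist x t < d \<Longrightarrow> dist ((f x - f t) / (x - t)) f' < e"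
    by (auto simp: eventually_at)
  define R where "R x = F x - F t - f t * (x - t) - f' / 2 * (x - t)\<^sup>2" for x
  define R' where "R' x = f x - f t - f' * (x - t)" for x
  have R': "\<bar>R' x\<bar> \<le> e * \<bar>x - t\<bar>" if "\<bar>x - t\<bar> < d" for x
  proof (cases "x = t")
    case False
    have "\<bar>(f x - f t) / (x - t) - f'\<bar> \<le> e" using d(2)[OF False] that by (simp add: dist_real_def)
    then have "\<bar>(f x - f t) / (x - t) - f'\<bar> * \<bar>x - t\<bar> \<le> e * \<bar>x - t\<bar>" by (rule mult_right_mono) simp
    also have "\<bar>(f x - f t) / (x - t) - f'\<bar> * \<bar>x - t\<bar> = \<bar>R' x\<bar>"
      unfolding abs_mult[symmetric] using False by (subst left_diff_distrib) (simp add: R'_def)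
    finally show ?thesis .
  qed (simp add: R'_def)
  show thesis
  proof
    show "0 < min d w" using d(1) w by simp
    fix x assume x: "\<bar>x - t\<bar> < min d w"
    have "norm (R x - R t) \<le> e * \<bar>x - t\<bar> * norm (x - t)"
    proof (rule field_differentiable_bound[where S = "cball t \<bar>x - t\<bar>"])
      fix y assume "y \<in> cball t \<bar>x - t\<bar>"
      then have y: "\<bar>y - t\<bar> \<le> \<bar>x - t\<bar>" by (simp add: dist_real_def abs_minus_commute)
      have "(R has_real_derivative R' y) (at y)"
        unfolding R_def R'_def using F[of y] y x by (auto intro!: derivative_eq_intros)
      then show "(R has_real_derivative R' y) (at y within cball t \<bar>x - t\<bar>)"
        by (rule has_field_derivative_at_within)
      have "\<bar>R' y\<bar> \<le> e * \<bar>y - t\<bar>" using R' y x by simp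
      also have "\<dots> \<le> e * \<bar>x - t\<bar>" using y e by (intro mult_left_mono) auto
      finally show "norm (R' y) \<le> e * \<bar>x - t\<bar>" by simp
    qed (auto simp: dist_real_def)
    also have "e * \<bar>x - t\<bar> * norm (x - t) = e * (x - t)\<^sup>2" by (simp add: power2_eq_square)
    finally show "\<bar>F x - F t - f t * (x - t) - f' / 2 * (x - t)\<^sup>2\<bar> \<le> e * (x - t)\<^sup>2"
      by (simp add: R_def)
  qed
qed

context kernel
begin

lemma integral_odd: "(\<integral>u. k u * u \<partial>lborel) = 0"
proof -
  have "(\<integral>u. k u * u \<partial>lborel) = \<bar>-1\<bar> *\<^sub>R (\<integral>u. k (0 + (-1) * u) * (0 + (-1) * u) \<partial>lborel)"
    by (rule lborel_integral_real_affine) simp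
  also have "\<dots> = - (\<integral>u. k u * u \<partial>lborel)" by (simp add: k_sym)
  finally show ?thesis by simp
qed

text \<open>
  After the substitution \<open>v = t - h u\<close> the constant term of the Taylor expansion integrates to \<open>F t\<close>, the
  linear one to 0 by symmetry of \<open>k\<close>, and the quadratic one to the limit.
\<close>

lemma kernel_bias:
  assumes F: "\<And>x. \<bar>x - t\<bar> < w \<Longrightarrow> (F has_real_derivative f x) (at x)" and w: "0 < w"
    and f: "(f has_real_derivative f') (at t)"
    and F_meas: "F \<in> borel_measurable borel" and F_bd: "\<And>x. \<bar>F x\<bar> \<le> 1"
    and h: "h \<longlonglongrightarrow> 0" "\<forall>\<^sub>F n in sequentially. 0 < h n"
  shows "(\<lambda>n. (smoothed (h n) F t - F t) / (h n)\<^sup>2) \<longlonglongrightarrow> f' / 2 * second_moment k"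
proof (rule LIMSEQ_I)
  fix e0 :: real assume e0: "0 < e0"
  define e where "e = e0 / (2 * second_moment k)"
  have e: "0 < e" "e * second_moment k < e0" using e0 second_moment_pos by (auto simp: e_def)
  obtain d where d: "0 < d" "\<And>x. \<bar>x - t\<bar> < d \<Longrightarrow> \<bar>F x - F t - f t * (x - t) - f' / 2 * (x - t)\<^sup>2\<bar> \<le> e * (x - t)\<^sup>2"
    using second_order_remainder[OF F w f e(1)] by blast
  have "\<forall>\<^sub>F n in sequentially. h n < d" using order_tendstoD(2)[OF h(1)] d(1) .
  with h(2) have "\<forall>\<^sub>F n in sequentially.
    norm ((smoothed (h n) F t - F t) / (h n)\<^sup>2 - f' / 2 * second_moment k) < e0"
  proof eventually_elim
    case (elim n)
    define H where "H = h n"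
    have H: "0 < H" "H < d" using elim by (auto simp: H_def)
    note [measurable] = F_meas
    define R where "R x = F x - F t - f t * (x - t) - f' / 2 * (x - t)\<^sup>2" for x
    have [measurable]: "R \<in> borel_measurable borel" unfolding R_def by measurable
    have R: "\<bar>k u * R (t - H * u)\<bar> \<le> e * H\<^sup>2 * (u\<^sup>2 * k u)" for u
    proof (cases "\<bar>u\<bar> < 1")
      case True
      have "\<bar>(t - H * u) - t\<bar> < d" using True H by (simp add: abs_mult) (smt (verit) mult_left_le)
      from d(2)[OF this] have "\<bar>R (t - H * u)\<bar> \<le> e * (H * u)\<^sup>2" by (simp add: R_def)
      from mult_left_mono[OF this k_nonneg[of u]] show ?thesis
        using k_nonneg[of u] by (simp add: abs_mult power_mult_distrib algebra_simps)
    qed (use k_zero[of u] in auto)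
    have iF: "integrable lborel (\<lambda>u. k u * F (t - H * u))"
      by (rule integrable_k_times[where B = 1]) (auto intro: F_bd)
    have i1: "integrable lborel (\<lambda>u. k u * u)" by (rule integrable_k_times[where B = 1]) auto
    note i2 = integrable_second_moment
    have eq: "k u * R (t - H * u) = k u * F (t - H * u) - F t * k u + f t * H * (k u * u) - f' / 2 * H\<^sup>2 * (u\<^sup>2 * k u)" for u
      by (simp add: R_def power2_eq_square algebra_simps)
    have iR: "integrable lborel (\<lambda>u. k u * R (t - H * u))"
      unfolding eq using iF i1 i2 integrable_k by auto
    have "(\<integral>u. k u * R (t - H * u) \<partial>lborel) = (\<integral>u. k u * F (t - H * u) \<partial>lborel) - F t - f' / 2 * H\<^sup>2 * second_moment k"
      unfolding eq using iF i1 i2 integrable_k integral_k integral_odd by (simp add: second_moment_def)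
    then have bias: "smoothed H F t - F t - f' / 2 * H\<^sup>2 * second_moment k = (\<integral>u. k u * R (t - H * u) \<partial>lborel)"
      by (simp only: rescale_integral[OF H(1)])
    have "\<bar>\<integral>u. k u * R (t - H * u) \<partial>lborel\<bar> \<le> (\<integral>u. \<bar>k u * R (t - H * u)\<bar> \<partial>lborel)" by simp
    also have "\<dots> \<le> (\<integral>u. e * H\<^sup>2 * (u\<^sup>2 * k u) \<partial>lborel)"
      using iR i2 R by (intro integral_mono) auto
    also have "\<dots> = H\<^sup>2 * (e * second_moment k)" by (simp add: second_moment_def)
    also have "\<dots> < H\<^sup>2 * e0" using e(2) H by (intro mult_strict_left_mono) auto
    finally have "\<bar>smoothed H F t - F t - f' / 2 * H\<^sup>2 * second_moment k\<bar> < H\<^sup>2 * e0"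
      unfolding bias .
    then have "\<bar>smoothed H F t - F t - f' / 2 * H\<^sup>2 * second_moment k\<bar> / H\<^sup>2 < e0"
      using H by (simp add: divide_less_eq mult.commute)
    also have "\<bar>smoothed H F t - F t - f' / 2 * H\<^sup>2 * second_moment k\<bar> / H\<^sup>2
       = \<bar>(smoothed H F t - F t - f' / 2 * H\<^sup>2 * second_moment k) / H\<^sup>2\<bar>" by simp
    also have "(smoothed H F t - F t - f' / 2 * H\<^sup>2 * second_moment k) / H\<^sup>2
      = (smoothed H F t - F t) / H\<^sup>2 - f' / 2 * second_moment k"
      using H by (simp add: diff_divide_distrib)
    finally show ?case by (simp add: H_def)
  qed
  then show "\<exists>no. \<forall>n\<ge>no. norm ((smoothed (h n) F t - F t) / (h n)\<^sup>2 - f' / 2 * second_moment k) < e0"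
    by (simp add: eventually_sequentially)
qed

lemma kernel_variance:
  assumes \<Psi>: "isCont \<Psi> t" "\<Psi> \<in> borel_measurable borel" "\<And>x. \<bar>\<Psi> x\<bar> \<le> B"
    and h: "h \<longlonglongrightarrow> 0"
  shows "(\<lambda>n. \<integral>u. (k u)\<^sup>2 * \<Psi> (t - h n * u) \<partial>lborel) \<longlonglongrightarrow> (\<integral>u. (k u)\<^sup>2 \<partial>lborel) * \<Psi> t"
proof -
  note [measurable] = \<Psi>(2)
  have "(\<lambda>n. \<integral>u. (k u)\<^sup>2 * \<Psi> (t - h n * u) \<partial>lborel) \<longlonglongrightarrow> (\<integral>u. (k u)\<^sup>2 * \<Psi> t \<partial>lborel)"
  proof (rule integral_dominated_convergence[where w = "\<lambda>u. (k u)\<^sup>2 * B"])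
    show "integrable lborel (\<lambda>u. (k u)\<^sup>2 * B)" using integrable_k_squared by simp
    show "AE u in lborel. (\<lambda>n. (k u)\<^sup>2 * \<Psi> (t - h n * u)) \<longlonglongrightarrow> (k u)\<^sup>2 * \<Psi> t"
    proof (rule AE_I2)
      fix u
      have "(\<lambda>n. t - h n * u) \<longlonglongrightarrow> t - 0 * u" by (intro tendsto_intros h)
      then have "(\<lambda>n. \<Psi> (t - h n * u)) \<longlonglongrightarrow> \<Psi> t"
        using isCont_tendsto_compose[OF \<Psi>(1)] by simp
      then show "(\<lambda>n. (k u)\<^sup>2 * \<Psi> (t - h n * u)) \<longlonglongrightarrow> (k u)\<^sup>2 * \<Psi> t" by (intro tendsto_intros)
    qed
    show "AE u in lborel. norm ((k u)\<^sup>2 * \<Psi> (t - h n * u)) \<le> (k u)\<^sup>2 * B" for n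
      using \<Psi>(3) by (auto simp: abs_mult intro!: mult_left_mono)
  qed measurable
  then show ?thesis by simp
qed

end

section \<open>Measurability of the estimator\<close>

text \<open>
  Although the sorting permutation depends on real numbers, it takes countably many values, and it is
  built from finitely many comparisons.
\<close>

lemma measurable_insort_key:
  assumes [measurable]: "\<And>i. T i \<in> borel_measurable M" and L: "L \<in> measurable M (count_space UNIV)"
  shows "(\<lambda>\<omega>. insort_key (\<lambda>i. T i \<omega> :: real) (x::nat) (L \<omega>)) \<in> measurable M (count_space UNIV)"
proof (rule measurable_compose_countable[OF _ L])
  fix ys :: "nat list"
  show "(\<lambda>\<omega>. insort_key (\<lambda>i. T i \<omega>) x ys) \<in> measurable M (count_space UNIV)"
  proof (induction ys)
    case (Cons y ys)
    have [measurable]: "(\<lambda>\<omega>. y # insort_key (\<lambda>i. T i \<omega>) x ys) \<in> measurable M (count_space UNIV)"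
      by (rule measurable_compose[OF Cons]) simp
    show ?case by simp
  qed simp
qed

lemma measurable_sort_key:
  assumes [measurable]: "\<And>i. T i \<in> borel_measurable M"
  shows "(\<lambda>\<omega>. sort_key (\<lambda>i. T i \<omega> :: real) (xs :: nat list)) \<in> measurable M (count_space UNIV)"
  by (induction xs) (simp_all add: sort_key_def measurable_insort_key)

lemma measurable_order_perm[measurable (raw)]:
  assumes [measurable]: "\<And>i. T i \<in> borel_measurable M"
  shows "(\<lambda>\<omega>. order_perm n (\<lambda>i. T i \<omega>) j) \<in> measurable M (count_space UNIV)"
  unfolding order_perm_def by (rule measurable_compose[OF measurable_sort_key]) auto

lemma measurable_rank[measurable (raw)]:
  assumes [measurable]: "\<And>i. T i \<in> borel_measurable M" "v \<in> borel_measurable M"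
  shows "(\<lambda>\<omega>. rank_of n (\<lambda>i. T i \<omega>) (v \<omega>)) \<in> measurable M (count_space UNIV)"
proof -
  have "rank_of n (\<lambda>i. T i \<omega>) (v \<omega>) = (\<Sum>i<n. if T i \<omega> \<le> v \<omega> then 1 else 0)" for \<omega>
    by (simp add: rank_of_def sum.If_cases Int_def)
  then show ?thesis by simp
qed

lemma measurable_map_upt:
  assumes b: "\<And>j. b j \<in> measurable M (count_space UNIV)"
  shows "(\<lambda>\<omega>. map (\<lambda>j. b j \<omega> :: bool) [0..<m]) \<in> measurable M (count_space UNIV)"
proof (induction m)
  case (Suc m)
  have "(\<lambda>\<omega>. map (\<lambda>j. b j \<omega>) [0..<m] @ [b m \<omega>]) \<in> measurable M (count_space UNIV)"
    by (rule measurable_compose_countable[OF _ Suc]) (rule measurable_compose[OF b], simp)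
  then show ?case by simp
qed simp

text \<open>
  The estimator is a slope of a supremum over uncountably many convex functions, but it depends on the sample only
  through a natural number (how many times are at most \<open>v\<close>) and a list of bits (the ordered
  indicators); every function of these discrete quantities is measurable.
\<close>

lemma measurable_mle:
  assumes [measurable]: "\<And>i. X i \<in> borel_measurable M" "\<And>i. T i \<in> borel_measurable M" "v \<in> borel_measurable M"
  shows "(\<lambda>\<omega>. mle n (\<lambda>i. T i \<omega>) (\<lambda>i. of_bool (X i \<omega> \<le> T i \<omega>)) (v \<omega>)) \<in> borel_measurable M"
proof -
  define p where "p j \<omega> = order_perm n (\<lambda>i. T i \<omega>) j" for j \<omega>
  define bits where "bits \<omega> = map (\<lambda>j. X (p j \<omega>) \<omega> \<le> T (p j \<omega>) \<omega>) [0..<n]" for \<omega>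
  define points :: "bool list \<Rightarrow> (real \<times> real) set" where
    "points bs = (\<lambda>i. (real i / real n, (\<Sum>j<i. of_bool (bs ! j)) / real n)) ` {..n}" for bs
  define mle_of where "mle_of m bs = (if m = 0 then 0 else vector_derivative (gcm {0..1} (points bs)) (at_left (real m / real n)))"
    for m and bs
  have p[measurable]: "p j \<in> measurable M (count_space UNIV)" for j
    unfolding p_def by measurable
  have [measurable]: "(\<lambda>\<omega>. X (p j \<omega>) \<omega>) \<in> borel_measurable M" "(\<lambda>\<omega>. T (p j \<omega>) \<omega>) \<in> borel_measurable M" for j
    by (rule measurable_compose_countable[OF _ p], measurable)+
  have bits: "bits \<in> measurable M (count_space UNIV)"
    unfolding bits_def by (rule measurable_map_upt) measurable
  have rank_of: "(\<lambda>\<omega>. rank_of n (\<lambda>i. T i \<omega>) (v \<omega>)) \<in> measurable M (count_space UNIV)"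
    by measurable
  have "cusum_points n (\<lambda>i. T i \<omega>) (\<lambda>i. of_bool (X i \<omega> \<le> T i \<omega>)) = points (bits \<omega>)" for \<omega>
    unfolding cusum_points_def points_def
  proof (rule image_cong[OF refl])
    fix i assume "i \<in> {..n}"
    then have "(\<Sum>j<i. ordered_ind n (\<lambda>i. T i \<omega>) (\<lambda>i. of_bool (X i \<omega> \<le> T i \<omega>)) j) = (\<Sum>j<i. of_bool (bits \<omega> ! j) :: real)"
      by (intro sum.cong) (auto simp: ordered_ind_def bits_def p_def order_perm_def)
    then show "(real i / real n, (\<Sum>j<i. ordered_ind n (\<lambda>i. T i \<omega>) (\<lambda>i. of_bool (X i \<omega> \<le> T i \<omega>)) j) / real n)
      = (real i / real n, (\<Sum>j<i. of_bool (bits \<omega> ! j)) / real n)" by simp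
  qed
  then have "mle n (\<lambda>i. T i \<omega>) (\<lambda>i. of_bool (X i \<omega> \<le> T i \<omega>)) (v \<omega>) = mle_of (rank_of n (\<lambda>i. T i \<omega>) (v \<omega>)) (bits \<omega>)" for \<omega>
    by (simp only: mle_def mle_of_def rank_of_def Let_def)
  moreover have "(\<lambda>\<omega>. mle_of (rank_of n (\<lambda>i. T i \<omega>) (v \<omega>)) (bits \<omega>)) \<in> borel_measurable M"
    by (rule measurable_compose_countable[OF _ rank_of], rule measurable_compose[OF bits]) simp
  ultimately show ?thesis by simp
qed

section \<open>Concentration for the current status sample\<close>

text \<open>
  Fubini's theorem in the form of conditioning on \<open>V\<close>.
\<close>

lemma (in prob_space) indep_var_prob_le:
  assumes ind: "indep_var S U R V" and A: "A \<in> sets (S \<Otimes>\<^sub>M R)"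
    and b: "\<And>v. v \<in> space R \<Longrightarrow> prob {\<omega> \<in> space M. (U \<omega>, v) \<in> A} \<le> b" "0 \<le> b"
  shows "prob {\<omega> \<in> space M. (U \<omega>, V \<omega>) \<in> A} \<le> b"
proof -
  have [measurable]: "U \<in> measurable M S" "V \<in> measurable M R"
    using indep_var_rv1[OF ind] indep_var_rv2[OF ind] by auto
  interpret U: prob_space "distr M S U" by (rule prob_space_distr) simp
  interpret V: prob_space "distr M R V" by (rule prob_space_distr) simp
  interpret UV: pair_sigma_finite "distr M S U" "distr M R V" ..
  have "emeasure M {\<omega> \<in> space M. (U \<omega>, V \<omega>) \<in> A} = emeasure (distr M (S \<Otimes>\<^sub>M R) (\<lambda>\<omega>. (U \<omega>, V \<omega>))) A"
    using A by (subst emeasure_distr) (auto intro!: arg_cong2[where f = emeasure])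
  also have "\<dots> = emeasure (distr M S U \<Otimes>\<^sub>M distr M R V) A"
    using ind by (simp add: indep_var_distribution_eq)
  also have "\<dots> = (\<integral>\<^sup>+v. emeasure (distr M S U) ((\<lambda>u. (u, v)) -` A) \<partial>distr M R V)"
    using A by (intro UV.emeasure_pair_measure_alt2) (simp cong: sets_pair_measure_cong)
  also have "\<dots> \<le> (\<integral>\<^sup>+v. ennreal b \<partial>distr M R V)"
  proof (rule nn_integral_mono)
    fix v assume "v \<in> space (distr M R V)"
    then have v: "v \<in> space R" by simp
    have "emeasure (distr M S U) ((\<lambda>u. (u, v)) -` A) = emeasure M {\<omega> \<in> space M. (U \<omega>, v) \<in> A}"
      using sets_Pair2[OF A, of v] by (subst emeasure_distr) (auto intro!: arg_cong2[where f = emeasure])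
    also have "\<dots> \<le> ennreal b" using b(1)[OF v] by (simp add: emeasure_eq_measure b(2))
    finally show "emeasure (distr M S U) ((\<lambda>u. (u, v)) -` A) \<le> ennreal b" .
  qed
  also have "\<dots> = ennreal b" using V.emeasure_space_1 by simp
  finally show ?thesis by (simp add: emeasure_eq_measure b(2))
qed

lemma (in prob_space) Hoeffding_unit_interval:
  assumes I: "finite I" "card I \<le> N" and ind: "indep_vars (\<lambda>_. borel) Y I"
    and Y: "\<And>i \<omega>. i \<in> I \<Longrightarrow> 0 \<le> Y i \<omega> \<and> Y i \<omega> \<le> (1::real)" and \<mu>: "\<And>i. i \<in> I \<Longrightarrow> expectation (Y i) = \<mu> i"
    and e: "0 \<le> e" "0 < N"
  shows "prob {\<omega> \<in> space M. \<bar>\<Sum>i\<in>I. Y i \<omega> - \<mu> i\<bar> > e} \<le> 2 * exp (- 2 * e\<^sup>2 / N)"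
proof (cases "I = {}")
  case True
  then have "{\<omega> \<in> space M. \<bar>\<Sum>i\<in>I. Y i \<omega> - \<mu> i\<bar> > e} = {}" using e by auto
  then show ?thesis by (simp only: measure_empty) simp
next
  case False
  then have pos: "0 < card I" using I by auto
  interpret Hoeffding_ineq M I Y "\<lambda>_. 0" "\<lambda>_. 1" "\<Sum>i\<in>I. expectation (Y i)"
    by unfold_locales (use I ind Y in auto)
  have [measurable]: "i \<in> I \<Longrightarrow> Y i \<in> borel_measurable M" for i by (rule random_variable)
  have "(\<Sum>i\<in>I. expectation (Y i)) = (\<Sum>i\<in>I. \<mu> i)" using \<mu> by (intro sum.cong) auto
  then have "prob {\<omega> \<in> space M. \<bar>\<Sum>i\<in>I. Y i \<omega> - \<mu> i\<bar> > e}
      \<le> prob {\<omega> \<in> space M. \<bar>(\<Sum>i\<in>I. Y i \<omega>) - (\<Sum>i\<in>I. expectation (Y i))\<bar> \<ge> e}"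
    by (intro finite_measure_mono) (auto simp: sum_subtractf)
  also have "\<dots> \<le> 2 * exp (- 2 * e\<^sup>2 / (\<Sum>i\<in>I. (1 - 0)\<^sup>2))"
    using pos e by (intro Hoeffding_ineq_abs_ge) auto
  also have "\<dots> \<le> 2 * exp (- 2 * e\<^sup>2 / N)"
    using pos I(2) e by (auto simp: divide_simps mult_left_mono)
  finally show ?thesis .
qed

text \<open>
  Between two neighbouring quantiles \<open>q j\<close> the function \<open>G\<close> grows by only \<open>1 / K\<close>, and both monotone
  functions are squeezed between their values there.
\<close>

lemma uniform_close_from_grid:
  fixes G E q :: "_ \<Rightarrow> real" and K :: nat
  assumes mono: "mono G" "mono E" and range: "\<And>x. 0 \<le> G x" "\<And>x. G x \<le> 1" "\<And>x. 0 \<le> E x" "\<And>x. E x \<le> 1"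
    and K: "0 < K" "1 / real K \<le> \<rho> / 2"
    and q: "\<And>j. 0 < j \<Longrightarrow> j < K \<Longrightarrow> G (q j) = real j / real K \<and> \<bar>E (q j) - G (q j)\<bar> \<le> \<rho> / 2"
  shows "\<bar>E x - G x\<bar> \<le> \<rho>"
proof -
  have \<rho>: "0 < \<rho>" using K by (smt (verit) divide_pos_pos of_nat_0_less_iff zero_less_one divide_nonpos_nonneg)
  have up: "E x \<le> G x + \<rho>"
  proof -
    define j where "j = nat \<lfloor>real K * G x\<rfloor>"
    have fl: "real j \<le> real K * G x" "real K * G x < real j + 1"
      using range(1)[of x] by (auto simp: j_def)
    have G: "G x < real (Suc j) / K" "real (Suc j) / K \<le> G x + 1 / K"
      using fl K(1) by (auto simp: field_simps)
    show ?thesis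
    proof (cases "Suc j < K")
      case True
      have "x < q (Suc j)" using q[OF _ True] G monoD[OF mono(1), of "q (Suc j)" x] by fastforce
      then have "E x \<le> E (q (Suc j))" using monoD[OF mono(2)] by auto
      moreover have "G (q (Suc j)) = real (Suc j) / K" "\<bar>E (q (Suc j)) - G (q (Suc j))\<bar> \<le> \<rho> / 2"
        using q[OF _ True] by auto
      ultimately show ?thesis using G K by linarith
    next
      case False
      then have "1 \<le> real (Suc j) / K" using K(1) by (simp add: divide_simps)
      then show ?thesis using G range(4)[of x] K \<rho> by linarith
    qed
  qed
  have lo: "G x - \<rho> \<le> E x"
  proof (cases "G x \<le> 1 / K")
    case True
    then show ?thesis using K range(3)[of x] \<rho> by linarith
  next
    case False
    define j where "j = nat (\<lceil>real K * G x\<rceil> - 1)"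
    have KG: "1 < real K * G x" "real K * G x \<le> real K" using False K(1) range(2)[of x] by (auto simp: field_simps)
    have j: "real j = real_of_int \<lceil>real K * G x\<rceil> - 1" using KG unfolding j_def by auto
    have fl: "real j < real K * G x" "real K * G x \<le> real j + 1" "1 \<le> j"
      using j KG by linarith+
    then have jK: "0 < j" "j < K" using KG by auto
    have G: "real j / K < G x" "G x \<le> real j / K + 1 / K"
      using fl K(1) by (auto simp: field_simps)
    have "q j < x" using q[OF jK] G monoD[OF mono(1), of x "q j"] by fastforce
    then have "E (q j) \<le> E x" using monoD[OF mono(2)] by auto
    then show ?thesis using q[OF jK] G K by linarith
  qed
  from up lo show ?thesis by auto
qed

locale current_status_sample = prob_space M for M :: "'a measure" +
  fixes X T :: "nat \<Rightarrow> 'a \<Rightarrow> real" and F G :: "real \<Rightarrow> real"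
  assumes indep: "indep_vars (\<lambda>_. borel) (case_sum X T) UNIV"
    and F_cdf: "\<And>i. cdf (distr M borel (X i)) = F"
    and G_cdf: "\<And>i. cdf (distr M borel (T i)) = G"
    and G_continuous: "\<And>x. isCont G x"
begin

lemma X_measurable[measurable]: "X i \<in> borel_measurable M" and T_measurable[measurable]: "T i \<in> borel_measurable M"
  using indep[unfolded indep_vars_def, THEN conjunct1, rule_format, of "Inl i"]
    indep[unfolded indep_vars_def, THEN conjunct1, rule_format, of "Inr i"] by auto

lemma indep_X: "indep_vars (\<lambda>_. borel) X I" and indep_T: "indep_vars (\<lambda>_. borel) T I"
proof -
  have "indep_vars (\<lambda>_. borel) (case_sum X T \<circ> f) I" if "inj f" for f :: "nat \<Rightarrow> nat + nat"
  proof -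
    have "indep_vars (\<lambda>i. PiM {f i} (\<lambda>_. borel)) (\<lambda>i \<omega>. restrict (\<lambda>j. case_sum X T j \<omega>) {f i}) I"
      using that by (intro indep_vars_restrict[OF indep]) (auto simp: disjoint_family_on_def inj_eq)
    then have "indep_vars (\<lambda>_. borel) (\<lambda>i \<omega>. (restrict (\<lambda>j. case_sum X T j \<omega>) {f i}) (f i)) I"
      by (rule indep_vars_compose2) measurable
    then show ?thesis by (simp add: comp_def)
  qed
  from this[of Inl] this[of Inr] show "indep_vars (\<lambda>_. borel) X I" "indep_vars (\<lambda>_. borel) T I"
    by (simp_all add: comp_def)
qed

lemma F_eq: "F x = prob {\<omega> \<in> space M. X i \<omega> \<le> x}" and G_eq: "G x = prob {\<omega> \<in> space M. T i \<omega> \<le> x}"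
  unfolding F_cdf[of i, symmetric] G_cdf[of i, symmetric] cdf_def
  by (subst measure_distr; auto intro!: arg_cong2[where f = measure])+

lemma F_mono: "x \<le> y \<Longrightarrow> F x \<le> F y" and G_mono: "x \<le> y \<Longrightarrow> G x \<le> G y"
  unfolding F_eq[of _ 0] G_eq[of _ 0] by (auto intro!: finite_measure_mono)

lemma F_range: "0 \<le> F x" "F x \<le> 1" and G_range: "0 \<le> G x" "G x \<le> 1"
  unfolding F_eq[of _ 0] G_eq[of _ 0] by (auto simp: prob_le_1)

lemma F_measurable[measurable]: "F \<in> borel_measurable borel" and G_measurable[measurable]: "G \<in> borel_measurable borel"
  using F_mono G_mono by (auto intro!: borel_measurable_mono simp: mono_def)

abbreviation \<epsilon> :: "nat \<Rightarrow> 'a \<Rightarrow> real" where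
  "\<epsilon> i \<omega> \<equiv> of_bool (X i \<omega> \<le> T i \<omega>) - F (T i \<omega>)"

lemma indep_samples:
  "indep_var (PiM UNIV (\<lambda>_. borel)) (\<lambda>\<omega> i. X i \<omega>) (PiM UNIV (\<lambda>_. borel)) (\<lambda>\<omega> i. T i \<omega>)"
proof -
  have "indep_var (PiM (range Inl) (\<lambda>_. borel)) (\<lambda>\<omega>. restrict (\<lambda>i. case_sum X T i \<omega>) (range Inl))
     (PiM (range Inr) (\<lambda>_. borel)) (\<lambda>\<omega>. restrict (\<lambda>i. case_sum X T i \<omega>) (range Inr))"
    by (rule indep_var_restrict[OF indep]) auto
  then have "indep_var (PiM UNIV (\<lambda>_. borel)) ((\<lambda>x i. x (Inl i)) \<circ> (\<lambda>\<omega>. restrict (\<lambda>i. case_sum X T i \<omega>) (range Inl)))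
    (PiM UNIV (\<lambda>_. borel)) ((\<lambda>x i. x (Inr i)) \<circ> (\<lambda>\<omega>. restrict (\<lambda>i. case_sum X T i \<omega>) (range Inr)))"
    by (rule indep_var_compose; intro measurable_PiM_single') (auto simp: space_PiM PiE_def)
  then show ?thesis by (simp add: comp_def)
qed

text \<open>
  Conditionally on the times the ordering is fixed, and the summands are independent centred
  indicators.
\<close>

lemma noise_bound:
  assumes "l \<le> r" "r \<le> n" "0 < L"
  shows "prob {\<omega> \<in> space M. \<bar>\<Sum>j\<in>{l..<r}. \<epsilon> (order_perm n (\<lambda>i. T i \<omega>) j) \<omega>\<bar> > sqrt (real (r - l) * L)}
    \<le> 2 * exp (- 2 * L)"
proof (cases "l = r")
  case True
  then have "{\<omega> \<in> space M. \<bar>\<Sum>j\<in>{l..<r}. \<epsilon> (order_perm n (\<lambda>i. T i \<omega>) j) \<omega>\<bar> > sqrt (real (r - l) * L)} = {}" by auto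
  then show ?thesis by (simp only: measure_empty) simp
next
  case False
  let ?P = "PiM UNIV (\<lambda>_::nat. borel :: real measure)"
  define A where "A = {z \<in> space (?P \<Otimes>\<^sub>M ?P). \<bar>\<Sum>j\<in>{l..<r}. of_bool (fst z (order_perm n (snd z) j) \<le> snd z (order_perm n (snd z) j))
      - F (snd z (order_perm n (snd z) j))\<bar> > sqrt (real (r - l) * L)}"
  have comp: "(\<lambda>x. x i) \<in> borel_measurable ?P" for i by measurable
  have p[measurable]: "(\<lambda>z. order_perm n (snd z) j) \<in> measurable (?P \<Otimes>\<^sub>M ?P) (count_space UNIV)" for j
    by (rule measurable_order_perm[where T = "\<lambda>i z. snd z i"]) (rule measurable_compose[OF measurable_snd comp])
  have [measurable]: "(\<lambda>z. fst z (order_perm n (snd z) j)) \<in> borel_measurable (?P \<Otimes>\<^sub>M ?P)"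
    "(\<lambda>z. snd z (order_perm n (snd z) j)) \<in> borel_measurable (?P \<Otimes>\<^sub>M ?P)" for j
    by (rule measurable_compose_countable[OF _ p], rule measurable_compose[OF _ comp], simp)+
  have A: "A \<in> sets (?P \<Otimes>\<^sub>M ?P)" unfolding A_def by measurable
  have "prob {\<omega> \<in> space M. ((\<lambda>i. X i \<omega>), (\<lambda>i. T i \<omega>)) \<in> A} \<le> 2 * exp (- 2 * L)"
  proof (rule indep_var_prob_le[OF indep_samples A])
    fix v :: "nat \<Rightarrow> real"
    define p where "p = order_perm n v"
    define I where "I = p ` {l..<r}"
    have inj: "inj_on p {l..<r}"
      using order_perm_bij[of n v] assms(2) unfolding p_def bij_betw_def
      by (auto intro: inj_on_subset)
    have card: "card I = r - l" unfolding I_def using card_image[OF inj] by simp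
    have "prob {\<omega> \<in> space M. \<bar>\<Sum>i\<in>I. of_bool (X i \<omega> \<le> v i) - F (v i)\<bar> > sqrt (real (r - l) * L)}
        \<le> 2 * exp (- 2 * (sqrt (real (r - l) * L))\<^sup>2 / real (r - l))"
    proof (rule Hoeffding_unit_interval)
      show "indep_vars (\<lambda>_. borel) (\<lambda>i \<omega>. of_bool (X i \<omega> \<le> v i)) I"
        by (rule indep_vars_compose2[OF indep_X]) measurable
      fix i
      have "expectation (\<lambda>\<omega>. of_bool (X i \<omega> \<le> v i)) = expectation (indicator {\<omega> \<in> space M. X i \<omega> \<le> v i})"
        by (intro Bochner_Integration.integral_cong) (auto simp: indicator_def)
      also have "\<dots> = F (v i)" by (simp add: F_eq[of _ i])
      finally show "expectation (\<lambda>\<omega>. of_bool (X i \<omega> \<le> v i)) = F (v i)" .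
    qed (use False assms card in \<open>auto simp: I_def\<close>)
    also have "- 2 * (sqrt (real (r - l) * L))\<^sup>2 / real (r - l) = - 2 * L"
      using False assms by simp
    also have "{\<omega> \<in> space M. \<bar>\<Sum>i\<in>I. of_bool (X i \<omega> \<le> v i) - F (v i)\<bar> > sqrt (real (r - l) * L)}
        = {\<omega> \<in> space M. ((\<lambda>i. X i \<omega>), v) \<in> A}"
      by (auto simp: A_def I_def sum.reindex[OF inj] space_pair_measure space_PiM simp flip: p_def)
    finally show "prob {\<omega> \<in> space M. ((\<lambda>i. X i \<omega>), v) \<in> A} \<le> 2 * exp (- 2 * L)" .
  qed simp
  also have "{\<omega> \<in> space M. ((\<lambda>i. X i \<omega>), (\<lambda>i. T i \<omega>)) \<in> A}
      = {\<omega> \<in> space M. \<bar>\<Sum>j\<in>{l..<r}. \<epsilon> (order_perm n (\<lambda>i. T i \<omega>) j) \<omega>\<bar> > sqrt (real (r - l) * L)}"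
    by (auto simp: A_def space_pair_measure space_PiM)
  finally show ?thesis .
qed

lemma empirical_cdf_bound:
  assumes "0 < n" "0 \<le> \<rho>"
  shows "prob {\<omega> \<in> space M. \<bar>rank_of n (\<lambda>i. T i \<omega>) x / n - G x\<bar> > \<rho>} \<le> 2 * exp (- 2 * real n * \<rho>\<^sup>2)"
proof -
  have "prob {\<omega> \<in> space M. \<bar>\<Sum>i\<in>{..<n}. of_bool (T i \<omega> \<le> x) - G x\<bar> > n * \<rho>} \<le> 2 * exp (- 2 * (n * \<rho>)\<^sup>2 / n)"
  proof (rule Hoeffding_unit_interval)
    show "indep_vars (\<lambda>_. borel) (\<lambda>i \<omega>. of_bool (T i \<omega> \<le> x)) {..<n}"
      by (rule indep_vars_compose2[OF indep_T]) measurable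
    fix i
    have "expectation (\<lambda>\<omega>. of_bool (T i \<omega> \<le> x)) = expectation (indicator {\<omega> \<in> space M. T i \<omega> \<le> x})"
      by (intro Bochner_Integration.integral_cong) (auto simp: indicator_def)
    also have "\<dots> = G x" by (simp add: G_eq[of _ i])
    finally show "expectation (\<lambda>\<omega>. of_bool (T i \<omega> \<le> x)) = G x" .
  qed (use assms in auto)
  also have "{\<omega> \<in> space M. \<bar>\<Sum>i\<in>{..<n}. of_bool (T i \<omega> \<le> x) - G x\<bar> > n * \<rho>}
    = {\<omega> \<in> space M. \<bar>rank_of n (\<lambda>i. T i \<omega>) x / n - G x\<bar> > \<rho>}"
  proof -
    have "(\<Sum>i\<in>{..<n}. of_bool (T i \<omega> \<le> x) - G x) = n * (rank_of n (\<lambda>i. T i \<omega>) x / n - G x)" for \<omega>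
      using assms(1) by (simp add: sum_subtractf rank_of_def of_bool_def sum.If_cases Int_def algebra_simps)
    then show ?thesis using assms(1) by (simp add: abs_mult)
  qed
  also have "2 * exp (- 2 * (n * \<rho>)\<^sup>2 / n) = 2 * exp (- 2 * real n * \<rho>\<^sup>2)"
    using assms(1) by (simp add: power2_eq_square)
  finally show ?thesis .
qed

lemma G_quantile:
  assumes "0 < u" "u < 1"
  obtains x where "G x = u"
proof -
  interpret T: real_distribution "distr M borel (T 0)" by (rule real_distribution_distr) simp
  have "(G \<longlongrightarrow> 1) at_top" using T.cdf_lim_at_top_prob by (simp add: G_cdf)
  then have "\<forall>\<^sub>F x in at_top. u < G x" using assms by (intro order_tendstoD) auto
  then obtain b where b: "u < G b" by (metis eventually_at_top_linorder order_refl)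
  have "(G \<longlongrightarrow> 0) at_bot" using T.cdf_lim_at_bot by (simp add: G_cdf)
  then have "\<forall>\<^sub>F x in at_bot. G x < u" using assms by (intro order_tendstoD) auto
  then obtain a where a: "G a < u" by (metis eventually_at_bot_linorder order_refl)
  have "a \<le> b" using a b G_mono[of b a] by linarith
  then obtain x where "G x = u" using IVT[of G a u b] a b G_continuous by auto
  then show ?thesis by (rule that)
qed

definition ties :: "'a set" where
  "ties = {\<omega> \<in> space M. \<exists>i j. i \<noteq> j \<and> T i \<omega> = T j \<omega>}"

lemma ties_sets[measurable]: "ties \<in> sets M"
  unfolding ties_def by measurable

text \<open>
  Conditionally on one of two times, the other one, having a continuous distribution, avoids it almost
  surely.
\<close>

lemma ties_null: "prob ties = 0"
proof -
  have "AE \<omega> in M. T i \<omega> \<noteq> T j \<omega>" if "i \<noteq> j" for i j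
  proof -
    interpret Tj: real_distribution "distr M borel (T i)" by (rule real_distribution_distr) simp
    have ind: "indep_var borel (T i) borel (T j)"
    proof -
      have "indep_var (PiM {i} (\<lambda>_. borel)) (\<lambda>\<omega>. restrict (\<lambda>i. T i \<omega>) {i}) (PiM {j} (\<lambda>_. borel)) (\<lambda>\<omega>. restrict (\<lambda>i. T i \<omega>) {j})"
        using that by (intro indep_var_restrict[OF indep_T[of UNIV]]) auto
      then have "indep_var borel ((\<lambda>x. x i) \<circ> (\<lambda>\<omega>. restrict (\<lambda>i. T i \<omega>) {i})) borel ((\<lambda>x. x j) \<circ> (\<lambda>\<omega>. restrict (\<lambda>i. T i \<omega>) {j}))"
        by (rule indep_var_compose; measurable)
      then show ?thesis by (simp add: comp_def)
    qed
    have "{z \<in> space (borel \<Otimes>\<^sub>M (borel :: real measure)). fst z = snd z} \<in> sets (borel \<Otimes>\<^sub>M (borel :: real measure))"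
      by measurable
    then have A: "{z. fst z = snd z} \<in> sets (borel \<Otimes>\<^sub>M (borel :: real measure))"
      by (simp add: space_pair_measure)
    have "prob {\<omega> \<in> space M. (T i \<omega>, T j \<omega>) \<in> {z. fst z = snd z}} \<le> 0"
    proof (rule indep_var_prob_le[OF ind A])
      fix v :: real
      have "measure (distr M borel (T i)) {v} = 0"
        using G_continuous[of v] Tj.isCont_cdf[of v] G_cdf by simp
      also have "measure (distr M borel (T i)) {v} = prob {\<omega> \<in> space M. T i \<omega> = v}"
        by (subst measure_distr) (auto intro!: arg_cong2[where f = measure])
      finally show "prob {\<omega> \<in> space M. (T i \<omega>, v) \<in> {z. fst z = snd z}} \<le> 0" by simp
    qed simp
    then have "prob {\<omega> \<in> space M. T i \<omega> = T j \<omega>} = 0" using measure_nonneg by (auto intro: antisym)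
    then show ?thesis
      by (intro AE_I[of _ _ "{\<omega> \<in> space M. T i \<omega> = T j \<omega>}"]) (auto simp: emeasure_eq_measure)
  qed
  then have "AE \<omega> in M. \<forall>i j. i \<noteq> j \<longrightarrow> T i \<omega> \<noteq> T j \<omega>" by (auto simp: AE_all_countable)
  then have "AE \<omega> in M. \<omega> \<notin> ties" by eventually_elim (auto simp: ties_def)
  then show ?thesis by (simp add: prob_eq_0)
qed

text \<open>
  The event on which the deterministic bounds apply. It enters only through a measurable subset of large
  probability, which spares the quantifier over all real \<open>x\<close> a measurability argument.
\<close>

definition good_event :: "nat \<Rightarrow> real \<Rightarrow> real \<Rightarrow> 'a set" where
  "good_event n \<rho> L = {\<omega> \<in> space M.
     inj_on (\<lambda>i. T i \<omega>) {..<n} \<and>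
     (\<forall>x. \<bar>rank_of n (\<lambda>i. T i \<omega>) x / n - G x\<bar> \<le> \<rho>) \<and>
     (\<forall>l r. l \<le> r \<longrightarrow> r \<le> n \<longrightarrow>
        \<bar>\<Sum>j\<in>{l..<r}. \<epsilon> (order_perm n (\<lambda>i. T i \<omega>) j) \<omega>\<bar> \<le> sqrt (real (r - l) * L))}"

text \<open>
  A union bound over the \<open>K\<close> quantiles and over all stretches of the ordered sample, of which there are at
  most \<open>(n + 1)\<^sup>2\<close>.
\<close>

lemma good_event_likely:
  assumes "0 < n" "0 < \<rho>" "\<rho> \<le> 1" "0 < L"
  obtains A where "A \<in> sets M" "space M - A \<subseteq> good_event n \<rho> L"
    "prob A \<le> 6 / \<rho> * exp (- real n * \<rho>\<^sup>2 / 2) + 2 * (real n + 1)\<^sup>2 * exp (- 2 * L)"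
proof -
  define K where "K = nat \<lceil>2 / \<rho>\<rceil>"
  have K: "2 / \<rho> \<le> K" "K \<le> 2 / \<rho> + 1" using assms(2) by (auto simp: K_def)
  have K0: "0 < K" using K assms(2) by (smt (verit) divide_pos_pos of_nat_0_less_iff)
  have "\<exists>x. G x = real j / K" if "0 < j" "j < K" for j
    using G_quantile[of "real j / K"] that by auto
  then obtain q where q: "\<And>j. 0 < j \<Longrightarrow> j < K \<Longrightarrow> G (q j) = real j / K" by metis
  define B where "B j = {\<omega> \<in> space M. \<bar>rank_of n (\<lambda>i. T i \<omega>) (q j) / n - G (q j)\<bar> > \<rho> / 2}" for j
  define N where "N l r = {\<omega> \<in> space M. \<bar>\<Sum>j\<in>{l..<r}. \<epsilon> (order_perm n (\<lambda>i. T i \<omega>) j) \<omega>\<bar> > sqrt (real (r - l) * L)}" for l r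
  have [measurable]: "B j \<in> sets M" for j unfolding B_def by measurable
  have p[measurable]: "(\<lambda>\<omega>. order_perm n (\<lambda>i. T i \<omega>) j) \<in> measurable M (count_space UNIV)" for j
    by measurable
  have [measurable]: "(\<lambda>\<omega>. \<epsilon> (order_perm n (\<lambda>i. T i \<omega>) j) \<omega>) \<in> borel_measurable M" for j
    by (rule measurable_compose_countable[OF _ p]) measurable
  have [measurable]: "N l r \<in> sets M" for l r unfolding N_def by measurable
  define A where "A = ties \<union> (\<Union>j\<in>{..<K}. B j) \<union> (\<Union>z\<in>{z\<in>{..n} \<times> {..n}. fst z \<le> snd z}. N (fst z) (snd z))"
  show ?thesis
  proof
    show "A \<in> sets M" unfolding A_def by measurable
    show "space M - A \<subseteq> good_event n \<rho> L"
    proof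
      fix \<omega> assume "\<omega> \<in> space M - A"
      then have \<omega>: "\<omega> \<in> space M" "\<omega> \<notin> ties" "\<And>j. j < K \<Longrightarrow> \<omega> \<notin> B j"
        "\<And>l r. l \<le> r \<Longrightarrow> r \<le> n \<Longrightarrow> \<omega> \<notin> N l r"
        by (auto simp: A_def)
      have "\<bar>rank_of n (\<lambda>i. T i \<omega>) x / n - G x\<bar> \<le> \<rho>" for x
      proof (rule uniform_close_from_grid[where K = K and q = q and G = G and E = "\<lambda>x. rank_of n (\<lambda>i. T i \<omega>) x / n"])
        show "mono G" "mono (\<lambda>x. rank_of n (\<lambda>i. T i \<omega>) x / n)"
          using G_mono by (auto simp: mono_def intro!: divide_right_mono rank_mono)
        show "real (rank_of n (\<lambda>i. T i \<omega>) x) / real n \<le> 1" for x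
          using rank_le[of n _ x] assms(1) by simp
        show "1 / real K \<le> \<rho> / 2" using K assms(2) K0 by (simp add: field_simps)
        fix j assume "0 < j" "j < K"
        then show "G (q j) = real j / real K \<and> \<bar>rank_of n (\<lambda>i. T i \<omega>) (q j) / n - G (q j)\<bar> \<le> \<rho> / 2"
          using q[of j] \<omega>(1) \<omega>(3)[of j] by (auto simp: B_def)
      qed (use G_range K0 in auto)
      moreover have "inj_on (\<lambda>i. T i \<omega>) {..<n}"
        using \<omega>(1,2) by (auto simp: ties_def inj_on_def)
      ultimately show "\<omega> \<in> good_event n \<rho> L"
        using \<omega>(1,4) by (auto simp: good_event_def N_def not_less)
    qed
    have "prob A \<le> prob ties + prob (\<Union>j\<in>{..<K}. B j) + prob (\<Union>z\<in>{z\<in>{..n} \<times> {..n}. fst z \<le> snd z}. N (fst z) (snd z))"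
      unfolding A_def by (intro order.trans[OF measure_Un_le] add_mono) auto
    also have "prob (\<Union>j\<in>{..<K}. B j) \<le> (\<Sum>j\<in>{..<K}. 2 * exp (- 2 * real n * (\<rho> / 2)\<^sup>2))"
      using assms unfolding B_def
      by (intro order.trans[OF finite_measure_subadditive_finite] sum_mono empirical_cdf_bound) auto
    also have "\<dots> = K * (2 * exp (- real n * \<rho>\<^sup>2 / 2))" by (simp add: power_divide)
    also have "\<dots> \<le> 3 / \<rho> * (2 * exp (- real n * \<rho>\<^sup>2 / 2))"
      using K(2) assms(2,3) by (intro mult_right_mono) (auto simp: field_simps)
    also have "prob (\<Union>z\<in>{z\<in>{..n} \<times> {..n}. fst z \<le> snd z}. N (fst z) (snd z))
        \<le> (\<Sum>z\<in>{z\<in>{..n} \<times> {..n}. fst z \<le> snd z}. 2 * exp (- 2 * L))"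
    proof -
      have "prob (N l r) \<le> 2 * exp (- 2 * L)" if "l \<le> r" "r \<le> n" for l r
        unfolding N_def by (rule noise_bound[OF that assms(4)])
      then show ?thesis by (intro order.trans[OF finite_measure_subadditive_finite] sum_mono) auto
    qed
    also have "\<dots> = real (card {z\<in>{..n} \<times> {..n}. fst z \<le> snd z}) * (2 * exp (- 2 * L))" by simp
    also have "\<dots> \<le> (real n + 1)\<^sup>2 * (2 * exp (- 2 * L))"
    proof (intro mult_right_mono)
      have "card {z\<in>{..n} \<times> {..n}. fst z \<le> snd z} \<le> card ({..n} \<times> {..n})" by (rule card_mono) auto
      also have "\<dots> = (n + 1)\<^sup>2" by (simp add: power2_eq_square)
      finally have "real (card {z\<in>{..n} \<times> {..n}. fst z \<le> snd z}) \<le> real ((n + 1)\<^sup>2)" by (simp only: of_nat_le_iff)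
      then show "real (card {z\<in>{..n} \<times> {..n}. fst z \<le> snd z}) \<le> (real n + 1)\<^sup>2" by (simp add: add.commute)
    qed simp
    finally show "prob A \<le> 6 / \<rho> * exp (- real n * \<rho>\<^sup>2 / 2) + 2 * (real n + 1)\<^sup>2 * exp (- 2 * L)"
      by (simp add: ties_null algebra_simps)
  qed
qed

end

lemma (in current_status_sample) indep_pair: "indep_var borel (X i) borel (T i)"
proof -
  have "indep_var borel ((\<lambda>x. x i) \<circ> (\<lambda>\<omega> i. X i \<omega>)) borel ((\<lambda>x. x i) \<circ> (\<lambda>\<omega> i. T i \<omega>))"
    by (rule indep_var_compose[OF indep_samples]) measurable
  then show ?thesis by (simp add: comp_def)
qed

lemma (in current_status_sample) expectation_pair:
  fixes q :: "real \<Rightarrow> real \<Rightarrow> real"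
  assumes q[measurable]: "(\<lambda>z. q (fst z) (snd z)) \<in> borel_measurable (borel \<Otimes>\<^sub>M borel)" and B: "\<And>x y. \<bar>q x y\<bar> \<le> B"
  shows "expectation (\<lambda>\<omega>. q (X i \<omega>) (T i \<omega>))
    = (\<integral>\<tau>. expectation (\<lambda>\<omega>. q (X i \<omega>) \<tau>) \<partial>distr M borel (T i))"
proof -
  interpret PX: prob_space "distr M borel (X i)" by (rule prob_space_distr) simp
  interpret PT: prob_space "distr M borel (T i)" by (rule prob_space_distr) simp
  interpret PP: pair_prob_space "distr M borel (X i)" "distr M borel (T i)" ..
  have int: "integrable (distr M borel (X i) \<Otimes>\<^sub>M distr M borel (T i)) (\<lambda>z. q (fst z) (snd z))"
    using B by (intro PP.integrable_const_bound[where B = B]) (auto cong: measurable_cong_sets sets_pair_measure_cong)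
  have "expectation (\<lambda>\<omega>. q (X i \<omega>) (T i \<omega>)) = (\<integral>z. q (fst z) (snd z) \<partial>distr M (borel \<Otimes>\<^sub>M borel) (\<lambda>\<omega>. (X i \<omega>, T i \<omega>)))"
    by (subst integral_distr) auto
  also have "\<dots> = (\<integral>z. q (fst z) (snd z) \<partial>(distr M borel (X i) \<Otimes>\<^sub>M distr M borel (T i)))"
    using indep_pair[of i] by (simp add: indep_var_distribution_eq)
  also have "\<dots> = (\<integral>\<tau>. (\<integral>x. q x \<tau> \<partial>distr M borel (X i)) \<partial>distr M borel (T i))"
    using PP.integral_snd[of "\<lambda>x y. q x y"] int by (simp add: case_prod_beta')
  also have "\<dots> = (\<integral>\<tau>. expectation (\<lambda>\<omega>. q (X i \<omega>) \<tau>) \<partial>distr M borel (T i))"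
  proof (intro Bochner_Integration.integral_cong refl integral_distr)
    fix \<tau>
    have "(\<lambda>x. (\<lambda>z. q (fst z) (snd z)) (x, \<tau>)) \<in> borel_measurable borel"
      by (rule measurable_compose[OF _ q]) simp
    then show "(\<lambda>x. q x \<tau>) \<in> borel_measurable borel" by simp
  qed simp
  finally show ?thesis .
qed

text \<open>
  Given \<open>T i = \<tau>\<close>, the indicator is a Bernoulli variable with success probability \<open>F \<tau>\<close>, which has mean
  \<open>F \<tau>\<close> and variance \<open>F \<tau> (1 - F \<tau>)\<close>.
\<close>

lemma (in current_status_sample) weighted_noise_moments:
  assumes a[measurable]: "a \<in> borel_measurable borel" and B: "\<And>x. \<bar>a x\<bar> \<le> B"
  shows "expectation (\<lambda>\<omega>. a (T i \<omega>) * \<epsilon> i \<omega>) = 0"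
    and "expectation (\<lambda>\<omega>. (a (T i \<omega>) * \<epsilon> i \<omega>)\<^sup>2) = (\<integral>\<tau>. (a \<tau>)\<^sup>2 * (F \<tau> * (1 - F \<tau>)) \<partial>distr M borel (T i))"
proof -
  have bd: "\<bar>of_bool (x \<le> \<tau>) - F \<tau>\<bar> \<le> 1" for x \<tau> using F_range[of \<tau>] by (auto simp: of_bool_def)
  have B0: "0 \<le> B" using B[of 0] by linarith
  have bd1: "\<bar>a \<tau> * (of_bool (x \<le> \<tau>) - F \<tau>)\<bar> \<le> B" for x \<tau>
    using mult_mono[OF B[of \<tau>] bd[of x \<tau>]] B0 by (simp add: abs_mult)
  have ind: "expectation (\<lambda>\<omega>. of_bool (X i \<omega> \<le> \<tau>)) = F \<tau>" for \<tau>
  proof -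
    have "expectation (\<lambda>\<omega>. of_bool (X i \<omega> \<le> \<tau>)) = expectation (indicator {\<omega> \<in> space M. X i \<omega> \<le> \<tau>})"
      by (intro Bochner_Integration.integral_cong) (auto simp: indicator_def)
    also have "\<dots> = F \<tau>" by (simp add: F_eq[of _ i])
    finally show ?thesis .
  qed
  have int: "integrable M (\<lambda>\<omega>. of_bool (X i \<omega> \<le> \<tau>) :: real)" for \<tau>
    by (rule integrable_const_bound[where B = 1]) auto
  have "expectation (\<lambda>\<omega>. a (T i \<omega>) * \<epsilon> i \<omega>)
    = (\<integral>\<tau>. expectation (\<lambda>\<omega>. a \<tau> * (of_bool (X i \<omega> \<le> \<tau>) - F \<tau>)) \<partial>distr M borel (T i))"
    by (rule expectation_pair[where B = B and q = "\<lambda>x \<tau>. a \<tau> * (of_bool (x \<le> \<tau>) - F \<tau>)"])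
      (measurable, rule bd1)
  also have "\<dots> = 0" using int ind by (simp add: prob_space)
  finally show "expectation (\<lambda>\<omega>. a (T i \<omega>) * \<epsilon> i \<omega>) = 0" .
  have "expectation (\<lambda>\<omega>. (a (T i \<omega>) * \<epsilon> i \<omega>)\<^sup>2)
    = (\<integral>\<tau>. expectation (\<lambda>\<omega>. (a \<tau> * (of_bool (X i \<omega> \<le> \<tau>) - F \<tau>))\<^sup>2) \<partial>distr M borel (T i))"
  proof (rule expectation_pair[where B = "B\<^sup>2" and q = "\<lambda>x \<tau>. (a \<tau> * (of_bool (x \<le> \<tau>) - F \<tau>))\<^sup>2"])
    show "\<bar>(a \<tau> * (of_bool (x \<le> \<tau>) - F \<tau>))\<^sup>2\<bar> \<le> B\<^sup>2" for x \<tau>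
      using power_mono[OF bd1[of \<tau> x], of 2] by simp
  qed measurable
  also have "\<dots> = (\<integral>\<tau>. (a \<tau>)\<^sup>2 * (F \<tau> * (1 - F \<tau>)) \<partial>distr M borel (T i))"
  proof (rule Bochner_Integration.integral_cong[OF refl])
    fix \<tau>
    have "(a \<tau> * (of_bool (X i \<omega> \<le> \<tau>) - F \<tau>))\<^sup>2 = (a \<tau>)\<^sup>2 * (of_bool (X i \<omega> \<le> \<tau>) * (1 - 2 * F \<tau>) + (F \<tau>)\<^sup>2)" for \<omega>
      by (auto simp: of_bool_def power2_eq_square algebra_simps)
    then have "expectation (\<lambda>\<omega>. (a \<tau> * (of_bool (X i \<omega> \<le> \<tau>) - F \<tau>))\<^sup>2)
      = (a \<tau>)\<^sup>2 * (F \<tau> * (1 - 2 * F \<tau>) + (F \<tau>)\<^sup>2)"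
      using int ind by (simp add: prob_space)
    then show "expectation (\<lambda>\<omega>. (a \<tau> * (of_bool (X i \<omega> \<le> \<tau>) - F \<tau>))\<^sup>2) = (a \<tau>)\<^sup>2 * (F \<tau> * (1 - F \<tau>))"
      by (simp add: power2_eq_square algebra_simps)
  qed
  finally show "expectation (\<lambda>\<omega>. (a (T i \<omega>) * \<epsilon> i \<omega>)\<^sup>2) = (\<integral>\<tau>. (a \<tau>)\<^sup>2 * (F \<tau> * (1 - F \<tau>)) \<partial>distr M borel (T i))" .
qed

section \<open>Characteristic functions: triangular arrays and vanishing perturbations\<close>

lemma exp_minus_approx:
  fixes x :: real
  assumes "0 \<le> x"
  shows "\<bar>1 - x - exp (- x)\<bar> \<le> x\<^sup>2"
proof (cases "x \<le> 1")
  case True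
  have "1 - x \<le> exp (- x)" using exp_ge_add_one_self[of "- x"] by simp
  moreover have "exp (- x) \<le> 1 / (1 + x)"
  proof -
    have "1 + x \<le> exp x" using exp_ge_add_one_self[of x] by simp
    then show ?thesis using assms by (simp add: exp_minus divide_simps)
  qed
  moreover have "1 / (1 + x) \<le> 1 - x + x\<^sup>2"
  proof -
    have "1 \<le> (1 - x + x\<^sup>2) * (1 + x)" using assms by (simp add: algebra_simps power2_eq_square)
    then show ?thesis using assms by (simp add: divide_le_eq)
  qed
  ultimately show ?thesis by auto
next
  case False
  then have "x \<le> x\<^sup>2" by (simp add: power2_eq_square)
  moreover have "exp (- x) \<le> 1" using assms by simp
  ultimately show ?thesis using False exp_gt_zero[of "- x"] unfolding abs_le_iff by linarith
qed

text \<open>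
  Uniformly small summands make Lindeberg's condition trivial. Each characteristic function differs from
  \<open>exp (- \<theta>\<^sup>2 s / 2)\<close> by a quantity of smaller order than \<open>s\<close>, and the differences of \<open>n\<close> factors of modulus
  at most 1 add up. Comparing with an exponential, rather than with \<open>1 - \<theta>\<^sup>2 s / 2\<close>, makes the limit of the
  product immediate.
\<close>

lemma (in prob_space) clt_bounded_array_char:
  fixes Y :: "nat \<Rightarrow> nat \<Rightarrow> 'a \<Rightarrow> real"
  assumes ind: "\<And>n. indep_vars (\<lambda>_. borel) (Y n) {..<n}"
    and bound: "\<forall>\<^sub>F n in sequentially. \<forall>i<n. \<forall>\<omega>. \<bar>Y n i \<omega>\<bar> \<le> b n" and b: "b \<longlonglongrightarrow> 0"
    and mean: "\<And>n i. i < n \<Longrightarrow> expectation (Y n i) = 0"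
    and var: "\<And>n i. i < n \<Longrightarrow> expectation (\<lambda>\<omega>. (Y n i \<omega>)\<^sup>2) = s n"
    and s: "(\<lambda>n. real n * s n) \<longlonglongrightarrow> \<sigma>2"
  shows "(\<lambda>n. char (distr M borel (\<lambda>\<omega>. \<Sum>i<n. Y n i \<omega>)) \<theta>) \<longlonglongrightarrow> complex_of_real (exp (- (\<theta>\<^sup>2 * \<sigma>2 / 2)))"
proof -
  define R where "R n = \<bar>\<theta>\<bar> ^ 3 / 6 * \<bar>b n\<bar> * (real n * s n) + \<theta>^4 / 4 * (b n)\<^sup>2 * (real n * s n)" for n
  have [measurable]: "i < n \<Longrightarrow> Y n i \<in> borel_measurable M" for n i
    using ind[of n] by (auto simp: indep_vars_def)
  have "\<forall>\<^sub>F n in sequentially. norm (char (distr M borel (\<lambda>\<omega>. \<Sum>i<n. Y n i \<omega>)) \<theta>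
      - complex_of_real (exp (- (\<theta>\<^sup>2 * (real n * s n) / 2)))) \<le> R n"
    using bound
  proof eventually_elim
    case (elim n)
    define x where "x = \<theta>\<^sup>2 * s n / 2"
    have factor: "norm (char (distr M borel (Y n i)) \<theta> - complex_of_real (exp (- x)))
        \<le> \<bar>\<theta>\<bar> ^ 3 / 6 * \<bar>b n\<bar> * s n + \<theta>^4 / 4 * (b n)\<^sup>2 * s n" if i: "i < n" for i
    proof -
      have bd: "\<bar>Y n i \<omega>\<bar> \<le> \<bar>b n\<bar>" for \<omega> using elim i by (meson abs_ge_self order.trans)
      have [measurable]: "Y n i \<in> borel_measurable M" using i by measurable
      have sq: "(Y n i \<omega>)\<^sup>2 \<le> (b n)\<^sup>2" for \<omega> using bd[of \<omega>] by (rule abs_le_square_iff[THEN iffD1])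
      have int1: "integrable M (Y n i)" using bd by (intro integrable_const_bound[where B = "\<bar>b n\<bar>"]) auto
      have int2: "integrable M (\<lambda>\<omega>. (Y n i \<omega>)\<^sup>2)" using sq by (intro integrable_const_bound[where B = "(b n)\<^sup>2"]) auto
      have s0: "0 \<le> s n" unfolding var[OF i, symmetric] by (intro integral_nonneg_AE) auto
      have sb: "s n \<le> (b n)\<^sup>2"
      proof -
        have "s n \<le> expectation (\<lambda>_. (b n)\<^sup>2)"
          unfolding var[OF i, symmetric] using int2 sq by (intro integral_mono) auto
        then show ?thesis by (simp add: prob_space)
      qed
      have third: "norm (char (distr M borel (Y n i)) \<theta> - (1 - \<theta>\<^sup>2 * s n / 2))
          \<le> \<theta>\<^sup>2 / 6 * expectation (\<lambda>\<omega>. min (6 * (Y n i \<omega>)\<^sup>2) (\<bar>\<theta>\<bar> * \<bar>Y n i \<omega>\<bar> ^ 3))"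
        using int1 int2 mean[OF i] var[OF i] by (intro char_approx3') auto
      have "expectation (\<lambda>\<omega>. min (6 * (Y n i \<omega>)\<^sup>2) (\<bar>\<theta>\<bar> * \<bar>Y n i \<omega>\<bar> ^ 3))
          \<le> expectation (\<lambda>\<omega>. \<bar>\<theta>\<bar> * \<bar>b n\<bar> * (Y n i \<omega>)\<^sup>2)"
      proof (rule integral_mono)
        show "integrable M (\<lambda>\<omega>. min (6 * (Y n i \<omega>)\<^sup>2) (\<bar>\<theta>\<bar> * \<bar>Y n i \<omega>\<bar> ^ 3))"
          using sq by (intro integrable_const_bound[where B = "6 * (b n)\<^sup>2"]) (auto simp: min.coboundedI1)
        fix \<omega>
        have "\<bar>Y n i \<omega>\<bar> ^ 3 = \<bar>Y n i \<omega>\<bar> * (Y n i \<omega>)\<^sup>2" by (simp add: power2_eq_square power3_eq_cube)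
        also have "\<dots> \<le> \<bar>b n\<bar> * (Y n i \<omega>)\<^sup>2" using bd by (intro mult_right_mono) auto
        finally have "\<bar>\<theta>\<bar> * \<bar>Y n i \<omega>\<bar> ^ 3 \<le> \<bar>\<theta>\<bar> * (\<bar>b n\<bar> * (Y n i \<omega>)\<^sup>2)" by (intro mult_left_mono) auto
        then show "min (6 * (Y n i \<omega>)\<^sup>2) (\<bar>\<theta>\<bar> * \<bar>Y n i \<omega>\<bar> ^ 3) \<le> \<bar>\<theta>\<bar> * \<bar>b n\<bar> * (Y n i \<omega>)\<^sup>2"
          by (simp add: mult.assoc min.coboundedI2)
      qed (use int2 in auto)
      also have "\<dots> = \<bar>\<theta>\<bar> * \<bar>b n\<bar> * s n" using var[OF i] by simp
      finally have "\<theta>\<^sup>2 / 6 * expectation (\<lambda>\<omega>. min (6 * (Y n i \<omega>)\<^sup>2) (\<bar>\<theta>\<bar> * \<bar>Y n i \<omega>\<bar> ^ 3))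
          \<le> \<theta>\<^sup>2 / 6 * (\<bar>\<theta>\<bar> * \<bar>b n\<bar> * s n)" by (intro mult_left_mono) auto
      also have "\<dots> = \<bar>\<theta>\<bar> ^ 3 / 6 * \<bar>b n\<bar> * s n"
        by (simp add: power2_eq_square power3_eq_cube)
      finally have 1: "norm (char (distr M borel (Y n i)) \<theta> - (1 - \<theta>\<^sup>2 * s n / 2)) \<le> \<bar>\<theta>\<bar> ^ 3 / 6 * \<bar>b n\<bar> * s n"
        using third by linarith
      have "norm (complex_of_real (1 - \<theta>\<^sup>2 * s n / 2) - complex_of_real (exp (- x))) = \<bar>1 - x - exp (- x)\<bar>"
        unfolding x_def of_real_diff[symmetric] norm_of_real ..
      also have "\<dots> \<le> x\<^sup>2" using s0 by (intro exp_minus_approx) (simp add: x_def)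
      also have "\<dots> = \<theta>^4 / 4 * (s n * s n)" by (simp add: x_def power2_eq_square power4_eq_xxxx)
      also have "\<dots> \<le> \<theta>^4 / 4 * ((b n)\<^sup>2 * s n)" using sb s0 by (intro mult_left_mono mult_right_mono) auto
      finally have 2: "norm (complex_of_real (1 - \<theta>\<^sup>2 * s n / 2) - complex_of_real (exp (- x))) \<le> \<theta>^4 / 4 * (b n)\<^sup>2 * s n"
        by (simp add: mult.assoc)
      show ?thesis
        using norm_triangle_ineq[of "char (distr M borel (Y n i)) \<theta> - (1 - \<theta>\<^sup>2 * s n / 2)"
            "complex_of_real (1 - \<theta>\<^sup>2 * s n / 2) - complex_of_real (exp (- x))"] 1 2 by simp
    qed
    have x0: "0 \<le> x" if "0 < n"
    proof -
      have "0 \<le> s n" unfolding var[OF that, symmetric] by (intro integral_nonneg_AE) auto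
      then show ?thesis by (simp add: x_def)
    qed
    have "char (distr M borel (\<lambda>\<omega>. \<Sum>i<n. Y n i \<omega>)) \<theta> = (\<Prod>i<n. char (distr M borel (Y n i)) \<theta>)"
      by (rule char_distr_sum[OF ind])
    moreover have "complex_of_real (exp (- (\<theta>\<^sup>2 * (real n * s n) / 2))) = (\<Prod>i<n. complex_of_real (exp (- x)))"
      by (simp add: x_def exp_of_nat_mult[symmetric] algebra_simps flip: of_real_power)
    ultimately have "norm (char (distr M borel (\<lambda>\<omega>. \<Sum>i<n. Y n i \<omega>)) \<theta>
        - complex_of_real (exp (- (\<theta>\<^sup>2 * (real n * s n) / 2))))
      = norm ((\<Prod>i<n. char (distr M borel (Y n i)) \<theta>) - (\<Prod>i<n. complex_of_real (exp (- x))))" by simp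
    also have "\<dots> \<le> (\<Sum>i<n. norm (char (distr M borel (Y n i)) \<theta> - complex_of_real (exp (- x))))"
    proof (rule norm_prod_diff)
      fix i assume i: "i \<in> {..<n}"
      interpret Yi: real_distribution "distr M borel (Y n i)" using i by (intro real_distribution_distr) auto
      show "norm (char (distr M borel (Y n i)) \<theta>) \<le> 1" by (rule Yi.cmod_char_le_1)
      show "norm (complex_of_real (exp (- x))) \<le> 1" using x0 i by (simp add: norm_of_real)
    qed
    also have "\<dots> \<le> (\<Sum>i<n. \<bar>\<theta>\<bar> ^ 3 / 6 * \<bar>b n\<bar> * s n + \<theta>^4 / 4 * (b n)\<^sup>2 * s n)"
      by (intro sum_mono factor) simp
    also have "\<dots> = R n" by (simp add: R_def algebra_simps)
    finally show ?case .
  qed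
  moreover have "R \<longlonglongrightarrow> 0"
  proof -
    have "R \<longlonglongrightarrow> \<bar>\<theta>\<bar> ^ 3 / 6 * \<bar>0\<bar> * \<sigma>2 + \<theta>^4 / 4 * 0\<^sup>2 * \<sigma>2"
      unfolding R_def by (intro tendsto_intros b s)
    then show ?thesis by simp
  qed
  ultimately have "(\<lambda>n. char (distr M borel (\<lambda>\<omega>. \<Sum>i<n. Y n i \<omega>)) \<theta>
      - complex_of_real (exp (- (\<theta>\<^sup>2 * (real n * s n) / 2)))) \<longlonglongrightarrow> 0"
    by (rule Lim_null_comparison)
  moreover have "(\<lambda>n. complex_of_real (exp (- (\<theta>\<^sup>2 * (real n * s n) / 2)))) \<longlonglongrightarrow> complex_of_real (exp (- (\<theta>\<^sup>2 * \<sigma>2 / 2)))"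
    by (intro tendsto_intros s) simp
  ultimately show ?thesis by (rule Lim_transform[rotated])
qed

lemma char_normal:
  assumes "0 < \<sigma>"
  shows "char (density lborel (normal_density \<mu> \<sigma>)) \<theta> = iexp (\<theta> * \<mu>) * complex_of_real (exp (- (\<theta>\<^sup>2 * \<sigma>\<^sup>2 / 2)))"
proof -
  interpret std: real_distribution "std_normal_distribution" by (rule real_dist_normal_dist)
  have "distributed std_normal_distribution lborel (\<lambda>x. x) (normal_density 0 1)"
    by (auto simp: distributed_def distr_id2 borel_measurable_normal_density)
  then have "distributed std_normal_distribution lborel (\<lambda>x. \<mu> + \<sigma> * x) (normal_density (\<mu> + \<sigma> * 0) (\<bar>\<sigma>\<bar> * 1))"
    using assms by (intro std.normal_density_affine) auto
  then have "density lborel (normal_density \<mu> \<sigma>) = distr std_normal_distribution lborel (\<lambda>x. \<mu> + \<sigma> * x)"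
    using assms by (simp add: distributed_def)
  also have "\<dots> = distr std_normal_distribution borel (\<lambda>x. \<mu> + \<sigma> * x)"
    by (intro distr_cong) auto
  finally have "char (density lborel (normal_density \<mu> \<sigma>)) \<theta> = (CLINT x|std_normal_distribution. iexp (\<theta> * (\<mu> + \<sigma> * x)))"
    by (simp add: char_def integral_distr)
  also have "\<dots> = (CLINT x|std_normal_distribution. iexp (\<theta> * \<mu>) * iexp ((\<theta> * \<sigma>) * x))"
    by (intro Bochner_Integration.integral_cong) (auto simp: exp_add[symmetric] algebra_simps)
  also have "\<dots> = iexp (\<theta> * \<mu>) * char std_normal_distribution (\<theta> * \<sigma>)"
    by (simp add: char_def)
  also have "char std_normal_distribution (\<theta> * \<sigma>) = complex_of_real (exp (- (\<theta>\<^sup>2 * \<sigma>\<^sup>2 / 2)))"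
    by (simp add: char_std_normal_distribution power_mult_distrib)
  finally show ?thesis .
qed

text \<open>
  Slutsky's theorem for a remainder that is small outside an event of vanishing probability: the
  integrand of the characteristic function changes by at most \<open>\<bar>\<theta>\<bar> r\<close> off the event and by at most 2 on it.
\<close>

lemma (in prob_space) slutsky_weak_conv:
  fixes Z S :: "nat \<Rightarrow> 'a \<Rightarrow> real"
  assumes [measurable]: "\<And>n. Z n \<in> borel_measurable M" "\<And>n. S n \<in> borel_measurable M"
    and N: "real_distribution N"
    and S: "\<And>\<theta>. (\<lambda>n. char (distr M borel (S n)) \<theta>) \<longlonglongrightarrow> \<psi> \<theta>"
    and N_char: "\<And>\<theta>. char N \<theta> = iexp (\<theta> * \<mu>) * \<psi> \<theta>"
    and bad: "\<And>n. A n \<in> sets M" "(\<lambda>n. prob (A n)) \<longlonglongrightarrow> 0"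
    and close: "\<forall>\<^sub>F n in sequentially. \<forall>\<omega>\<in>space M - A n. \<bar>Z n \<omega> - S n \<omega> - \<mu>\<bar> \<le> r n" and r: "r \<longlonglongrightarrow> 0"
  shows "weak_conv_m (\<lambda>n. distr M borel (Z n)) N"
proof (rule levy_continuity[OF _ N])
  show "real_distribution (distr M borel (Z n))" for n by (rule real_distribution_distr) simp
  fix \<theta>
  have "\<forall>\<^sub>F n in sequentially. norm (char (distr M borel (Z n)) \<theta> - iexp (\<theta> * \<mu>) * char (distr M borel (S n)) \<theta>)
      \<le> \<bar>\<theta>\<bar> * \<bar>r n\<bar> + 2 * prob (A n)"
    using close
  proof eventually_elim
    case (elim n)
    have int: "integrable M (\<lambda>\<omega>. iexp (\<theta> * Z n \<omega>))" "integrable M (\<lambda>\<omega>. iexp (\<theta> * \<mu>) * iexp (\<theta> * S n \<omega>))"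
      by (auto intro!: integrable_const_bound[where B = 1] simp: norm_mult)
    have "char (distr M borel (Z n)) \<theta> - iexp (\<theta> * \<mu>) * char (distr M borel (S n)) \<theta>
      = (CLINT \<omega>|M. iexp (\<theta> * Z n \<omega>) - iexp (\<theta> * \<mu>) * iexp (\<theta> * S n \<omega>))"
      using int by (simp add: char_def integral_distr)
    also have "norm \<dots> \<le> (\<integral>\<omega>. norm (iexp (\<theta> * Z n \<omega>) - iexp (\<theta> * \<mu>) * iexp (\<theta> * S n \<omega>)) \<partial>M)"
      by (rule integral_norm_bound)
    also have "\<dots> \<le> (\<integral>\<omega>. \<bar>\<theta>\<bar> * \<bar>r n\<bar> + 2 * indicator (A n) \<omega> \<partial>M)"
    proof (rule integral_mono)
      show "integrable M (\<lambda>\<omega>. norm (iexp (\<theta> * Z n \<omega>) - iexp (\<theta> * \<mu>) * iexp (\<theta> * S n \<omega>)))"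
        using int by auto
      show "integrable M (\<lambda>\<omega>. \<bar>\<theta>\<bar> * \<bar>r n\<bar> + 2 * indicator (A n) \<omega>)" using bad(1)[of n] by (intro Bochner_Integration.integrable_add integrable_const integrable_mult_right integrable_real_indicator)
          (auto simp: emeasure_eq_measure)
      fix \<omega> assume \<omega>: "\<omega> \<in> space M"
      have eq: "iexp (\<theta> * \<mu>) * iexp (\<theta> * S n \<omega>) = iexp (\<theta> * (S n \<omega> + \<mu>))"
        by (simp add: exp_add[symmetric] algebra_simps)
      show "norm (iexp (\<theta> * Z n \<omega>) - iexp (\<theta> * \<mu>) * iexp (\<theta> * S n \<omega>)) \<le> \<bar>\<theta>\<bar> * \<bar>r n\<bar> + 2 * indicator (A n) \<omega>"
      proof (cases "\<omega> \<in> A n")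
        case True
        have "norm (iexp (\<theta> * Z n \<omega>) - iexp (\<theta> * \<mu>) * iexp (\<theta> * S n \<omega>)) \<le> 1 + 1"
          unfolding eq by (rule order.trans[OF norm_triangle_ineq4]) simp
        also have "\<dots> \<le> \<bar>\<theta>\<bar> * \<bar>r n\<bar> + 2 * indicator (A n) \<omega>" using True by simp
        finally show ?thesis .
      next
        case False
        have "norm (iexp (\<theta> * Z n \<omega>) - iexp (\<theta> * (S n \<omega> + \<mu>))) \<le> \<bar>\<theta> * Z n \<omega> - \<theta> * (S n \<omega> + \<mu>)\<bar>"
        proof -
          let ?a = "\<theta> * Z n \<omega>" and ?b = "\<theta> * (S n \<omega> + \<mu>)"
          have "iexp ?a - iexp ?b = iexp ?b * (iexp (?a - ?b) - 1)"
            by (simp add: right_diff_distrib exp_add[symmetric])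
          then have "norm (iexp ?a - iexp ?b) = norm (iexp (?a - ?b) - 1)" by (simp add: norm_mult)
          also have "\<dots> \<le> \<bar>?a - ?b\<bar>" using iexp_approx1[of "?a - ?b" 0] by simp
          finally show ?thesis .
        qed
        also have "\<dots> = \<bar>\<theta>\<bar> * \<bar>Z n \<omega> - S n \<omega> - \<mu>\<bar>"
          by (simp add: abs_mult[symmetric] algebra_simps)
        also have "\<dots> \<le> \<bar>\<theta>\<bar> * \<bar>r n\<bar>"
          using elim \<omega> False by (intro mult_left_mono) (auto intro: order.trans)
        finally show ?thesis using False eq by simp
      qed
    qed
    also have "\<dots> = \<bar>\<theta>\<bar> * \<bar>r n\<bar> + 2 * prob (A n)"
    proof -
      have "integrable M (indicator (A n) :: 'a \<Rightarrow> real)"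
        using bad(1)[of n] by (intro integrable_real_indicator) (auto simp: emeasure_eq_measure)
      then show ?thesis using bad(1)[of n] by (simp add: prob_space)
    qed
    finally show ?case .
  qed
  moreover have "(\<lambda>n. \<bar>\<theta>\<bar> * \<bar>r n\<bar> + 2 * prob (A n)) \<longlonglongrightarrow> 0"
    using tendsto_add[OF tendsto_mult[OF tendsto_const tendsto_rabs[OF r]] tendsto_mult[OF tendsto_const bad(2)], of "\<bar>\<theta>\<bar>" 2] by simp
  ultimately have "(\<lambda>n. char (distr M borel (Z n)) \<theta> - iexp (\<theta> * \<mu>) * char (distr M borel (S n)) \<theta>) \<longlonglongrightarrow> 0"
    by (rule Lim_null_comparison)
  moreover have "(\<lambda>n. iexp (\<theta> * \<mu>) * char (distr M borel (S n)) \<theta>) \<longlonglongrightarrow> char N \<theta>"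
    unfolding N_char by (intro tendsto_intros S)
  ultimately show "(\<lambda>n. char (distr M borel (Z n)) \<theta>) \<longlonglongrightarrow> char N \<theta>"
    by (rule Lim_transform[rotated])
qed

section \<open>Asymptotic normality\<close>

text \<open>
  What the asymptotic argument uses of the model: on the support, two-sided linear growth of \<open>G\<close>, a lower
  bound for the growth of \<open>F\<close>, and a Lipschitz density \<open>g\<close>; in a window around \<open>t\<close>, smoothness of \<open>F\<close>. One constant \<open>\<kappa>\<close> serves for
  all lower and one constant \<open>\<beta>\<close> for all upper bounds.
\<close>

locale smle_setting = current_status_sample M X T F G + kernel k
  for M :: "'a measure" and X T :: "nat \<Rightarrow> 'a \<Rightarrow> real" and F G k :: "real \<Rightarrow> real" +
  fixes f g :: "real \<Rightarrow> real" and M\<^sub>0 t w \<kappa> \<beta> f' :: real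
  assumes T_distr: "\<And>i. distr M borel (T i) = density lborel (\<lambda>x. ennreal (g x))"
    and g_measurable[measurable]: "g \<in> borel_measurable borel" and g_nonneg: "\<And>x. 0 \<le> g x"
    and window: "0 < w" "w \<le> t" "t + w \<le> M\<^sub>0"
    and pos: "0 < \<kappa>" "0 < \<beta>"
    and F_growth: "\<And>x y. 0 \<le> x \<Longrightarrow> x \<le> y \<Longrightarrow> y \<le> M\<^sub>0 \<Longrightarrow> \<kappa> * (y - x) \<le> F y - F x"
    and G_growth: "\<And>x y. 0 \<le> x \<Longrightarrow> x \<le> y \<Longrightarrow> y \<le> M\<^sub>0 \<Longrightarrow> \<kappa> * (y - x) \<le> G y - G x"
    and G_lipschitz: "\<And>x y. 0 \<le> x \<Longrightarrow> x \<le> y \<Longrightarrow> y \<le> M\<^sub>0 \<Longrightarrow> G y - G x \<le> \<beta> * (y - x)"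
    and F_lipschitz: "\<And>x y. t - w \<le> x \<Longrightarrow> x \<le> y \<Longrightarrow> y \<le> t + w \<Longrightarrow> F y - F x \<le> \<beta> * (y - x)"
    and g_lower: "\<And>x. 0 \<le> x \<Longrightarrow> x \<le> M\<^sub>0 \<Longrightarrow> \<kappa> \<le> g x"
    and g_lipschitz: "\<And>x y. 0 \<le> x \<Longrightarrow> x \<le> M\<^sub>0 \<Longrightarrow> 0 \<le> y \<Longrightarrow> y \<le> M\<^sub>0 \<Longrightarrow> \<bar>g x - g y\<bar> \<le> \<beta> * \<bar>x - y\<bar>"
    and F_deriv: "\<And>x. \<bar>x - t\<bar> < w \<Longrightarrow> (F has_real_derivative f x) (at x)"
    and f_deriv: "(f has_real_derivative f') (at t)"
begin

text \<open>
  The reciprocal of \<open>g\<close> on the support, frozen outside so that it is Lipschitz on the whole line.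
\<close>

definition \<gamma> :: "real \<Rightarrow> real" where "\<gamma> x = 1 / g (max 0 (min M\<^sub>0 x))"

text \<open>
  The weight that turns integration against the distribution of the times into kernel smoothing.
\<close>

definition \<phi> :: "real \<Rightarrow> real \<Rightarrow> real" where "\<phi> h x = k ((t - x) / h) / h * \<gamma> x"

lemma M0_pos: "0 < M\<^sub>0" using window by linarith

lemma \<gamma>_bounds: "0 < \<gamma> x" "\<gamma> x \<le> 1 / \<kappa>"
proof -
  have "\<kappa> \<le> g (max 0 (min M\<^sub>0 x))" using M0_pos by (intro g_lower) auto
  then show "0 < \<gamma> x" "\<gamma> x \<le> 1 / \<kappa>" using pos by (auto simp: \<gamma>_def divide_simps)
qed

lemma \<gamma>_eq: "0 \<le> x \<Longrightarrow> x \<le> M\<^sub>0 \<Longrightarrow> \<gamma> x = 1 / g x"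
  by (simp add: \<gamma>_def)

lemma \<gamma>_lipschitz: "\<bar>\<gamma> x - \<gamma> y\<bar> \<le> \<beta> / \<kappa>\<^sup>2 * \<bar>x - y\<bar>"
proof -
  define x' y' where "x' = max 0 (min M\<^sub>0 x)" and "y' = max 0 (min M\<^sub>0 y)"
  have r: "0 \<le> x'" "x' \<le> M\<^sub>0" "0 \<le> y'" "y' \<le> M\<^sub>0" using M0_pos by (auto simp: x'_def y'_def)
  have g: "\<kappa> \<le> g x'" "\<kappa> \<le> g y'" using r by (auto intro: g_lower)
  have "\<gamma> x - \<gamma> y = (g y' - g x') / (g x' * g y')"
    using g pos by (simp add: \<gamma>_def x'_def[symmetric] y'_def[symmetric] field_simps)
  then have "\<bar>\<gamma> x - \<gamma> y\<bar> = \<bar>g y' - g x'\<bar> / (g x' * g y')" using g pos by (simp add: abs_mult)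
  also have "\<dots> \<le> (\<beta> * \<bar>y' - x'\<bar>) / (\<kappa> * \<kappa>)"
    using g pos r by (intro frac_le mult_mono g_lipschitz) auto
  also have "\<dots> \<le> (\<beta> * \<bar>x - y\<bar>) / (\<kappa> * \<kappa>)"
    using pos by (intro divide_right_mono mult_left_mono) (auto simp: x'_def y'_def)
  finally show ?thesis by (simp add: power2_eq_square)
qed

lemma \<gamma>_continuous: "isCont \<gamma> x"
proof -
  have "(\<beta> / \<kappa>\<^sup>2)-lipschitz_on UNIV \<gamma>"
    using \<gamma>_lipschitz pos by (intro lipschitz_onI) (auto simp: dist_real_def)
  then show ?thesis using lipschitz_on_continuous_on continuous_on_eq_continuous_at by blast
qed

lemma \<gamma>_measurable[measurable]: "\<gamma> \<in> borel_measurable borel"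
  using \<gamma>_continuous by (intro borel_measurable_continuous_onI continuous_at_imp_continuous_on) auto

lemma \<phi>_measurable[measurable]: "\<phi> h \<in> borel_measurable borel"
  unfolding \<phi>_def[abs_def] by measurable

lemma \<phi>_support: "0 < h \<Longrightarrow> \<phi> h x \<noteq> 0 \<Longrightarrow> \<bar>x - t\<bar> < h"
  using rescaled_zero[of h x t] by (auto simp: \<phi>_def not_less[symmetric])

text \<open>
  The Lipschitz constant of \<open>\<phi> h\<close> is of order \<open>1 / h\<^sup>2\<close> and its support has length \<open>2 h\<close>, so both monotone
  parts are of order \<open>1 / h\<close>.
\<close>

lemma \<phi>_decomposition:
  obtains B where "0 < B" "\<And>h. 0 < h \<Longrightarrow> h \<le> 1 \<Longrightarrow> \<exists>up dn. (\<forall>x. \<phi> h x = up x - dn x) \<and> mono up \<and> mono dn \<and>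
    (\<forall>x. 0 \<le> up x \<and> up x \<le> B / h \<and> 0 \<le> dn x \<and> dn x \<le> B / h)"
proof -
  obtain K where K: "0 < K" "\<And>u v. \<bar>k u - k v\<bar> \<le> K * \<bar>u - v\<bar>" using k_lipschitz by blast
  obtain K' where K': "0 < K'" "\<And>u. k u \<le> K'" using k_bounded by blast
  define l where "l = K / \<kappa> + K' * (\<beta> / \<kappa>\<^sup>2)"
  have l: "0 < l" using K K' pos by (simp add: l_def add_pos_pos)
  show thesis
  proof
    show "0 < 2 * l" using l by simp
    fix h :: real assume h: "0 < h" "h \<le> 1"
    have lip: "\<bar>\<phi> h x - \<phi> h y\<bar> \<le> l / h\<^sup>2 * \<bar>x - y\<bar>" for x y
    proof -
      let ?a = "k ((t - x) / h) / h" and ?b = "k ((t - y) / h) / h"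
      have "\<phi> h x - \<phi> h y = (?a - ?b) * \<gamma> x + ?b * (\<gamma> x - \<gamma> y)" by (simp add: \<phi>_def algebra_simps)
      then have "\<bar>\<phi> h x - \<phi> h y\<bar> \<le> \<bar>?a - ?b\<bar> * \<gamma> x + ?b * \<bar>\<gamma> x - \<gamma> y\<bar>"
        using \<gamma>_bounds(1)[of x] k_nonneg h by (simp add: abs_mult[symmetric] order.trans[OF abs_triangle_ineq] abs_mult)
      also have "\<dots> \<le> (K / h\<^sup>2 * \<bar>x - y\<bar>) * (1 / \<kappa>) + (K' / h) * (\<beta> / \<kappa>\<^sup>2 * \<bar>x - y\<bar>)"
      proof (intro add_mono mult_mono \<gamma>_bounds \<gamma>_lipschitz divide_right_mono K')
        have "\<bar>?a - ?b\<bar> = \<bar>k ((t - x) / h) - k ((t - y) / h)\<bar> / h" using h by (simp add: diff_divide_distrib[symmetric] abs_divide)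
        also have "\<dots> \<le> K * \<bar>(t - x) / h - (t - y) / h\<bar> / h" using h by (intro divide_right_mono K) auto
        also have "\<bar>(t - x) / h - (t - y) / h\<bar> = \<bar>x - y\<bar> / h" using h by (simp add: diff_divide_distrib[symmetric] abs_divide abs_minus_commute)
        finally show "\<bar>?a - ?b\<bar> \<le> K / h\<^sup>2 * \<bar>x - y\<bar>" by (simp add: power2_eq_square)
      qed (use \<gamma>_bounds(1)[of x] K K' h pos in auto)
      also have "(K' / h) * (\<beta> / \<kappa>\<^sup>2 * \<bar>x - y\<bar>) \<le> (K' / h\<^sup>2) * (\<beta> / \<kappa>\<^sup>2 * \<bar>x - y\<bar>)"
      proof (intro mult_right_mono divide_left_mono)
        show "h\<^sup>2 \<le> h" using h by (simp add: power2_eq_square mult_left_le)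
      qed (use h K' pos in auto)
      finally show ?thesis by (simp add: l_def algebra_simps add_divide_distrib)
    qed
    obtain up dn where ud: "\<And>x. \<phi> h x = up x - dn x" "mono up" "mono dn"
      "\<And>x. 0 \<le> up x" "\<And>x. up x \<le> l / h\<^sup>2 * ((t + h) - (t - h))" "\<And>x. 0 \<le> dn x" "\<And>x. dn x \<le> l / h\<^sup>2 * ((t + h) - (t - h))"
    proof (rule lipschitz_mono_decomposition[OF lip])
      show "t - h \<le> t + h" using h by simp
      show "\<phi> h x = 0" if "x \<le> t - h" for x using \<phi>_support[OF h(1), of x] that by fastforce
      show "\<phi> h x = 0" if "t + h \<le> x" for x using \<phi>_support[OF h(1), of x] that by fastforce
    qed blast
    have "l / h\<^sup>2 * ((t + h) - (t - h)) = 2 * l / h" using h by (simp add: power2_eq_square)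
    with ud show "\<exists>up dn. (\<forall>x. \<phi> h x = up x - dn x) \<and> mono up \<and> mono dn \<and>
      (\<forall>x. 0 \<le> up x \<and> up x \<le> 2 * l / h \<and> 0 \<le> dn x \<and> dn x \<le> 2 * l / h)"
      by (intro exI[of _ up] exI[of _ dn]) auto
  qed
qed

lemma integral_\<phi>:
  assumes h: "0 < h" "h \<le> w" and [measurable]: "q \<in> borel_measurable borel"
  shows "(\<integral>x. \<phi> h x * q x \<partial>distr M borel (T i)) = smoothed h q t"
proof -
  have "(\<integral>x. \<phi> h x * q x \<partial>distr M borel (T i)) = (\<integral>x. g x * (\<phi> h x * q x) \<partial>lborel)"
    unfolding T_distr using g_nonneg by (subst integral_density) auto
  also have "\<dots> = smoothed h q t"
  proof (rule Bochner_Integration.integral_cong[OF refl])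
    fix v
    show "g v * (\<phi> h v * q v) = k ((t - v) / h) / h * q v"
    proof (cases "\<bar>v - t\<bar> < h")
      case True
      then have "0 \<le> v" "v \<le> M\<^sub>0" using h window by auto
      then show ?thesis using g_lower[of v] pos by (simp add: \<phi>_def \<gamma>_eq)
    next
      case False
      then show ?thesis using rescaled_zero[OF h(1), of v t] by (simp add: \<phi>_def)
    qed
  qed
  finally show ?thesis .
qed

abbreviation \<Delta> :: "'a \<Rightarrow> nat \<Rightarrow> real" where "\<Delta> \<omega> \<equiv> \<lambda>i. of_bool (X i \<omega> \<le> T i \<omega>)"

text \<open>
  The quantity \<open>D\<close> bounds the gap between diagram and minorant near \<open>t\<close>, from \<open>cusum_above_C\<close> with
  \<open>\<eta> = \<kappa> \<delta>\<close>; \<open>m\<close> is a lower bound for the number of times in an interval of length \<open>h\<close>; and \<open>e\<close> bounds the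
  distance of both the estimator and \<open>F\<close> from \<open>F t\<close> on the support of the kernel. This crude bound of order
  \<open>h\<close> takes the place of a rate of convergence of the estimator.
\<close>

lemma smle_linearization:
  assumes \<omega>: "\<omega> \<in> good_event n \<rho> L" and n: "0 < n" and L: "0 < L" and \<rho>: "0 < \<rho>"
    and h: "0 < h" "2 * h \<le> w" and \<delta>: "0 < \<delta>" "\<delta> + h \<le> w"
    and decomp: "\<And>x. \<phi> h x = up x - dn x" "mono up" "mono dn" "\<And>x. 0 \<le> up x" "\<And>x. up x \<le> B" "\<And>x. 0 \<le> dn x" "\<And>x. dn x \<le> B"
    and D: "D = \<kappa> * \<delta> * (2 * \<beta> * \<delta> + 2 * \<rho>) + L / (4 * (\<kappa> * \<delta>) * real n)"
    and m: "m = real n * (\<kappa> * h - 2 * \<rho>)" "0 < m"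
    and e: "e = 2 * \<beta> * h + sqrt (L / m) + real n * D / m"
  shows "\<bar>smle k h n (\<lambda>i. T i \<omega>) (\<Delta> \<omega>) t - smoothed h F t
      - (\<Sum>i<n. \<phi> h (T i \<omega>) * \<epsilon> i \<omega>) / n\<bar> \<le> 4 * B * (2 * e) * \<rho> + 4 * B * D"
proof -
  interpret noisy_data n "\<lambda>i. T i \<omega>" "\<Delta> \<omega>" F L
    using \<omega> n L F_mono by unfold_locales (auto simp: good_event_def)
  let ?T = "\<lambda>i. T i \<omega>" and ?mle = "mle n (\<lambda>i. T i \<omega>) (\<Delta> \<omega>)"
  have inj: "inj_on ?T {..<n}" and unif: "\<And>x. \<bar>rank_of n ?T x / n - G x\<bar> \<le> \<rho>"
    using \<omega> by (auto simp: good_event_def)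
  have D0: "0 \<le> D" unfolding D using pos \<delta> \<rho> L n by (intro add_nonneg_nonneg mult_nonneg_nonneg divide_nonneg_nonneg) auto
  have "0 \<le> sqrt (L / m)" "0 \<le> real n * D / m" using m(2) D0 L by auto
  then have e0: "2 * \<beta> * h \<le> e" "0 \<le> e" unfolding e using mult_pos_pos[OF pos(2) h(1)] by linarith+
  have gap: "cusum n ?T (\<Delta> \<omega>) l - C (real l / n) \<le> D"
    if x: "\<bar>x - t\<bar> \<le> h" and l: "l \<le> n" "\<And>j. j < l \<Longrightarrow> ?T (order_perm n ?T j) \<le> x"
      "\<And>j. l \<le> j \<Longrightarrow> j < n \<Longrightarrow> x \<le> ?T (order_perm n ?T j)" for x l
  proof -
    have xr: "0 \<le> x - \<delta>" "x + \<delta> \<le> M\<^sub>0" using x \<delta> window by auto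
    have "cusum n ?T (\<Delta> \<omega>) l - C (real l / n) \<le> (\<kappa> * \<delta> * (n * (2 * \<beta> * \<delta> + 2 * \<rho>)) + L / (4 * (\<kappa> * \<delta>))) / n"
    proof (rule cusum_above_C[OF l, where \<delta> = \<delta>])
      show "0 < \<kappa> * \<delta>" using pos \<delta> by simp
      show "F y \<le> F x - \<kappa> * \<delta>" if "y \<le> x - \<delta>" for y
        using F_mono[OF that] F_growth[of "x - \<delta>" x] xr \<delta> by auto
      show "F x + \<kappa> * \<delta> \<le> F y" if "x + \<delta> \<le> y" for y
        using F_mono[OF that] F_growth[of x "x + \<delta>"] xr \<delta> by auto
      have "{i. i < n \<and> \<bar>?T i - x\<bar> < \<delta>} \<subseteq> {i. i < n \<and> ?T i \<le> x + \<delta>} - {i. i < n \<and> ?T i \<le> x - \<delta>}" by auto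
      then have "card {i. i < n \<and> \<bar>?T i - x\<bar> < \<delta>} \<le> card ({i. i < n \<and> ?T i \<le> x + \<delta>} - {i. i < n \<and> ?T i \<le> x - \<delta>})"
        by (intro card_mono) auto
      also have "\<dots> = rank_of n ?T (x + \<delta>) - rank_of n ?T (x - \<delta>)"
        unfolding rank_of_def using \<delta> by (subst card_Diff_subset) auto
      finally have "real (card {i. i < n \<and> \<bar>?T i - x\<bar> < \<delta>}) \<le> real (rank_of n ?T (x + \<delta>)) - real (rank_of n ?T (x - \<delta>))"
        using rank_mono[of "x - \<delta>" "x + \<delta>" n ?T] \<delta> by simp
      also have "\<dots> = n * (rank_of n ?T (x + \<delta>) / n - rank_of n ?T (x - \<delta>) / n)" using n by (simp add: field_simps)
      also have "\<dots> \<le> n * ((G (x + \<delta>) + \<rho>) - (G (x - \<delta>) - \<rho>))"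
        using unif[of "x + \<delta>"] unif[of "x - \<delta>"] by (intro mult_left_mono diff_mono) auto
      also have "\<dots> \<le> n * (2 * \<beta> * \<delta> + 2 * \<rho>)"
        using G_lipschitz[of "x - \<delta>" "x + \<delta>"] xr \<delta> by (intro mult_left_mono) (auto simp: algebra_simps)
      finally show "real (card {i. i < n \<and> \<bar>?T i - x\<bar> < \<delta>}) \<le> n * (2 * \<beta> * \<delta> + 2 * \<rho>)" .
    qed
    also have "\<dots> = D" unfolding D using n by (simp add: add_divide_distrib)
    finally show ?thesis .
  qed
  have gap_rank: "cusum n ?T (\<Delta> \<omega>) (rank_of n ?T x) - C (real (rank_of n ?T x) / n) \<le> D" if "\<bar>x - t\<bar> \<le> h" for x
  proof (rule gap[OF that rank_le])
    show "?T (order_perm n ?T j) \<le> x" if "j < rank_of n ?T x" for j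
      using rank_iff[of j x] that rank_le[of n ?T x] by simp
    show "x \<le> ?T (order_perm n ?T j)" if "rank_of n ?T x \<le> j" "j < n" for j
      using rank_iff[of j x] that by simp
  qed
  have rank_gap: "real (rank_of n ?T x) + m \<le> rank_of n ?T (x + h)" if "0 \<le> x" "x + h \<le> M\<^sub>0" for x
  proof -
    have "\<kappa> * h - 2 * \<rho> \<le> rank_of n ?T (x + h) / n - rank_of n ?T x / n"
      using unif[of x] unif[of "x + h"] G_growth[of x "x + h"] that h by auto
    then have "n * (\<kappa> * h - 2 * \<rho>) \<le> n * (rank_of n ?T (x + h) / n - rank_of n ?T x / n)" by (rule mult_left_mono) simp
    then show ?thesis using n by (simp add: m(1) right_diff_distrib)
  qed
  have up: "?mle (t + h) \<le> F t + e"
  proof -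
    have "?mle (t + h) \<le> F (t + h + h) + sqrt (L / m) + n * D / m"
    proof (rule mle_upper[OF gap_rank _ m(2) D0 F_range(1)])
      show "real (rank_of n ?T (t + h)) + m \<le> real (rank_of n ?T (t + h + h))"
        using h window by (intro rank_gap) auto
    qed (use h in auto)
    then show ?thesis using F_lipschitz[of t "t + h + h"] h window unfolding e by (simp add: algebra_simps)
  qed
  have lo: "F t - e \<le> ?mle (t - h)"
  proof -
    have "F (t - h - h) - sqrt (L / m) - n * D / m \<le> ?mle (t - h)"
    proof (rule mle_lower[OF gap_rank _ m(2) D0])
      show "real (rank_of n ?T (t - h - h)) + m \<le> real (rank_of n ?T (t - h))"
        using rank_gap[of "t - h - h"] h window by simp
    qed (use h in auto)
    then show ?thesis using F_lipschitz[of "t - h - h" t] h window unfolding e by (simp add: algebra_simps)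
  qed
  have mle_range: "F t - e \<le> ?mle x \<and> ?mle x \<le> F t + e" if "\<phi> h x \<noteq> 0" for x
  proof -
    have "x \<le> t + h" "t - h \<le> x" using \<phi>_support[OF h(1) that] by auto
    from this[THEN mle_mono] show ?thesis using up lo by linarith
  qed
  have F_range': "F t - e \<le> F x \<and> F x \<le> F t + e" if "\<phi> h x \<noteq> 0" for x
  proof -
    have x: "\<bar>x - t\<bar> < h" by (rule \<phi>_support[OF h(1) that])
    have "F (t + h) - F t \<le> \<beta> * h" "F t - F (t - h) \<le> \<beta> * h"
      using F_lipschitz[of t "t + h"] F_lipschitz[of "t - h" t] h by auto
    moreover have "\<beta> * h \<le> e" using e0 mult_pos_pos[OF pos(2) h(1)] by linarith
    moreover have "x \<le> t + h" "t - h \<le> x" using x by auto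
    from this[THEN F_mono] have "F x \<le> F (t + h)" "F (t - h) \<le> F x" .
    ultimately show ?thesis by linarith
  qed
  have Q: "real_distribution (distr M borel (T 0))" by (rule real_distribution_distr) simp
  have lin: "\<bar>(\<integral>x. \<phi> h x * (?mle x - F x) \<partial>distr M borel (T 0)) - (\<Sum>i<n. \<phi> h (?T i) * (\<Delta> \<omega> i - F (?T i))) / n\<bar>
      \<le> 4 * B * ((F t + e) - (F t - e)) * \<rho> + 4 * B * D"
  proof (rule mle_linearization[OF Q _ inj decomp _ D0 _ mle_range F_range'])
    show "\<bar>rank_of n ?T x / n - measure (distr M borel (T 0)) {..x}\<bar> \<le> \<rho>" for x
      using unif[of x] fun_cong[OF G_cdf[of 0], of x] by (simp add: cdf_def)
    show "F t - e \<le> F t + e" using e0 by simp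
    fix j assume j: "j < n" "\<phi> h (?T (order_perm n ?T j)) \<noteq> 0"
    let ?x = "?T (order_perm n ?T j)"
    have x: "\<bar>?x - t\<bar> \<le> h" using \<phi>_support[OF h(1) j(2)] by simp
    show "cusum n ?T (\<Delta> \<omega>) j - C (real j / n) \<le> D \<and> cusum n ?T (\<Delta> \<omega>) (Suc j) - C (real (Suc j) / n) \<le> D"
      using j(1) by (intro conjI gap[OF x]) (auto intro!: order_perm_sorted)
  qed
  have [measurable]: "?mle \<in> borel_measurable borel"
    using mle_mono by (intro borel_measurable_mono) (auto simp: mono_def)
  have "(\<integral>x. \<phi> h x * (?mle x - F x) \<partial>distr M borel (T 0)) = (\<integral>v. k ((t - v) / h) / h * (?mle v - F v) \<partial>lborel)"
    using h by (intro integral_\<phi>) auto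
  also have "\<dots> = (\<integral>v. k ((t - v) / h) / h * ?mle v - k ((t - v) / h) / h * F v \<partial>lborel)"
    by (simp add: right_diff_distrib)
  also have "\<dots> = smoothed h ?mle t - smoothed h F t"
  proof (rule Bochner_Integration.integral_diff)
    show "integrable lborel (\<lambda>v. k ((t - v) / h) / h * ?mle v)"
      using mle_nonneg mle_mono by (intro integrable_rescaled[OF h(1), where B = "?mle (t + h)"]) auto
    show "integrable lborel (\<lambda>v. k ((t - v) / h) / h * F v)"
      using F_range by (intro integrable_rescaled[OF h(1), where B = 1]) auto
  qed
  also have "smoothed h ?mle t = smle k h n ?T (\<Delta> \<omega>) t"
    by (rule smle_eq[symmetric, OF h(1) _ n]) simp
  finally show ?thesis using lin by simp
qed

text \<open>
  The case of an empty sample, in which the bandwidth expression degenerates to 0, is included because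
  the laws in the limit theorem are indexed by all natural numbers.
\<close>

lemma smle_measurable:
  assumes "0 \<le> h" "n = 0 \<Longrightarrow> h = 0" "0 < n \<Longrightarrow> 0 < h"
  shows "(\<lambda>\<omega>. smle k h n (\<lambda>i. T i \<omega>) (\<Delta> \<omega>) t) \<in> borel_measurable M"
proof (cases "n = 0")
  case True
  have "mle 0 T' \<Delta>' = (\<lambda>_. 0)" for T' \<Delta>' by (simp add: mle_def fun_eq_iff)
  with True show ?thesis by (simp add: smle_def)
next
  case False
  then have n: "0 < n" "0 < h" using assms by auto
  have [measurable]: "(\<lambda>z. mle n (\<lambda>i. T i (fst z)) (\<Delta> (fst z)) (snd z)) \<in> borel_measurable (M \<Otimes>\<^sub>M borel)"
    by (rule measurable_mle[where X = "\<lambda>i z. X i (fst z)" and T = "\<lambda>i z. T i (fst z)"]) measurable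
  have "(\<lambda>\<omega>. \<integral>v. (\<lambda>z. k ((t - snd z) / h) / h * mle n (\<lambda>i. T i (fst z)) (\<Delta> (fst z)) (snd z)) (\<omega>, v) \<partial>lborel) \<in> borel_measurable M"
    by (rule lborel.borel_measurable_lebesgue_integral) measurable
  then show ?thesis using smle_eq[OF n(2) _ n(1)] by simp
qed

text \<open>
  The scaled summands have size of order \<open>n powr (-2/5)\<close> and variance of order \<open>1 / n\<close>.
\<close>

lemma linear_term_char:
  assumes c: "0 < c"
  defines "h \<equiv> \<lambda>n::nat. c * real n powr (- 1/5)"
  shows "(\<lambda>n. char (distr M borel (\<lambda>\<omega>. real n powr (2/5) * ((\<Sum>i<n. \<phi> (h n) (T i \<omega>) * \<epsilon> i \<omega>) / n))) \<theta>)
    \<longlonglongrightarrow> complex_of_real (exp (- (\<theta>\<^sup>2 * (F t * (1 - F t) / (c * g t) * (\<integral>u. (k u)\<^sup>2 \<partial>lborel)) / 2)))"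
proof -
  obtain K where K: "0 < K" "\<And>u. k u \<le> K" using k_bounded by blast
  define a where "a n x = real n powr (- 3/5) * \<phi> (h n) x" for n x
  define Y where "Y n i \<omega> = a n (T i \<omega>) * \<epsilon> i \<omega>" for n i \<omega>
  define b where "b n = real n powr (- 3/5) * (K / h n * (1 / \<kappa>))" for n
  have h0: "0 \<le> h n" for n using c by (simp add: h_def)
  have [measurable]: "a n \<in> borel_measurable borel" for n unfolding a_def by measurable
  have a_bd: "\<bar>a n x\<bar> \<le> b n" for n x
  proof -
    have "\<bar>\<phi> (h n) x\<bar> = k ((t - x) / h n) / h n * \<gamma> x"
      using k_nonneg h0[of n] \<gamma>_bounds(1)[of x] by (simp add: \<phi>_def abs_mult)
    also have "\<dots> \<le> K / h n * (1 / \<kappa>)"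
      using k_nonneg h0[of n] \<gamma>_bounds[of x] K by (intro mult_mono divide_right_mono) auto
    finally have "real n powr (- 3/5) * \<bar>\<phi> (h n) x\<bar> \<le> b n" unfolding b_def by (rule mult_left_mono) simp
    then show ?thesis by (simp add: a_def abs_mult)
  qed
  have eps: "\<bar>\<epsilon> i \<omega>\<bar> \<le> 1" for i \<omega> using F_range[of "T i \<omega>"] by (auto simp: of_bool_def)
  define s where "s n = (\<integral>\<tau>. (a n \<tau>)\<^sup>2 * (F \<tau> * (1 - F \<tau>)) \<partial>distr M borel (T 0))" for n
  have "(\<lambda>n. char (distr M borel (\<lambda>\<omega>. \<Sum>i<n. Y n i \<omega>)) \<theta>)
    \<longlonglongrightarrow> complex_of_real (exp (- (\<theta>\<^sup>2 * (F t * (1 - F t) / (c * g t) * (\<integral>u. (k u)\<^sup>2 \<partial>lborel)) / 2)))"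
  proof (rule clt_bounded_array_char[where b = b and s = s])
    show "indep_vars (\<lambda>_. borel) (Y n) {..<n}" for n
    proof -
      have "indep_vars (\<lambda>i. PiM {Inl i, Inr i} (\<lambda>_. borel)) (\<lambda>i \<omega>. restrict (\<lambda>j. case_sum X T j \<omega>) {Inl i, Inr i}) {..<n}"
        by (intro indep_vars_restrict[OF indep]) (auto simp: disjoint_family_on_def)
      then have "indep_vars (\<lambda>_. borel) (\<lambda>i \<omega>. (\<lambda>x. a n (x (Inr i)) * (of_bool (x (Inl i) \<le> x (Inr i)) - F (x (Inr i))))
          (restrict (\<lambda>j. case_sum X T j \<omega>) {Inl i, Inr i})) {..<n}"
      proof (rule indep_vars_compose2)
        fix i
        let ?P = "PiM {Inl i, Inr i :: nat + nat} (\<lambda>_. borel :: real measure)"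
        have "(\<lambda>x. (x (Inl i), x (Inr i))) \<in> measurable ?P (borel \<Otimes>\<^sub>M borel)"
          by (intro measurable_Pair measurable_component_singleton) auto
        moreover have "(\<lambda>z. a n (snd z) * (of_bool (fst z \<le> snd z) - F (snd z))) \<in> borel_measurable (borel \<Otimes>\<^sub>M borel)"
          by measurable
        ultimately have "(\<lambda>x. a n (snd (x (Inl i), x (Inr i))) * (of_bool (fst (x (Inl i), x (Inr i)) \<le> snd (x (Inl i), x (Inr i)))
            - F (snd (x (Inl i), x (Inr i))))) \<in> borel_measurable ?P"
          by (rule measurable_compose)
        then show "(\<lambda>x. a n (x (Inr i)) * (of_bool (x (Inl i) \<le> x (Inr i)) - F (x (Inr i)))) \<in> borel_measurable ?P"
          by simp
      qed
      then show ?thesis by (simp add: Y_def[abs_def])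
    qed
    show "\<forall>\<^sub>F n in sequentially. \<forall>i<n. \<forall>\<omega>. \<bar>Y n i \<omega>\<bar> \<le> b n"
    proof (intro always_eventually allI impI)
      fix n i \<omega>
      have "\<bar>Y n i \<omega>\<bar> \<le> b n * 1" unfolding Y_def abs_mult
        using a_bd[of n "T i \<omega>"] eps by (intro mult_mono) auto
      then show "\<bar>Y n i \<omega>\<bar> \<le> b n" by simp
    qed
    show "b \<longlonglongrightarrow> 0" unfolding b_def h_def using c K(1) pos(1) by real_asymp
    show "expectation (Y n i) = 0" for n i
      unfolding Y_def[abs_def] by (rule weighted_noise_moments(1)[OF _ a_bd]) measurable
    show "expectation (\<lambda>\<omega>. (Y n i \<omega>)\<^sup>2) = s n" for n i
      unfolding Y_def s_def T_distr[symmetric, of 0]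
      by (subst weighted_noise_moments(2)[OF _ a_bd]) (auto simp: T_distr)
    define \<Psi> where "\<Psi> x = \<gamma> x * (F x * (1 - F x))" for x
    have \<Psi>_bd: "\<bar>\<Psi> x\<bar> \<le> 1 / \<kappa> * (1 * 1)" for x
      unfolding \<Psi>_def abs_mult using F_range[of x] \<gamma>_bounds[of x] pos by (intro mult_mono) auto
    have [measurable]: "\<Psi> \<in> borel_measurable borel" unfolding \<Psi>_def by measurable
    have "isCont F t" using F_deriv[of t] window by (intro DERIV_isCont) auto
    then have cont: "isCont \<Psi> t" unfolding \<Psi>_def using \<gamma>_continuous by (intro continuous_intros) auto
    have h_lim: "h \<longlonglongrightarrow> 0" unfolding h_def by real_asymp
    have "\<forall>\<^sub>F n in sequentially. h n < w" using order_tendstoD(2)[OF h_lim] window by auto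
    then have "\<forall>\<^sub>F n in sequentially. (1 / c) * (\<integral>u. (k u)\<^sup>2 * \<Psi> (t - h n * u) \<partial>lborel) = real n * s n"
      using eventually_gt_at_top[of 0]
    proof eventually_elim
      case (elim n)
      have h: "0 < h n" using c elim by (simp add: h_def)
      have "s n = (\<integral>\<tau>. \<phi> (h n) \<tau> * ((real n powr (- 3/5))\<^sup>2 * (\<phi> (h n) \<tau> * (F \<tau> * (1 - F \<tau>)))) \<partial>distr M borel (T 0))"
        unfolding s_def a_def by (intro Bochner_Integration.integral_cong) (auto simp: power2_eq_square algebra_simps)
      also have "\<dots> = (\<integral>v. k ((t - v) / h n) / h n * ((real n powr (- 3/5))\<^sup>2 * (\<phi> (h n) v * (F v * (1 - F v)))) \<partial>lborel)"
        using h elim by (intro integral_\<phi>) auto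
      also have "\<dots> = (\<integral>u. k u * ((real n powr (- 3/5))\<^sup>2 * (\<phi> (h n) (t - h n * u) * (F (t - h n * u) * (1 - F (t - h n * u))))) \<partial>lborel)"
        by (rule rescale_integral[OF h])
      also have "\<dots> = (\<integral>u. (real n powr (- 3/5))\<^sup>2 / h n * ((k u)\<^sup>2 * \<Psi> (t - h n * u)) \<partial>lborel)"
        using h by (intro Bochner_Integration.integral_cong) (auto simp: \<phi>_def \<Psi>_def power2_eq_square)
      also have "\<dots> = (real n powr (- 3/5))\<^sup>2 / h n * (\<integral>u. (k u)\<^sup>2 * \<Psi> (t - h n * u) \<partial>lborel)" by simp
      finally have "real n * s n = real n * ((real n powr (- 3/5))\<^sup>2 / h n) * (\<integral>u. (k u)\<^sup>2 * \<Psi> (t - h n * u) \<partial>lborel)" by simp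
      also have "real n * ((real n powr (- 3/5))\<^sup>2 / h n) = 1 / c"
      proof -
        have "real n * (real n powr (- 3/5))\<^sup>2 = real n powr 1 * (real n powr (- 3/5) * real n powr (- 3/5))"
          using elim by (simp add: power2_eq_square)
        also have "\<dots> = real n powr (1 + (- 3/5 + - 3/5))" by (simp only: powr_add)
        also have "1 + (- 3/5 + - 3/5) = (- 1/5 :: real)" by simp
        finally show ?thesis using elim c by (simp add: h_def)
      qed
      finally show ?case by simp
    qed
    moreover have "(\<lambda>n. (1 / c) * (\<integral>u. (k u)\<^sup>2 * \<Psi> (t - h n * u) \<partial>lborel)) \<longlonglongrightarrow> (1 / c) * ((\<integral>u. (k u)\<^sup>2 \<partial>lborel) * \<Psi> t)"
      using \<Psi>_bd by (intro tendsto_mult_left kernel_variance cont h_lim) auto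
    moreover have "(1 / c) * ((\<integral>u. (k u)\<^sup>2 \<partial>lborel) * \<Psi> t) = F t * (1 - F t) / (c * g t) * (\<integral>u. (k u)\<^sup>2 \<partial>lborel)"
      using window by (simp add: \<Psi>_def \<gamma>_eq)
    ultimately show "(\<lambda>n. real n * s n) \<longlonglongrightarrow> F t * (1 - F t) / (c * g t) * (\<integral>u. (k u)\<^sup>2 \<partial>lborel)"
      by (simp only:) (rule Lim_transform_eventually)
  qed
  moreover have "(\<Sum>i<n. Y n i \<omega>) = real n powr (2/5) * ((\<Sum>i<n. \<phi> (h n) (T i \<omega>) * \<epsilon> i \<omega>) / n)" for n \<omega>
  proof (cases "n = 0")
    case False
    then have "real n powr (2/5) / n = real n powr (2/5 - 1)" by (subst powr_diff) auto
    then have eq: "real n powr (- 3/5) = real n powr (2/5) / n" by simp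
    show ?thesis unfolding Y_def a_def eq by (simp add: sum_distrib_left sum_divide_distrib mult.assoc)
  qed simp
  ultimately show ?thesis by simp
qed

lemma F_interior: "0 < F t" "F t < 1"
proof -
  have tM: "0 < t" "0 < M\<^sub>0 - t" using window by auto
  show "0 < F t" using F_growth[of 0 t] F_range(1)[of 0] tM mult_pos_pos[OF pos(1) tM(1)] by simp
  show "F t < 1" using F_growth[of t M\<^sub>0] F_range(2)[of M\<^sub>0] tM mult_pos_pos[OF pos(1) tM(2)] by simp
qed

theorem smle_weak_conv:
  assumes c: "0 < c"
  defines "h \<equiv> \<lambda>n::nat. c * real n powr (- 1/5)"
  shows "weak_conv_m (\<lambda>n. distr M borel (\<lambda>\<omega>. real n powr (2/5) * (smle k (h n) n (\<lambda>i. T i \<omega>) (\<Delta> \<omega>) t - F t)))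
    (density lborel (normal_density (1/2 * c\<^sup>2 * second_moment k * f')
      (sqrt (F t * (1 - F t) / (c * g t) * (\<integral>u. (k u)\<^sup>2 \<partial>lborel)))))"
proof -
  define \<sigma>2 where "\<sigma>2 = F t * (1 - F t) / (c * g t) * (\<integral>u. (k u)\<^sup>2 \<partial>lborel)"
  define \<mu> where "\<mu> = 1/2 * c\<^sup>2 * second_moment k * f'"
  \<comment> \<open>The error terms require \<rho> to be of smaller order than n powr (-2/5), and \<delta> to lie between
  n powr (-2/5), up to a logarithm, and n powr (-3/10); the exponent of \<delta> is one choice in this
  range. Hoeffding's inequality permits any \<rho> of larger order than n powr (-1/2), up to a logarithm.
  The choice of L outweighs the (n + 1)^2 stretches in the union bound.\<close>
  define \<rho> where "\<rho> n = real n powr (- 9/20)" for n :: nat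
  define \<delta> where "\<delta> n = real n powr (- 5/16)" for n :: nat
  define L where "L n = 2 * ln (real n)" for n :: nat
  define D where "D n = \<kappa> * \<delta> n * (2 * \<beta> * \<delta> n + 2 * \<rho> n) + L n / (4 * (\<kappa> * \<delta> n) * real n)" for n
  define m where "m n = real n * (\<kappa> * h n - 2 * \<rho> n)" for n
  define e where "e n = 2 * \<beta> * h n + sqrt (L n / m n) + real n * D n / m n" for n
  obtain B where B: "0 < B" "\<And>h. 0 < h \<Longrightarrow> h \<le> 1 \<Longrightarrow> \<exists>up dn. (\<forall>x. \<phi> h x = up x - dn x) \<and> mono up \<and> mono dn \<and>
    (\<forall>x. 0 \<le> up x \<and> up x \<le> B / h \<and> 0 \<le> dn x \<and> dn x \<le> B / h)"
    using \<phi>_decomposition by blast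
  define r1 where "r1 n = real n powr (2/5) * (4 * (B / h n) * (2 * e n) * \<rho> n + 4 * (B / h n) * D n)" for n
  define bias where "bias n = smoothed (h n) F t - F t" for n
  have \<sigma>2: "0 < \<sigma>2"
  proof -
    have "0 < g t" using g_lower[of t] window pos by simp
    then show ?thesis using F_interior c integral_k_squared_pos by (simp add: \<sigma>2_def)
  qed
  have h_lim: "h \<longlonglongrightarrow> 0" unfolding h_def by real_asymp
  have r1_lim: "r1 \<longlonglongrightarrow> 0"
    unfolding r1_def D_def m_def e_def h_def \<rho>_def \<delta>_def L_def using c pos B(1) by real_asymp
  have m_pos: "\<forall>\<^sub>F n in sequentially. 0 < m n"
    unfolding m_def h_def \<rho>_def using c pos by real_asymp
  have bias_lim: "(\<lambda>n. real n powr (2/5) * bias n) \<longlonglongrightarrow> \<mu>"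
  proof -
    have "\<forall>\<^sub>F n in sequentially. 0 < h n"
      using eventually_gt_at_top[of 0] by eventually_elim (use c in \<open>simp add: h_def\<close>)
    then have "(\<lambda>n. bias n / (h n)\<^sup>2) \<longlonglongrightarrow> f' / 2 * second_moment k"
      unfolding bias_def using F_range by (intro kernel_bias[OF F_deriv window(1) f_deriv] h_lim) auto
    then have "(\<lambda>n. c\<^sup>2 * (bias n / (h n)\<^sup>2)) \<longlonglongrightarrow> c\<^sup>2 * (f' / 2 * second_moment k)"
      by (rule tendsto_mult_left)
    moreover have "\<forall>\<^sub>F n in sequentially. c\<^sup>2 * (bias n / (h n)\<^sup>2) = real n powr (2/5) * bias n"
      using eventually_gt_at_top[of 0]
    proof eventually_elim
      case (elim n)
      have "(real n powr (- 1/5))\<^sup>2 * real n powr (2/5) = 1"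
        using elim by (simp add: power2_eq_square flip: powr_add)
      then have eq: "c\<^sup>2 = (h n)\<^sup>2 * real n powr (2/5)" by (simp add: h_def power_mult_distrib)
      have "h n \<noteq> 0" using c elim by (simp add: h_def)
      then show ?case unfolding eq by simp
    qed
    ultimately have "(\<lambda>n. real n powr (2/5) * bias n) \<longlonglongrightarrow> c\<^sup>2 * (f' / 2 * second_moment k)"
      by (rule Lim_transform_eventually)
    also have "c\<^sup>2 * (f' / 2 * second_moment k) = \<mu>" by (simp add: \<mu>_def)
    finally show ?thesis .
  qed
  have "\<exists>A. A \<in> sets M \<and> (2 \<le> n \<longrightarrow> space M - A \<subseteq> good_event n (\<rho> n) (L n) \<and>
      prob A \<le> 6 / \<rho> n * exp (- real n * (\<rho> n)\<^sup>2 / 2) + 2 * (real n + 1)\<^sup>2 * exp (- 2 * L n))" for n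
  proof (cases "2 \<le> n")
    case True
    have "real n powr (- 9/20) \<le> real n powr 0" using True by (intro powr_mono) auto
    with True have "0 < n" "0 < \<rho> n" "\<rho> n \<le> 1" "0 < L n" by (auto simp: \<rho>_def L_def)
    from good_event_likely[OF this] show ?thesis by metis
  qed auto
  then obtain A where A: "\<And>n. A n \<in> sets M" "\<And>n. 2 \<le> n \<Longrightarrow> space M - A n \<subseteq> good_event n (\<rho> n) (L n)"
    "\<And>n. 2 \<le> n \<Longrightarrow> prob (A n) \<le> 6 / \<rho> n * exp (- real n * (\<rho> n)\<^sup>2 / 2) + 2 * (real n + 1)\<^sup>2 * exp (- 2 * L n)"
    by metis
  have A_lim: "(\<lambda>n. prob (A n)) \<longlonglongrightarrow> 0"
  proof (rule tendsto_sandwich[OF _ _ tendsto_const])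
    show "(\<lambda>n. 6 / \<rho> n * exp (- real n * (\<rho> n)\<^sup>2 / 2) + 2 * (real n + 1)\<^sup>2 * exp (- 2 * L n)) \<longlonglongrightarrow> 0"
      unfolding \<rho>_def L_def by real_asymp
    show "\<forall>\<^sub>F n in sequentially. prob (A n) \<le> 6 / \<rho> n * exp (- real n * (\<rho> n)\<^sup>2 / 2) + 2 * (real n + 1)\<^sup>2 * exp (- 2 * L n)"
      using eventually_ge_at_top[of 2] by eventually_elim (rule A(3))
  qed auto
  let ?Z = "\<lambda>n \<omega>. real n powr (2/5) * (smle k (h n) n (\<lambda>i. T i \<omega>) (\<Delta> \<omega>) t - F t)"
  let ?S = "\<lambda>n \<omega>. real n powr (2/5) * ((\<Sum>i<n. \<phi> (h n) (T i \<omega>) * \<epsilon> i \<omega>) / n)"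
  have "weak_conv_m (\<lambda>n. distr M borel (?Z n)) (density lborel (normal_density \<mu> (sqrt \<sigma>2)))"
  proof (rule slutsky_weak_conv[where S = ?S and A = A and \<mu> = \<mu> and r = "\<lambda>n. r1 n + \<bar>real n powr (2/5) * bias n - \<mu>\<bar>"])
    show "?Z n \<in> borel_measurable M" for n
    proof -
      have [measurable]: "(\<lambda>\<omega>. smle k (h n) n (\<lambda>i. T i \<omega>) (\<Delta> \<omega>) t) \<in> borel_measurable M"
        using c by (intro smle_measurable) (auto simp: h_def)
      show ?thesis by measurable
    qed
    show "?S n \<in> borel_measurable M" for n by measurable
    have "prob_space (density lborel (normal_density \<mu> (sqrt \<sigma>2)))"
      using \<sigma>2 by (intro prob_space_normal_density) simp
    then show "real_distribution (density lborel (normal_density \<mu> (sqrt \<sigma>2)))"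
      by (auto simp: real_distribution_def real_distribution_axioms_def)
    show "(\<lambda>n. char (distr M borel (?S n)) \<theta>) \<longlonglongrightarrow> complex_of_real (exp (- (\<theta>\<^sup>2 * \<sigma>2 / 2)))" for \<theta>
      using linear_term_char[OF c, of \<theta>] by (simp only: h_def \<sigma>2_def)
    show "char (density lborel (normal_density \<mu> (sqrt \<sigma>2))) \<theta> = iexp (\<theta> * \<mu>) * complex_of_real (exp (- (\<theta>\<^sup>2 * \<sigma>2 / 2)))" for \<theta>
      using char_normal[of "sqrt \<sigma>2" \<mu> \<theta>] \<sigma>2 by simp
    show "A n \<in> sets M" for n by (rule A(1))
    show "(\<lambda>n. prob (A n)) \<longlonglongrightarrow> 0" by (rule A_lim)
    have "(\<lambda>n. r1 n + \<bar>real n powr (2/5) * bias n - \<mu>\<bar>) \<longlonglongrightarrow> 0 + \<bar>\<mu> - \<mu>\<bar>"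
      by (intro tendsto_intros r1_lim bias_lim)
    then show "(\<lambda>n. r1 n + \<bar>real n powr (2/5) * bias n - \<mu>\<bar>) \<longlonglongrightarrow> 0" by simp
    have small: "\<forall>\<^sub>F n in sequentially. h n < 1" "\<forall>\<^sub>F n in sequentially. 2 * h n < w" "\<forall>\<^sub>F n in sequentially. \<delta> n + h n < w"
    proof -
      have "(\<lambda>n. 2 * h n) \<longlonglongrightarrow> 0" "(\<lambda>n. \<delta> n + h n) \<longlonglongrightarrow> 0" unfolding h_def \<delta>_def by real_asymp+
      from order_tendstoD(2)[OF h_lim, of 1] order_tendstoD(2)[OF this(1) window(1)] order_tendstoD(2)[OF this(2) window(1)]
      show "\<forall>\<^sub>F n in sequentially. h n < 1" "\<forall>\<^sub>F n in sequentially. 2 * h n < w" "\<forall>\<^sub>F n in sequentially. \<delta> n + h n < w"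
        by simp_all
    qed
    show "\<forall>\<^sub>F n in sequentially. \<forall>\<omega>\<in>space M - A n. \<bar>?Z n \<omega> - ?S n \<omega> - \<mu>\<bar> \<le> r1 n + \<bar>real n powr (2/5) * bias n - \<mu>\<bar>"
      using small m_pos eventually_ge_at_top[of 2]
    proof eventually_elim
      case (elim n)
      have h: "0 < h n" "h n \<le> 1" using elim c by (auto simp: h_def)
      obtain up dn where ud: "\<forall>x. \<phi> (h n) x = up x - dn x" "mono up" "mono dn"
        "\<forall>x. 0 \<le> up x \<and> up x \<le> B / h n \<and> 0 \<le> dn x \<and> dn x \<le> B / h n" using B(2)[OF h] by blast
      show ?case
      proof
        fix \<omega> assume "\<omega> \<in> space M - A n"
        then have \<omega>: "\<omega> \<in> good_event n (\<rho> n) (L n)" using A(2) elim by auto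
        define a where "a = smle k (h n) n (\<lambda>i. T i \<omega>) (\<Delta> \<omega>) t"
        define b where "b = smoothed (h n) F t"
        define d where "d = (\<Sum>i<n. \<phi> (h n) (T i \<omega>) * \<epsilon> i \<omega>) / n"
        define R where "R = 4 * (B / h n) * (2 * e n) * \<rho> n + 4 * (B / h n) * D n"
        have lin: "\<bar>a - b - d\<bar> \<le> R"
          unfolding a_def b_def d_def R_def
        proof (rule smle_linearization[OF \<omega> _ _ _ h(1) _ _ _ _ ud(2,3) _ _ _ _ D_def m_def _ e_def])
          show "0 < L n" using elim by (simp add: L_def)
          show "0 < \<rho> n" "0 < \<delta> n" using elim by (simp_all add: \<rho>_def \<delta>_def)
        qed (use elim ud in auto)
        have "real n powr (2/5) * (a - F t) - real n powr (2/5) * d - \<mu>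
            = real n powr (2/5) * (a - b - d) + (real n powr (2/5) * (b - F t) - \<mu>)"
          by (simp add: algebra_simps)
        also have "\<bar>\<dots>\<bar> \<le> \<bar>real n powr (2/5) * (a - b - d)\<bar> + \<bar>real n powr (2/5) * (b - F t) - \<mu>\<bar>"
          by (rule abs_triangle_ineq)
        also have "\<bar>real n powr (2/5) * (a - b - d)\<bar> \<le> real n powr (2/5) * R"
          using lin by (simp add: abs_mult mult_left_mono)
        finally show "\<bar>?Z n \<omega> - ?S n \<omega> - \<mu>\<bar> \<le> r1 n + \<bar>real n powr (2/5) * bias n - \<mu>\<bar>"
          unfolding a_def b_def d_def R_def r1_def bias_def by simp
      qed
    qed
  qed
  then show ?thesis by (simp only: \<mu>_def \<sigma>2_def)
qed

end

section \<open>Distributions with a density\<close>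

lemma cdf_density_diff:
  assumes P: "real_distribution P" and dens: "P = density lborel (\<lambda>x. ennreal (p x))" "p \<in> borel_measurable borel"
    and xy: "x \<le> y"
  shows "\<And>c. (\<And>z. x < z \<Longrightarrow> z \<le> y \<Longrightarrow> c \<le> p z) \<Longrightarrow> 0 \<le> c \<Longrightarrow> c * (y - x) \<le> cdf P y - cdf P x"
    and "\<And>c. (\<And>z. x < z \<Longrightarrow> z \<le> y \<Longrightarrow> p z \<le> c) \<Longrightarrow> 0 \<le> c \<Longrightarrow> cdf P y - cdf P x \<le> c * (y - x)"
proof -
  interpret real_distribution P by fact
  note [measurable] = dens(2)
  have diff: "ennreal (cdf P y - cdf P x) = (\<integral>\<^sup>+z. ennreal (p z) * indicator {x<..y} z \<partial>lborel)"
  proof -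
    have "cdf P y - cdf P x = measure P {x<..y}"
      using xy cdf_diff_eq[of x y] by (cases "x = y") auto
    then have "ennreal (cdf P y - cdf P x) = emeasure P {x<..y}" by (simp add: emeasure_eq_measure)
    also have "\<dots> = (\<integral>\<^sup>+z. ennreal (p z) * indicator {x<..y} z \<partial>lborel)"
      unfolding dens(1) by (subst emeasure_density) auto
    finally show ?thesis .
  qed
  have const: "(\<integral>\<^sup>+z. ennreal c * indicator {x<..y} z \<partial>lborel) = ennreal (c * (y - x))" if "0 \<le> c" for c
    using xy that by (subst nn_integral_cmult_indicator) (auto simp: ennreal_mult)
  have mono: "0 \<le> cdf P y - cdf P x" using xy cdf_nondecreasing[of x y] by simp
  show "c * (y - x) \<le> cdf P y - cdf P x" if "\<And>z. x < z \<Longrightarrow> z \<le> y \<Longrightarrow> c \<le> p z" "0 \<le> c" for c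
  proof -
    have "ennreal (c * (y - x)) \<le> ennreal (cdf P y - cdf P x)"
      unfolding diff const[OF that(2), symmetric]
      using that(1) by (intro nn_integral_mono) (auto simp: indicator_def intro!: ennreal_leI)
    then show ?thesis using mono by simp
  qed
  show "cdf P y - cdf P x \<le> c * (y - x)" if "\<And>z. x < z \<Longrightarrow> z \<le> y \<Longrightarrow> p z \<le> c" "0 \<le> c" for c
  proof -
    have "ennreal (cdf P y - cdf P x) \<le> ennreal (c * (y - x))"
      unfolding diff const[OF that(2), symmetric]
      using that(1) by (intro nn_integral_mono) (auto simp: indicator_def intro!: ennreal_leI)
    then show ?thesis using that(2) xy by simp
  qed
qed

text \<open>
  Near a continuity point the density lies between constants close to its value there, so the
  difference quotients of the distribution function do so as well.
\<close>

lemma cdf_density_has_derivative: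
  assumes P: "real_distribution P" and dens: "P = density lborel (\<lambda>x. ennreal (p x))" "p \<in> borel_measurable borel" "\<And>x. 0 \<le> p x"
    and cont: "isCont p x"
  shows "(cdf P has_real_derivative p x) (at x)"
  unfolding has_field_derivative_iff
proof (rule tendstoI)
  fix e :: real assume e: "0 < e"
  have "\<forall>\<^sub>F y in nhds x. dist (p y) (p x) < e / 2"
    using cont e unfolding isCont_def by (intro tendstoD) (auto simp: tendsto_at_iff_tendsto_nhds)
  then obtain d where d: "0 < d" "\<And>y. dist y x < d \<Longrightarrow> dist (p y) (p x) < e / 2"
    by (auto simp: eventually_nhds_metric)
  have bounds: "max 0 (p x - e / 2) * (v - u) \<le> cdf P v - cdf P u" "cdf P v - cdf P u \<le> (p x + e / 2) * (v - u)"
    if "u \<le> v" "x - d < u" "v < x + d" for u v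
  proof -
    have z: "max 0 (p x - e / 2) \<le> p z" "p z \<le> p x + e / 2" if "u < z" "z \<le> v" for z
    proof -
      have "dist z x < d" using that \<open>x - d < u\<close> \<open>v < x + d\<close> by (auto simp: dist_real_def)
      from d(2)[OF this] have "\<bar>p z - p x\<bar> < e / 2" by (simp add: dist_real_def)
      then show "max 0 (p x - e / 2) \<le> p z" "p z \<le> p x + e / 2"
        using dens(3)[of z] by linarith+
    qed
    show "max 0 (p x - e / 2) * (v - u) \<le> cdf P v - cdf P u"
      by (rule cdf_density_diff(1)[OF P dens(1,2) that(1)]) (use z in auto)
    show "cdf P v - cdf P u \<le> (p x + e / 2) * (v - u)"
      by (rule cdf_density_diff(2)[OF P dens(1,2) that(1)]) (use z e dens(3)[of x] in auto)
  qed
  have quotient: "\<bar>(cdf P v - cdf P u) / (v - u) - p x\<bar> \<le> e / 2" if "u < v" "x - d < u" "v < x + d" for u v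
  proof -
    have "(p x - e / 2) * (v - u) \<le> max 0 (p x - e / 2) * (v - u)" using that by (intro mult_right_mono) auto
    then have "(p x - e / 2) * (v - u) \<le> cdf P v - cdf P u" using bounds(1)[of u v] that by linarith
    then have "p x - e / 2 \<le> (cdf P v - cdf P u) / (v - u)" using that by (simp add: pos_le_divide_eq)
    moreover have "(cdf P v - cdf P u) / (v - u) \<le> p x + e / 2"
      using bounds(2)[of u v] that by (simp add: pos_divide_le_eq)
    ultimately show ?thesis by linarith
  qed
  have "dist ((cdf P y - cdf P x) / (y - x)) (p x) < e" if y: "y \<noteq> x" "dist y x < d" for y
  proof (cases "x < y")
    case True
    then show ?thesis using quotient[of x y] y d(1) e by (auto simp: dist_real_def)
  next
    case False
    then have "y < x" using y by simp
    then have "\<bar>(cdf P x - cdf P y) / (x - y) - p x\<bar> \<le> e / 2" using quotient[of y x] y d(1) by (auto simp: dist_real_def)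
    moreover have "(cdf P x - cdf P y) / (x - y) = (cdf P y - cdf P x) / (y - x)"
      by (metis minus_diff_eq minus_divide_divide)
    ultimately show ?thesis using e by (simp add: dist_real_def)
  qed
  then show "\<forall>\<^sub>F y in at x. dist ((cdf P y - cdf P x) / (y - x)) (p x) < e"
    using d(1) by (auto simp: eventually_at)
qed

text \<open>
  Around a point outside the support the distribution function is constant, while its derivative is
  the density.
\<close>

lemma density_zero_off_support:
  assumes P: "real_distribution P" and dens: "P = density lborel (\<lambda>x. ennreal (p x))" "p \<in> borel_measurable borel" "\<And>x. 0 \<le> p x"
    and cont: "isCont p x" and x: "x \<notin> dist_support P"
  shows "p x = 0"
proof (rule ccontr)
  interpret real_distribution P by fact
  assume "p x \<noteq> 0"
  then have px: "0 < p x" using dens(3)[of x] by simp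
  obtain U where U: "open U" "x \<in> U" "emeasure P U = 0" using x by (auto simp: dist_support_def not_gr_zero)
  then obtain r where r: "0 < r" "ball x r \<subseteq> U" by (meson openE)
  have F: "cdf P y = cdf P x" if y: "\<bar>y - x\<bar> < r" for y
  proof -
    have null: "measure P {u<..v} = 0" if "{u<..v} \<subseteq> ball x r" for u v
    proof -
      have "measure P {u<..v} \<le> measure P U"
        using that r(2) U(1) by (intro finite_measure_mono) auto
      also have "measure P U = 0" using U(3) by (simp add: measure_def)
      finally show ?thesis using measure_nonneg[of P "{u<..v}"] by linarith
    qed
    consider "x < y" | "y < x" | "x = y" by linarith
    then show ?thesis
    proof cases
      case 1
      have "{x<..y} \<subseteq> ball x r" using y by (auto simp: dist_real_def)
      then show ?thesis using cdf_diff_eq[OF 1] null by simp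
    next
      case 2
      have "{y<..x} \<subseteq> ball x r" using y by (auto simp: dist_real_def)
      then show ?thesis using cdf_diff_eq[OF 2] null by simp
    qed simp
  qed
  have "(cdf P has_real_derivative 0) (at x)"
  proof (rule has_field_derivative_transform_within_open[where S = "ball x r" and f = "\<lambda>_. cdf P x"])
    show "cdf P x = cdf P y" if "y \<in> ball x r" for y using F[of y] that by (simp add: dist_real_def abs_minus_commute)
  qed (use r in auto)
  with cdf_density_has_derivative[OF P dens cont] have "p x = 0" by (rule DERIV_unique)
  with px show False by simp
qed

lemma isCont_cdf_density:
  assumes P: "real_distribution P" and dens: "P = density lborel (\<lambda>x. ennreal (p x))" "p \<in> borel_measurable borel"
  shows "isCont (cdf P) x"
proof -
  interpret real_distribution P by fact
  note [measurable] = dens(2)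
  have "emeasure P {x} = (\<integral>\<^sup>+z. ennreal (p z) * indicator {x} z \<partial>lborel)"
    unfolding dens(1) by (subst emeasure_density) auto
  also have "\<dots> = 0" by (rule nn_integral_null_set) auto
  finally show ?thesis by (simp add: isCont_cdf measure_def)
qed

section \<open>The optimal bandwidth constant\<close>

text \<open>
  With \<open>B = 4 A c0 ^ 5\<close>, the excess over the value at \<open>c0\<close> has the factor \<open>(c - c0)\<^sup>2\<close> and otherwise positive
  factors.
\<close>

lemma quartic_plus_inverse_minimum:
  fixes A B c0 :: real
  assumes A: "0 < A" and c0: "0 < c0" "B = 4 * A * c0 ^ 5" and f: "\<And>c. 0 < c \<Longrightarrow> f c = A * c ^ 4 + B / c"
  shows "is_arg_min f (\<lambda>c. 0 < c) c \<longleftrightarrow> c = c0"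
proof -
  have diff: "f c - f c0 = A / c * ((c - c0)\<^sup>2 * (c ^ 3 + 2 * c\<^sup>2 * c0 + 3 * c * c0\<^sup>2 + 4 * c0 ^ 3))" if c: "0 < c" for c
  proof -
    have "f c - f c0 = A / c * (c ^ 5 - 5 * c0 ^ 4 * c + 4 * c0 ^ 5)"
    proof -
      have 1: "4 * A * c0 ^ 5 / c0 = 4 * A * c0 ^ 4"
        using power_Suc[of c0 4] c0(1) by simp
      have 2: "A * c ^ 4 = A / c * c ^ 5"
        using power_Suc[of c 4] c by simp
      have 3: "A * c0 ^ 4 = A / c * (c * c0 ^ 4)"
        using c by simp
      show ?thesis
        unfolding f[OF c] f[OF c0(1)] c0(2) 1 2 using 3
        by (simp only: right_diff_distrib distrib_left) (use c in simp)
    qed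
    also have "c ^ 5 - 5 * c0 ^ 4 * c + 4 * c0 ^ 5 = (c - c0)\<^sup>2 * (c ^ 3 + 2 * c\<^sup>2 * c0 + 3 * c * c0\<^sup>2 + 4 * c0 ^ 3)"
      by algebra
    finally show ?thesis .
  qed
  have pos: "f c0 < f c" if c: "0 < c" "c \<noteq> c0" for c
  proof -
    have "0 < A / c * ((c - c0)\<^sup>2 * (c ^ 3 + 2 * c\<^sup>2 * c0 + 3 * c * c0\<^sup>2 + 4 * c0 ^ 3))"
      using c A c0 by (intro mult_pos_pos divide_pos_pos add_pos_pos) auto
    then show ?thesis using diff[OF c(1)] by simp
  qed
  show ?thesis
  proof
    assume m: "is_arg_min f (\<lambda>c. 0 < c) c"
    then have "0 < c" "\<not> f c0 < f c" using c0(1) by (auto simp: is_arg_min_def)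
    then show "c = c0" using pos by blast
  next
    assume "c = c0"
    moreover have "\<not> f y < f c0" if "0 < y" for y
      using pos[OF that] by (cases "y = c0") auto
    ultimately show "is_arg_min f (\<lambda>c. 0 < c) c" using c0(1) by (auto simp: is_arg_min_def)
  qed
qed

lemma bandwidth_constant_optimal:
  fixes V m2 d :: real and K :: "real \<Rightarrow> real"
  assumes "0 < V" "0 < m2" "d \<noteq> 0"
    and K: "\<And>c. 0 < c \<Longrightarrow> K c = (1/2 * c\<^sup>2 * m2 * d)\<^sup>2 + V / c"
  shows "is_arg_min K (\<lambda>c. 0 < c) c \<longleftrightarrow> c = V powr (1/5) * (m2\<^sup>2 * d\<^sup>2) powr (- 1/5)"
proof -
  define a where "a = m2\<^sup>2 * d\<^sup>2"
  define c0 where "c0 = V powr (1/5) * a powr (- 1/5)"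
  have a: "0 < a" using assms by (simp add: a_def)
  have "c0 ^ 5 = (V powr (1/5)) ^ 5 * (a powr (- 1/5)) ^ 5" by (simp add: c0_def power_mult_distrib)
  also have "(V powr (1/5)) ^ 5 = V" using assms by (simp add: powr_power)
  also have "(a powr (- 1/5)) ^ 5 = a powr (- 1)" using a by (simp add: powr_power)
  also have "a powr (- 1) = 1 / a" using a by (simp add: powr_minus_divide)
  finally have V: "V = 4 * (a / 4) * c0 ^ 5" using a by simp
  show ?thesis
    unfolding a_def[symmetric] c0_def[symmetric]
  proof (rule quartic_plus_inverse_minimum[OF _ _ V])
    show "0 < a / 4" "0 < c0" using a assms by (auto simp: c0_def)
    show "K c = a / 4 * c ^ 4 + V / c" if "0 < c" for c
      unfolding K[OF that] by (simp add: a_def power2_eq_square power4_eq_xxxx)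
  qed
qed

section \<open>The limit theorem\<close>

theorem theorem4p2:
  fixes M :: "'a measure"
    and X T :: "nat \<Rightarrow> 'a \<Rightarrow> real"
    and F\<^sub>0 f\<^sub>0 G g k :: "real \<Rightarrow> real"
    and M\<^sub>0 t :: real
  assumes "prob_space M"
    and indep: "prob_space.indep_vars M (\<lambda>_. borel) (case_sum X T) UNIV"
    and F0_cdf: "\<And>i. cdf (distr M borel (X i)) = F\<^sub>0"
    and f0_density: "\<And>i. distributed M lborel (X i) (\<lambda>x. ennreal (f\<^sub>0 x))" "\<And>x. 0 \<le> f\<^sub>0 x"
    and G_cdf: "\<And>i. cdf (distr M borel (T i)) = G"
    and g_density: "\<And>i. distributed M lborel (T i) (\<lambda>x. ennreal (g x))" "\<And>x. 0 \<le> g x"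
    and kernel: "smooth_kernel k"
    and F0_support: "\<And>i. dist_support (distr M borel (X i)) = {0..M\<^sub>0}"
    and F0_strict: "strict_mono_on {0..M\<^sub>0} F\<^sub>0"
    and f0_away: "\<exists>\<epsilon>>0. \<forall>x\<in>{0..M\<^sub>0}. \<epsilon> \<le> f\<^sub>0 x"
    and G_support: "\<And>i. dist_support (distr M borel (T i)) = {0..}"
    and G_strict: "strict_mono_on {0..M\<^sub>0} G"
    and g_away: "\<exists>\<epsilon>>0. \<forall>x\<in>{0..M\<^sub>0}. \<epsilon> \<le> g x"
    and g_deriv: "\<exists>g' B. \<forall>x\<in>{0..M\<^sub>0}.
        (g has_real_derivative g' x) (at x within {0..}) \<and> \<bar>g' x\<bar> \<le> B"
    and t_pos: "0 < t"
    and f0_diff: "\<forall>\<^sub>F x in nhds t. f\<^sub>0 differentiable (at x)"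
    and f0'_cont: "isCont (deriv f\<^sub>0) t"
    and f0'_nz: "deriv f\<^sub>0 t \<noteq> 0"
  shows "(\<forall>c>0. weak_conv_m
            (\<lambda>n. distr M borel (\<lambda>\<omega>. real n powr (2/5) *
               (smle k (c * real n powr (- 1/5)) n
                  (\<lambda>i. T i \<omega>) (\<lambda>i. of_bool (X i \<omega> \<le> T i \<omega>)) t - F\<^sub>0 t)))
            (density lborel (normal_density (mu_SM k f\<^sub>0 t c) (sqrt (sigma2_SM k F\<^sub>0 g t c)))))
       \<and> (\<forall>c. is_arg_min (amse_SM k F\<^sub>0 f\<^sub>0 g t) (\<lambda>c. 0 < c) c \<longleftrightarrow> c = c_SM k F\<^sub>0 f\<^sub>0 g t)"
proof -
  interpret prob_space M by fact
  have X_meas: "X i \<in> borel_measurable M" and T_meas: "T i \<in> borel_measurable M" for i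
    using distributed_measurable[OF f0_density(1)[of i]] distributed_measurable[OF g_density(1)[of i]] by simp_all
  have f0_meas: "f\<^sub>0 \<in> borel_measurable borel" and g_meas: "g \<in> borel_measurable borel"
    using distributed_real_measurable[OF _ f0_density(1)[of 0]] distributed_real_measurable[OF _ g_density(1)[of 0]]
      f0_density(2) g_density(2) by auto
  have X_distr: "distr M borel (X i) = density lborel (\<lambda>x. ennreal (f\<^sub>0 x))"
    and T_distr: "distr M borel (T i) = density lborel (\<lambda>x. ennreal (g x))" for i
    using distributed_distr_eq_density[OF f0_density(1)[of i]] distributed_distr_eq_density[OF g_density(1)[of i]]
    by (simp_all cong: distr_cong)
  have X_real: "real_distribution (distr M borel (X 0))" and T_real: "real_distribution (distr M borel (T 0))"
    using X_meas T_meas by (auto intro: real_distribution_distr)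
  note F_diff = cdf_density_diff[OF X_real X_distr f0_meas, unfolded F0_cdf]
  note G_diff = cdf_density_diff[OF T_real T_distr g_meas, unfolded G_cdf]
  interpret current_status_sample M X T F\<^sub>0 G
    using indep F0_cdf G_cdf isCont_cdf_density[OF T_real T_distr g_meas] by unfold_locales (auto simp: G_cdf)
  interpret kernel k using kernel by unfold_locales
  obtain r where r: "0 < r" "\<And>x. dist x t < r \<Longrightarrow> f\<^sub>0 differentiable (at x)"
    using f0_diff by (auto simp: eventually_nhds_metric)
  have f0_cont: "isCont f\<^sub>0 x" if "dist x t < r" for x
    using r(2)[OF that] by (rule differentiable_imp_continuous_within)
  obtain \<epsilon>f where \<epsilon>f: "0 < \<epsilon>f" "\<And>x. x \<in> {0..M\<^sub>0} \<Longrightarrow> \<epsilon>f \<le> f\<^sub>0 x" using f0_away by blast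
  obtain \<epsilon>g where \<epsilon>g: "0 < \<epsilon>g" "\<And>x. x \<in> {0..M\<^sub>0} \<Longrightarrow> \<epsilon>g \<le> g x" using g_away by blast
  have f0_zero: "f\<^sub>0 x = 0" if "M\<^sub>0 < x" "dist x t < r" for x
    using density_zero_off_support[OF X_real X_distr f0_meas f0_density(2) f0_cont[OF that(2)]] F0_support that(1) by auto
  \<comment> \<open>The density vanishes to the right of \<open>M\<^sub>0\<close> wherever it is continuous. If \<open>t\<close> were there, so would its
    derivative at \<open>t\<close>; if \<open>t\<close> were \<open>M\<^sub>0\<close>, continuity would contradict the lower bound for the density.\<close>
  have t_less: "t < M\<^sub>0"
  proof (rule ccontr)
    assume not_less: "\<not> t < M\<^sub>0"
    show False
    proof (cases "t = M\<^sub>0")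
      case True
      have "f\<^sub>0 t = 0"
      proof (rule tendsto_unique[of "at_right t"])
        show "(f\<^sub>0 \<longlongrightarrow> f\<^sub>0 t) (at_right t)"
          using f0_cont[of t] r(1) unfolding isCont_def by (auto intro: filterlim_at_within_not_equal tendsto_within_subset[of _ _ _ UNIV])
        have "\<forall>\<^sub>F x in at_right t. f\<^sub>0 x = 0"
          using r(1) True by (auto simp: eventually_at dist_real_def intro!: exI[of _ r] f0_zero)
        then show "(f\<^sub>0 \<longlongrightarrow> 0) (at_right t)" by (rule tendsto_eventually)
      qed simp
      moreover have "\<epsilon>f \<le> f\<^sub>0 t" using True t_pos by (intro \<epsilon>f(2)) auto
      ultimately show False using \<epsilon>f(1) by simp
    next
      case False
      have "(f\<^sub>0 has_real_derivative 0) (at t)"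
      proof (rule has_field_derivative_transform_within_open[where S = "ball t (min r (t - M\<^sub>0))" and f = "\<lambda>_. 0"])
        show "0 = f\<^sub>0 x" if "x \<in> ball t (min r (t - M\<^sub>0))" for x
          using that by (intro f0_zero[symmetric]) (auto simp: dist_real_def)
      qed (use False not_less r(1) in auto)
      then have "deriv f\<^sub>0 t = 0" by (rule DERIV_imp_deriv)
      with f0'_nz show False by simp
    qed
  qed
  have "\<forall>\<^sub>F x in nhds t. f\<^sub>0 x < f\<^sub>0 t + 1"
    using f0_cont[of t] r(1) by (intro order_tendstoD(2)[of f\<^sub>0 "f\<^sub>0 t"]) (auto simp: isCont_def tendsto_at_iff_tendsto_nhds)
  then obtain r' where r': "0 < r'" "\<And>x. dist x t < r' \<Longrightarrow> f\<^sub>0 x < f\<^sub>0 t + 1" by (auto simp: eventually_nhds_metric)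
  obtain g' B where g': "\<And>x. x \<in> {0..M\<^sub>0} \<Longrightarrow> (g has_real_derivative g' x) (at x within {0..}) \<and> \<bar>g' x\<bar> \<le> B"
    using g_deriv by blast
  have g_lip: "\<bar>g x - g y\<bar> \<le> \<bar>B\<bar> * \<bar>x - y\<bar>" if "x \<in> {0..M\<^sub>0}" "y \<in> {0..M\<^sub>0}" for x y
  proof -
    have "norm (g x - g y) \<le> \<bar>B\<bar> * norm (x - y)"
    proof (rule field_differentiable_bound[where S = "{0..M\<^sub>0}" and f' = g'])
      fix z assume "z \<in> {0..M\<^sub>0}"
      from g'[OF this] show "(g has_real_derivative g' z) (at z within {0..M\<^sub>0})" "norm (g' z) \<le> \<bar>B\<bar>"
        by (auto intro: has_field_derivative_subset)
    qed (use that in auto)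
    then show ?thesis by simp
  qed
  have g_upper: "g x \<le> g 0 + \<bar>B\<bar> * M\<^sub>0" if "x \<in> {0..M\<^sub>0}" for x
  proof -
    have "g x \<le> g 0 + \<bar>B\<bar> * \<bar>x - 0\<bar>" using g_lip[OF that, of 0] that by auto
    also have "\<dots> \<le> g 0 + \<bar>B\<bar> * M\<^sub>0" using that by (intro add_left_mono mult_left_mono) auto
    finally show ?thesis .
  qed
  define w where "w = Min {r / 2, r' / 2, t, M\<^sub>0 - t}"
  have w: "0 < w" "w < r" "w < r'" "w \<le> t" "t + w \<le> M\<^sub>0"
    using r(1) r'(1) t_pos t_less by (auto simp: w_def min_def)
  define \<kappa> where "\<kappa> = min \<epsilon>f \<epsilon>g"
  define \<beta> where "\<beta> = f\<^sub>0 t + 1 + g 0 + \<bar>B\<bar> * M\<^sub>0 + \<bar>B\<bar>"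
  have nonneg: "0 \<le> f\<^sub>0 t" "0 \<le> g 0" "0 \<le> \<bar>B\<bar> * M\<^sub>0" using f0_density(2) g_density(2) t_pos t_less by auto
  have f0_deriv: "(f\<^sub>0 has_real_derivative deriv f\<^sub>0 t) (at t)"
    using r by (simp add: DERIV_deriv_iff_real_differentiable)
  interpret smle_setting M X T F\<^sub>0 G k f\<^sub>0 g M\<^sub>0 t w \<kappa> \<beta> "deriv f\<^sub>0 t"
  proof unfold_locales
    show "0 < \<kappa>" "0 < \<beta>" using \<epsilon>f(1) \<epsilon>g(1) nonneg by (auto simp: \<kappa>_def \<beta>_def)
    show "\<kappa> * (y - x) \<le> F\<^sub>0 y - F\<^sub>0 x" if "0 \<le> x" "x \<le> y" "y \<le> M\<^sub>0" for x y
    proof (rule F_diff(1)[OF that(2)])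
      show "\<kappa> \<le> f\<^sub>0 z" if "x < z" "z \<le> y" for z
        using \<epsilon>f(2)[of z] that \<open>0 \<le> x\<close> \<open>y \<le> M\<^sub>0\<close> by (auto simp: \<kappa>_def)
    qed (use \<epsilon>f(1) \<epsilon>g(1) in \<open>auto simp: \<kappa>_def\<close>)
    show "\<kappa> * (y - x) \<le> G y - G x" if "0 \<le> x" "x \<le> y" "y \<le> M\<^sub>0" for x y
    proof (rule G_diff(1)[OF that(2)])
      show "\<kappa> \<le> g z" if "x < z" "z \<le> y" for z
        using \<epsilon>g(2)[of z] that \<open>0 \<le> x\<close> \<open>y \<le> M\<^sub>0\<close> by (auto simp: \<kappa>_def)
    qed (use \<epsilon>f(1) \<epsilon>g(1) in \<open>auto simp: \<kappa>_def\<close>)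
    show "G y - G x \<le> \<beta> * (y - x)" if "0 \<le> x" "x \<le> y" "y \<le> M\<^sub>0" for x y
    proof (rule G_diff(2)[OF that(2)])
      show "g z \<le> \<beta>" if "x < z" "z \<le> y" for z
        using g_upper[of z] that \<open>0 \<le> x\<close> \<open>y \<le> M\<^sub>0\<close> nonneg by (auto simp: \<beta>_def)
    qed (use nonneg in \<open>auto simp: \<beta>_def\<close>)
    show "F\<^sub>0 y - F\<^sub>0 x \<le> \<beta> * (y - x)" if "t - w \<le> x" "x \<le> y" "y \<le> t + w" for x y
    proof (rule F_diff(2)[OF that(2)])
      show "f\<^sub>0 z \<le> \<beta>" if "x < z" "z \<le> y" for z
      proof -
        have "\<bar>z - t\<bar> < r'" using that \<open>t - w \<le> x\<close> \<open>y \<le> t + w\<close> w by linarith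
        then have "f\<^sub>0 z < f\<^sub>0 t + 1" by (intro r'(2)) (simp add: dist_real_def)
        then show ?thesis unfolding \<beta>_def using nonneg by linarith
      qed
    qed (use nonneg in \<open>auto simp: \<beta>_def\<close>)
    show "\<kappa> \<le> g x" if "0 \<le> x" "x \<le> M\<^sub>0" for x using \<epsilon>g(2)[of x] that by (auto simp: \<kappa>_def)
    show "\<bar>g x - g y\<bar> \<le> \<beta> * \<bar>x - y\<bar>" if "0 \<le> x" "x \<le> M\<^sub>0" "0 \<le> y" "y \<le> M\<^sub>0" for x y
    proof -
      have "\<bar>g x - g y\<bar> \<le> \<bar>B\<bar> * \<bar>x - y\<bar>" using g_lip that by auto
      also have "\<dots> \<le> \<beta> * \<bar>x - y\<bar>" using nonneg by (intro mult_right_mono) (auto simp: \<beta>_def)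
      finally show ?thesis .
    qed
    show "(F\<^sub>0 has_real_derivative f\<^sub>0 x) (at x)" if "\<bar>x - t\<bar> < w" for x
      using cdf_density_has_derivative[OF X_real X_distr f0_meas f0_density(2) f0_cont] that w
      by (simp add: F0_cdf dist_real_def)
  qed (use T_distr g_meas g_density(2) w f0_deriv in auto)
  have variance_pos: "0 < F\<^sub>0 t * (1 - F\<^sub>0 t) / g t * (\<integral>u. (k u)\<^sup>2 \<partial>lborel)"
    using F_interior g_lower[of t] t_pos t_less pos integral_k_squared_pos by simp
  show ?thesis
  proof (intro conjI allI impI)
    fix c :: real assume "0 < c"
    from smle_weak_conv[OF this]
    show "weak_conv_m (\<lambda>n. distr M borel (\<lambda>\<omega>. real n powr (2/5) *
               (smle k (c * real n powr (- 1/5)) n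
                  (\<lambda>i. T i \<omega>) (\<lambda>i. of_bool (X i \<omega> \<le> T i \<omega>)) t - F\<^sub>0 t)))
            (density lborel (normal_density (mu_SM k f\<^sub>0 t c) (sqrt (sigma2_SM k F\<^sub>0 g t c))))"
      by (simp only: mu_SM_def sigma2_SM_def)
  next
    fix c :: real
    show "is_arg_min (amse_SM k F\<^sub>0 f\<^sub>0 g t) (\<lambda>c. 0 < c) c \<longleftrightarrow> c = c_SM k F\<^sub>0 f\<^sub>0 g t"
      unfolding c_SM_def
      by (rule bandwidth_constant_optimal[OF variance_pos second_moment_pos f0'_nz])
         (simp add: amse_SM_def mu_SM_def sigma2_SM_def field_simps)
  qed
qed

end
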